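(* Let $0<\alpha<1$, $a>0$, $J=[0,a]$, let $E$ and $U$ be Hilbert spaces and $X=L^2(J,E)$. Let $A$ be the infinitesimal generator of a $C_0$-semigroup of bounded operators on $E$, and suppose $A\in\mathcal{A}^\alpha(\omega_0,\theta_0)$ for some $\theta_0\in(0,\frac{\pi}{2}]$ and $\omega_0\in\mathbb{R}$. Assume that the $\alpha$-order solution operator $\{T_\alpha(t)\}_{t\ge 0}$ and the $\alpha$-order resolvent operator $\{S_\alpha(t)\}$ generated by $A$ are compact. Let $B:L^2(J,U)\to X$ be a bounded linear operator with range $R(B)$, let $f:J\times E\to E$, let $t_1,\dots,t_m\in J$ and $c_1,\dots,c_m\in\mathbb{R}$ with $\sum_{k=1}^m|c_k|<1/M_T$, where $M_T=\sup_{t\ge0}\|T_\alpha(t)\|_{\mathcal{L}(E)}$. Let the Green's function $G$, the operator $L:X\to E$, the Nemytskii operator $F:X\to X$ and the solution map $W$ be as defined in the context, and suppose: (A') for every $p\in X$ there exists $q\in R(B)$ such that $L(p)=L(q)$; (B') the solution map $W:\overline{R(B)}\to X$ is (well defined and) compact and continuous; (C') $F$ is uniformly bounded in $X$: there is a constant $M\ge 0$ with $\|Fz\|_X\le M$ for all $z\in X$. Then the fractional evolution system $${}^{C}D^{\alpha}u(t)=Au(t)+(Bv)(t)+f(t,u(t)),\quad t\in J,\qquad u(0)=\sum_{k=1}^m c_k u(t_k),$$ is approximately controllable on $J$; that is, the set of terminal values $u(a)$ of mild solutions $u$ of this system, as the control $v$ ranges over $L^2(J,U)$, is dense in $E$.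
   Context: ${}^{C}D^\alpha$ is the Caputo derivative of order $\alpha$ with lower limit $0$. $\mathcal{L}(E)$ is the space of bounded linear operators on $E$. All integrals of $E$-valued functions are Bochner integrals. Solution operator. A function $T_\alpha:[0,\infty)\to\mathcal{L}(E)$ is an $\alpha$-order solution operator generated by $A$ if: (i) $T_\alpha$ is strongly continuous on $[0,\infty)$ and $T_\alpha(0)=I$; (ii) $T_\alpha(t)D(A)\subseteq D(A)$ and $AT_\alpha(t)x=T_\alpha(t)Ax$ for all $x\in D(A)$, $t\ge0$; (iii) for every $x\in D(A)$, $u(t)=T_\alpha(t)x$ satisfies $u(t)=x+\frac{1}{\Gamma(\alpha)}\int_0^t(t-s)^{\alpha-1}Au(s)\,ds$ for $t\ge0$. Analyticity. With $\Sigma_\theta=\{z\in\mathbb{C}\setminus\{0\}:|\arg z|<\theta\}$, $0<\theta_0\le\pi/2$, $\omega_0\in\mathbb{R}$, write $A\in\mathcal{A}^\alpha(\omega_0,\theta_0)$ if $A$ generates an $\alpha$-order solution operator $T_\alpha$ that has an analytic extension to $\Sigma_{\theta_0}$, strongly continuous on $\Sigma_\theta$ for every $\theta\in(0,\theta_0)$, and such that for each $\theta\in(0,\theta_0)$ and $\omega>\omega_0$ there is a constant $M=M(\omega,\theta)>0$ with $\|T_\alpha(z)\|\le Me^{\omega\,\mathrm{Re}\,z}$ for $z\in\Sigma_\theta$. Resolvent operator. The $\alpha$-order resolvent operator generated by $A$ is a strongly continuous function $S_\alpha:(0,\infty)\to\mathcal{L}(E)$ such that for some $\omega\ge0$ one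 has $\{\nu\in\mathbb{C}:\mathrm{Re}\,\nu>\omega\}\subset\rho(A)$ and $(\nu^\alpha I-A)^{-1}x=\int_0^\infty e^{-\nu t}S_\alpha(t)x\,dt$ for $\mathrm{Re}\,\nu>\omega$, $x\in E$. $T_\alpha$ (resp. $S_\alpha$) is called compact if $T_\alpha(t)$ (resp. $S_\alpha(t)$) is a compact operator for every $t>0$. Green's function. Since $\sum_k|c_k|<1/M_T$, the operator $\mathcal{O}=\left(I-\sum_{k=1}^m c_kT_\alpha(t_k)\right)^{-1}\in\mathcal{L}(E)$ exists. Define for $t,s\in[0,a]$ $$G(t,s)=\sum_{k=1}^m\chi_{t_k}(s)\,T_\alpha(t)\,\mathcal{O}\,S_\alpha(t_k-s)+\chi_t(s)\,S_\alpha(t-s),$$ where in the sum $\chi_{t_k}(s)=c_k$ if $s\in[0,t_k)$ and $0$ if $s\in[t_k,a]$, and in the last term $\chi_t(s)=1$ if $s\in[0,t)$ and $0$ if $s\in[t,a]$ (terms with zero coefficient are zero). Operator $L$. $L:X\to E$ is $Lp=\int_0^a G(a,s)p(s)\,ds$, taken to be a well-defined bounded linear operator. Nemytskii operator. $F:X\to X$, $[Fz](t)=f(t,z(t))$ (assumed to map $X$ into $X$). Mild solutions. For $v\in L^2(J,U)$, a mild solution of the system is $u\in C(J,E)$ with $u(t)=\int_0^aG(t,s)[(Bv)(s)+f(s,u(s))]\,ds$ for all $t\in J$. Solution map. $W:\overline{R(B)}\to X$ (closure of $R(B)$ in $X$) is defined by $W\mu=y$, where $y\in C(J,E)$ is the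 unique mild solution of ${}^{C}D^\alpha y(t)=Ay(t)+\mu(t)+f(t,y(t))$, $y(0)=\sum_{k=1}^mc_ky(t_k)$, i.e. the unique $y\in C(J,E)$ with $y(t)=\int_0^aG(t,s)[\mu(s)+f(s,y(s))]\,ds$ for all $t\in J$. That $W$ is well defined (existence and uniqueness for every $\mu\in\overline{R(B)}$) is part of hypothesis (B'). Compact means that bounded sets are mapped to relatively compact sets. *)

theory Defs
  imports "HOL-Analysis.Analysis"
begin

section \<open>Complex Hilbert spaces and their operators\<close>

text \<open>The inherited real inner product is the real part of \<open>cinner\<close>; \<open>cinner\<close> is linear in its
  first argument.  Separability is not part of the class.\<close>

class complex_hilbert = banach + real_inner +
  fixes scaleC :: "complex \<Rightarrow> 'a \<Rightarrow> 'a" (infixr "*\<^sub>C" 75)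
    and cinner :: "'a \<Rightarrow> 'a \<Rightarrow> complex"
  assumes scaleC_add_right: "c *\<^sub>C (x + y) = c *\<^sub>C x + c *\<^sub>C y"
    and scaleC_add_left: "(c + d) *\<^sub>C x = c *\<^sub>C x + d *\<^sub>C x"
    and scaleC_scaleC: "c *\<^sub>C (d *\<^sub>C x) = (c * d) *\<^sub>C x"
    and scaleC_one: "1 *\<^sub>C x = x"
    and scaleR_scaleC: "r *\<^sub>R x = complex_of_real r *\<^sub>C x"
    and cinner_add_left: "cinner (x + y) z = cinner x z + cinner y z"
    and cinner_scaleC_left: "cinner (c *\<^sub>C x) y = c * cinner x y"
    and cinner_commute: "cinner x y = cnj (cinner y x)"
    and inner_eq_Re_cinner: "inner x y = Re (cinner x y)"

instantiation complex :: complex_hilbert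
begin

definition scaleC_complex :: "complex \<Rightarrow> complex \<Rightarrow> complex" where
  "scaleC_complex c x = c * x"

definition cinner_complex :: "complex \<Rightarrow> complex \<Rightarrow> complex" where
  "cinner_complex x y = x * cnj y"

instance
  by standard
    (auto simp: scaleC_complex_def cinner_complex_def algebra_simps scaleR_conv_of_real
      inner_complex_def)

end

definition bounded_clinear :: "('a::complex_hilbert \<Rightarrow> 'b::complex_hilbert) \<Rightarrow> bool" where
  "bounded_clinear K \<longleftrightarrow> bounded_linear K \<and> (\<forall>c x. K (c *\<^sub>C x) = c *\<^sub>C K x)"

definition compact_operator :: "('a::complex_hilbert \<Rightarrow> 'b::complex_hilbert) \<Rightarrow> bool" where
  "compact_operator K \<longleftrightarrow>
     bounded_clinear K \<and> (\<forall>V. bounded V \<longrightarrow> compact (closure (K ` V)))"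


section \<open>Bochner integral and \<open>L\<^sup>2\<close> without separability\<close>

text \<open>The library's \<^const>\<open>has_bochner_integral\<close> has the same definition, but its type is
  restricted to second countable spaces.\<close>

definition has_bochner :: "'a measure \<Rightarrow> ('a \<Rightarrow> 'b::real_normed_vector) \<Rightarrow> 'b \<Rightarrow> bool" where
  "has_bochner M f x \<longleftrightarrow>
     f \<in> borel_measurable M \<and>
     (\<exists>s. (\<forall>i. Bochner_Integration.simple_bochner_integrable M (s i)) \<and>
          (\<lambda>i. \<integral>\<^sup>+ t. ennreal (norm (f t - s i t)) \<partial>M) \<longlonglongrightarrow> 0 \<and>
          (\<lambda>i. Bochner_Integration.simple_bochner_integral M (s i)) \<longlonglongrightarrow> x)"

lemma has_bochner_iff_has_bochner_integral:
  fixes f :: "'a \<Rightarrow> 'b::{real_normed_vector, second_countable_topology}"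
  shows "has_bochner M f x \<longleftrightarrow> has_bochner_integral M f x"
  unfolding has_bochner_def has_bochner_integral.simps by blast

definition strongly_measurable :: "'a measure \<Rightarrow> ('a \<Rightarrow> 'b::topological_space) \<Rightarrow> bool" where
  "strongly_measurable M f \<longleftrightarrow>
     (\<exists>s. (\<forall>i. simple_function M (s i)) \<and> (AE t in M. (\<lambda>i. s i t) \<longlonglongrightarrow> f t))"

text \<open>Elements of \<open>L\<^sup>2([0,a],E)\<close> are represented by functions on \<open>\<real>\<close> of which only the restriction
  to \<open>[0,a]\<close> matters.  No quotient is formed: \<open>L2_norm\<close> is a seminorm on the representatives which
  vanishes exactly on the functions that are zero almost everywhere on \<open>[0,a]\<close>, and
  \<open>L2_topology\<close> is the (non-Hausdorff) topology of the corresponding pseudometric.  Its open and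
  closed sets, closures, compact sets and continuous maps are the preimages or lifts of those of
  the quotient.\<close>

definition L2 :: "real \<Rightarrow> (real \<Rightarrow> 'e::complex_hilbert) set" where
  "L2 a = {p. strongly_measurable (lebesgue_on {0..a}) p \<and>
              integrable (lebesgue_on {0..a}) (\<lambda>t. (norm (p t))\<^sup>2)}"

definition L2_norm :: "real \<Rightarrow> (real \<Rightarrow> 'e::complex_hilbert) \<Rightarrow> real" where
  "L2_norm a p = sqrt (integral\<^sup>L (lebesgue_on {0..a}) (\<lambda>t. (norm (p t))\<^sup>2))"

definition L2_topology :: "real \<Rightarrow> (real \<Rightarrow> 'e::complex_hilbert) topology" where
  "L2_topology a = topology (\<lambda>V. V \<subseteq> L2 a \<and>
     (\<forall>p\<in>V. \<exists>r>0. {q \<in> L2 a. L2_norm a (\<lambda>t. q t - p t) < r} \<subseteq> V))"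

lemma openin_L2_topology:
  "openin (L2_topology a) V \<longleftrightarrow>
     V \<subseteq> L2 a \<and> (\<forall>p\<in>V. \<exists>r>0. {q \<in> L2 a. L2_norm a (\<lambda>t. q t - p t) < r} \<subseteq> V)"
proof -
  let ?P = "\<lambda>V. V \<subseteq> L2 a \<and> (\<forall>p\<in>V. \<exists>r>0. {q \<in> L2 a. L2_norm a (\<lambda>t. q t - p t) < r} \<subseteq> V)"
  have "?P (V1 \<inter> V2)" if V: "?P V1" "?P V2" for V1 V2
  proof (intro conjI ballI)
    fix p assume p: "p \<in> V1 \<inter> V2"
    obtain r1 where r1: "r1 > 0" "{q \<in> L2 a. L2_norm a (\<lambda>t. q t - p t) < r1} \<subseteq> V1"
      using V(1) p by blast
    obtain r2 where r2: "r2 > 0" "{q \<in> L2 a. L2_norm a (\<lambda>t. q t - p t) < r2} \<subseteq> V2"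
      using V(2) p by blast
    show "\<exists>r>0. {q \<in> L2 a. L2_norm a (\<lambda>t. q t - p t) < r} \<subseteq> V1 \<inter> V2"
      using r1 r2 by (intro exI[of _ "min r1 r2"]) auto
  qed (use V in auto)
  moreover have "?P (\<Union>\<V>)" if "\<forall>V\<in>\<V>. ?P V" for \<V>
    using that by (meson Sup_least Union_iff Union_upper subset_trans)
  ultimately have "istopology ?P"
    unfolding istopology_def by blast
  then show ?thesis
    unfolding L2_topology_def by (rule fun_cong[OF topology_inverse'])
qed

lemma topspace_L2_topology [simp]: "topspace (L2_topology a) = L2 a"
proof
  have "openin (L2_topology a) (L2 a)"
    unfolding openin_L2_topology by (auto intro: exI[of _ 1])
  then show "L2 a \<subseteq> topspace (L2_topology a)"
    by (rule openin_subset)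
  show "topspace (L2_topology a) \<subseteq> L2 a"
    using openin_topspace[of "L2_topology a"] unfolding openin_L2_topology by blast
qed

definition bounded_clinear_L2 ::
    "real \<Rightarrow> ((real \<Rightarrow> 'u::complex_hilbert) \<Rightarrow> (real \<Rightarrow> 'e::complex_hilbert)) \<Rightarrow> bool" where
  "bounded_clinear_L2 a B \<longleftrightarrow>
     (\<forall>v\<in>L2 a. B v \<in> L2 a) \<and>
     (\<forall>v\<in>L2 a. \<forall>w\<in>L2 a. AE t in lebesgue_on {0..a}. B (\<lambda>s. v s + w s) t = B v t + B w t) \<and>
     (\<forall>c. \<forall>v\<in>L2 a. AE t in lebesgue_on {0..a}. B (\<lambda>s. c *\<^sub>C v s) t = c *\<^sub>C B v t) \<and>
     (\<exists>C. \<forall>v\<in>L2 a. L2_norm a (B v) \<le> C * L2_norm a v)"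

definition compact_map_L2 ::
    "real \<Rightarrow> (real \<Rightarrow> 'e::complex_hilbert) set \<Rightarrow>
     ((real \<Rightarrow> 'e) \<Rightarrow> (real \<Rightarrow> 'e)) \<Rightarrow> bool" where
  "compact_map_L2 a Y W \<longleftrightarrow>
     W ` Y \<subseteq> L2 a \<and>
     (\<forall>V \<subseteq> Y. (\<exists>C. \<forall>\<mu>\<in>V. L2_norm a \<mu> \<le> C) \<longrightarrow>
        compactin (L2_topology a) (L2_topology a closure_of (W ` V)))"


section \<open>Semigroups, solution operators and resolvent operators\<close>

text \<open>An unbounded operator is given by its domain \<open>D\<close> and a function \<open>A\<close> whose values outside \<open>D\<close>
  are irrelevant.\<close>

definition C0_semigroup :: "(real \<Rightarrow> 'e::complex_hilbert \<Rightarrow> 'e) \<Rightarrow> bool" where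
  "C0_semigroup Q \<longleftrightarrow>
     (\<forall>t\<ge>0. bounded_clinear (Q t)) \<and>
     (\<forall>x. Q 0 x = x) \<and>
     (\<forall>s\<ge>0. \<forall>t\<ge>0. \<forall>x. Q (s + t) x = Q s (Q t x)) \<and>
     (\<forall>x. ((\<lambda>t. Q t x) \<longlongrightarrow> x) (at_right 0))"

definition infinitesimal_generator ::
    "'e::complex_hilbert set \<Rightarrow> ('e \<Rightarrow> 'e) \<Rightarrow> (real \<Rightarrow> 'e \<Rightarrow> 'e) \<Rightarrow> bool" where
  "infinitesimal_generator D A Q \<longleftrightarrow>
     D = {x. \<exists>y. ((\<lambda>h. (1 / h) *\<^sub>R (Q h x - x)) \<longlongrightarrow> y) (at_right 0)} \<and>
     (\<forall>x\<in>D. ((\<lambda>h. (1 / h) *\<^sub>R (Q h x - x)) \<longlongrightarrow> A x) (at_right 0))"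

definition solution_operator ::
    "real \<Rightarrow> 'e::complex_hilbert set \<Rightarrow> ('e \<Rightarrow> 'e) \<Rightarrow> (real \<Rightarrow> 'e \<Rightarrow> 'e) \<Rightarrow> bool" where
  "solution_operator \<alpha> D A T \<longleftrightarrow>
     (\<forall>t\<ge>0. bounded_clinear (T t)) \<and>
     (\<forall>x. continuous_on {0..} (\<lambda>t. T t x)) \<and>
     (\<forall>x. T 0 x = x) \<and>
     (\<forall>t\<ge>0. \<forall>x\<in>D. T t x \<in> D \<and> A (T t x) = T t (A x)) \<and>
     (\<forall>x\<in>D. \<forall>t\<ge>0. \<exists>I.
        has_bochner (lebesgue_on {0..t}) (\<lambda>s. (t - s) powr (\<alpha> - 1) *\<^sub>R A (T s x)) I \<and>
        T t x = x + (1 / Gamma \<alpha>) *\<^sub>R I)"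

definition sector :: "real \<Rightarrow> complex set" where
  "sector \<theta> = {z. z \<noteq> 0 \<and> \<bar>Arg z\<bar> < \<theta>}"

text \<open>Analyticity with respect to the operator norm.\<close>

definition operator_analytic_on ::
    "(complex \<Rightarrow> 'e::complex_hilbert \<Rightarrow> 'e) \<Rightarrow> complex set \<Rightarrow> bool" where
  "operator_analytic_on T \<Omega> \<longleftrightarrow>
     (\<forall>z\<in>\<Omega>. bounded_clinear (T z)) \<and>
     (\<forall>z\<in>\<Omega>. \<exists>T'. bounded_clinear T' \<and>
        ((\<lambda>h. onorm (\<lambda>x. (1 / h) *\<^sub>C (T (z + h) x - T z x) - T' x)) \<longlongrightarrow> 0) (at 0))"

definition analytic_class ::
    "real \<Rightarrow> real \<Rightarrow> real \<Rightarrow> 'e::complex_hilbert set \<Rightarrow> ('e \<Rightarrow> 'e) \<Rightarrow> bool" where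
  "analytic_class \<alpha> \<omega>\<^sub>0 \<theta>\<^sub>0 D A \<longleftrightarrow>
     (\<exists>T T\<^sub>C. solution_operator \<alpha> D A T \<and>
        (\<forall>t>0. \<forall>x. T\<^sub>C (complex_of_real t) x = T t x) \<and>
        operator_analytic_on T\<^sub>C (sector \<theta>\<^sub>0) \<and>
        (\<forall>\<theta>. 0 < \<theta> \<and> \<theta> < \<theta>\<^sub>0 \<longrightarrow> (\<forall>x. continuous_on (sector \<theta>) (\<lambda>z. T\<^sub>C z x))) \<and>
        (\<forall>\<theta> \<omega>. 0 < \<theta> \<and> \<theta> < \<theta>\<^sub>0 \<and> \<omega> > \<omega>\<^sub>0 \<longrightarrow>
           (\<exists>M>0. \<forall>z\<in>sector \<theta>. onorm (T\<^sub>C z) \<le> M * exp (\<omega> * Re z))))"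

definition resolvent :: "'e::complex_hilbert set \<Rightarrow> ('e \<Rightarrow> 'e) \<Rightarrow> complex \<Rightarrow> 'e \<Rightarrow> 'e" where
  "resolvent D A \<nu> = inv_into D (\<lambda>x. \<nu> *\<^sub>C x - A x)"

definition resolvent_set :: "'e::complex_hilbert set \<Rightarrow> ('e \<Rightarrow> 'e) \<Rightarrow> complex set" where
  "resolvent_set D A =
     {\<nu>. bij_betw (\<lambda>x. \<nu> *\<^sub>C x - A x) D UNIV \<and> bounded_clinear (resolvent D A \<nu>)}"

text \<open>The powers \<open>\<nu>\<^sup>\<alpha>\<close> are principal values.  That \<open>\<nu>\<^sup>\<alpha>\<close> lies in the resolvent set is what gives
  the operator \<open>(\<nu>\<^sup>\<alpha> I - A)\<^sup>-\<^sup>1\<close> in the Laplace transform formula its meaning.\<close>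

definition resolvent_operator ::
    "real \<Rightarrow> 'e::complex_hilbert set \<Rightarrow> ('e \<Rightarrow> 'e) \<Rightarrow> (real \<Rightarrow> 'e \<Rightarrow> 'e) \<Rightarrow> bool" where
  "resolvent_operator \<alpha> D A S \<longleftrightarrow>
     (\<forall>t>0. bounded_clinear (S t)) \<and>
     (\<forall>x. continuous_on {0<..} (\<lambda>t. S t x)) \<and>
     (\<exists>\<omega>\<ge>0. \<forall>\<nu>. Re \<nu> > \<omega> \<longrightarrow>
        \<nu> \<in> resolvent_set D A \<and>
        \<nu> powr complex_of_real \<alpha> \<in> resolvent_set D A \<and>
        (\<forall>x. has_bochner (lebesgue_on {0<..}) (\<lambda>t. exp (- (\<nu> * complex_of_real t)) *\<^sub>C S t x)
               (resolvent D A (\<nu> powr complex_of_real \<alpha>) x)))"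


section \<open>The nonlocal problem\<close>

text \<open>\<open>M\<^sub>T\<close>, with value \<open>\<infinity>\<close> if the norms are unbounded.\<close>

definition sup_norm_solop :: "(real \<Rightarrow> 'e::complex_hilbert \<Rightarrow> 'e) \<Rightarrow> ennreal" where
  "sup_norm_solop T = (SUP t\<in>{0..}. ennreal (onorm (T t)))"

definition nonlocal_inverse ::
    "(real \<Rightarrow> 'e::complex_hilbert \<Rightarrow> 'e) \<Rightarrow> nat \<Rightarrow> (nat \<Rightarrow> real) \<Rightarrow> (nat \<Rightarrow> real) \<Rightarrow> 'e \<Rightarrow> 'e" where
  "nonlocal_inverse T m c \<tau> = inv (\<lambda>x. x - (\<Sum>k=1..m. c k *\<^sub>R T (\<tau> k) x))"

definition green ::
    "(real \<Rightarrow> 'e::complex_hilbert \<Rightarrow> 'e) \<Rightarrow> (real \<Rightarrow> 'e \<Rightarrow> 'e) \<Rightarrow> nat \<Rightarrow>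
     (nat \<Rightarrow> real) \<Rightarrow> (nat \<Rightarrow> real) \<Rightarrow> real \<Rightarrow> real \<Rightarrow> 'e \<Rightarrow> 'e" where
  "green T S m c \<tau> t s x =
     (\<Sum>k=1..m. if s \<in> {0..<\<tau> k}
                 then c k *\<^sub>R T t (nonlocal_inverse T m c \<tau> (S (\<tau> k - s) x)) else 0) +
     (if s \<in> {0..<t} then S (t - s) x else 0)"

text \<open>Mild solutions of \<open>\<^sup>CD\<^sup>\<alpha> y(t) = A y(t) + \<mu>(t) + f(t, y(t))\<close> on \<open>[0,a]\<close> with
  \<open>y(0) = \<Sum>\<^sub>k c\<^sub>k y(t\<^sub>k)\<close>; \<open>\<alpha>\<close>, \<open>A\<close> and the nonlocal condition enter through the Green's function \<open>G\<close>.\<close>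

definition mild_solution ::
    "real \<Rightarrow> (real \<Rightarrow> real \<Rightarrow> 'e::complex_hilbert \<Rightarrow> 'e) \<Rightarrow> (real \<Rightarrow> 'e \<Rightarrow> 'e) \<Rightarrow>
     (real \<Rightarrow> 'e) \<Rightarrow> (real \<Rightarrow> 'e) \<Rightarrow> bool" where
  "mild_solution a G f \<mu> y \<longleftrightarrow>
     continuous_on {0..a} y \<and>
     (\<forall>t\<in>{0..a}. has_bochner (lebesgue_on {0..a}) (\<lambda>s. G t s (\<mu> s + f s (y s))) (y t))"

text \<open>Functions in \<open>C([0,a],E)\<close> are likewise identified when they agree on \<open>[0,a]\<close>.\<close>

definition is_solution_map ::
    "real \<Rightarrow> (real \<Rightarrow> real \<Rightarrow> 'e::complex_hilbert \<Rightarrow> 'e) \<Rightarrow> (real \<Rightarrow> 'e \<Rightarrow> 'e) \<Rightarrow>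
     (real \<Rightarrow> 'e) set \<Rightarrow> ((real \<Rightarrow> 'e) \<Rightarrow> (real \<Rightarrow> 'e)) \<Rightarrow> bool" where
  "is_solution_map a G f Y W \<longleftrightarrow>
     (\<forall>\<mu>\<in>Y. mild_solution a G f \<mu> (W \<mu>) \<and>
        (\<forall>y. mild_solution a G f \<mu> y \<longrightarrow> (\<forall>t\<in>{0..a}. y t = W \<mu> t)))"

text \<open>\<open>L p = \<integral>\<^sub>0\<^sup>a G(a,s) p(s) ds\<close>; linearity follows from that of the integral.\<close>

definition is_terminal_operator ::
    "real \<Rightarrow> (real \<Rightarrow> real \<Rightarrow> 'e::complex_hilbert \<Rightarrow> 'e) \<Rightarrow> ((real \<Rightarrow> 'e) \<Rightarrow> 'e) \<Rightarrow> bool" where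
  "is_terminal_operator a G L \<longleftrightarrow>
     (\<forall>p\<in>L2 a. has_bochner (lebesgue_on {0..a}) (\<lambda>s. G a s (p s)) (L p)) \<and>
     (\<exists>C. \<forall>p\<in>L2 a. norm (L p) \<le> C * L2_norm a p)"

definition nemytskii :: "(real \<Rightarrow> 'e \<Rightarrow> 'e) \<Rightarrow> (real \<Rightarrow> 'e) \<Rightarrow> (real \<Rightarrow> 'e)" where
  "nemytskii f z = (\<lambda>t. f t (z t))"

definition approximately_controllable ::
    "real \<Rightarrow> (real \<Rightarrow> real \<Rightarrow> 'e::complex_hilbert \<Rightarrow> 'e) \<Rightarrow> (real \<Rightarrow> 'e \<Rightarrow> 'e) \<Rightarrow>
     ((real \<Rightarrow> 'u::complex_hilbert) \<Rightarrow> (real \<Rightarrow> 'e)) \<Rightarrow> bool" where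
  "approximately_controllable a G f B \<longleftrightarrow>
     closure {u a | u v. v \<in> L2 a \<and> mild_solution a G f (B v) u} = UNIV"

end

theory Submission
  imports Defs "HOL-Complex_Analysis.Complex_Analysis"
begin

text \<open>Since the Nemytskii operator need not be continuous, Schauder's theorem in \<open>L\<^sup>2\<close> is replaced by a
  finite-dimensional argument.  The operator \<open>L\<close> is compact, so \<open>{L h | \<parallel>h\<parallel> \<le> M}\<close> has a finite net \<open>L h\<^sub>i\<close>,
  and by (A') \<open>L h\<^sub>i = L(B v\<^sub>i)\<close>.  Given a target \<open>L p = L(B v\<^sub>0)\<close>, put
  \<open>v\<^sub>\<lambda> = v\<^sub>0 - \<Sum>\<^sub>i \<lambda>\<^sub>i v\<^sub>i\<close> and let \<open>\<lambda>\<close> be a Brouwer fixed point of the map sending \<open>\<lambda>\<close> to the Schauder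
  projection weights of \<open>L F W(B v\<^sub>\<lambda>)\<close>; then \<open>L(B v\<^sub>\<lambda> + F W(B v\<^sub>\<lambda>))\<close> is close to \<open>L p\<close>.

  Density of the range of \<open>L\<close>, its compactness, and the equicontinuity of trajectories at \<open>a\<close> all follow from
  norm estimates for \<open>S\<^sub>\<alpha>\<close>.  By uniqueness of Laplace transforms the primitive of \<open>S\<^sub>\<alpha>\<close> is the fractional
  integral of order \<open>\<alpha>\<close> of the solution operator in the definition of \<open>\<A>\<^sup>\<alpha>(\<omega>\<^sub>0,\<theta>\<^sub>0)\<close>, whose derivatives of order
  \<open>k\<close> are \<open>O(t\<^sup>-\<^sup>k)\<close> by Cauchy's inequality in a sector.  Hence \<open>\<parallel>S\<^sub>\<alpha>(t)\<parallel> \<le> C t\<^sup>\<alpha>\<^sup>-\<^sup>1\<close> and \<open>S\<^sub>\<alpha>\<close> is continuous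
  in operator norm; boundedness of \<open>L\<close> forces \<open>\<alpha> > 1/2\<close>.\<close>


section \<open>Bochner integrals and \<open>L\<^sup>2\<close>\<close>

text \<open>Brouwer's theorem needs \<lambda> \<mapsto> L F W(B v) to be continuous, v being the
  control for \<lambda>. The mild solution formula at the right end reads W(\<mu>)(a) = L \<mu> + L
  F W(\<mu>), so L F W(B v) is a terminal value minus L(B v), and the latter is affine in \<lambda>.
  W is continuous into L2, where single values have no meaning; but the forcing terms B v + F W(B v)
  stay in one bounded set, hence the trajectories are equicontinuous at a, and convergence in L2
  implies convergence of the terminal values.

  The other obstacle is the singularity of S at 0. Estimates of the Green's function split off short
  intervals before a, t and the nodes, where s^(\<alpha> - 1) is small in L2; on what remains, S is
  norm continuous with compact values on some [\<delta>, a], and one finite net serves all of it.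

  E need not be separable, so vector integrals are paired with a vector y and treated as real
  integrals; bounds uniform in y lead back to norms.\<close>

text \<open>In a non-separable space a difference of two Borel functions can fail to be Borel. A
  simple function has finitely many values, so the difference is pieced together from the functions
  f - v with v fixed.\<close>

lemma borel_measurable_norm_diff_simple:
  fixes f s :: "'a \<Rightarrow> 'b::real_normed_vector"
  assumes f: "f \<in> borel_measurable M" and s: "simple_function M s"
  shows "(\<lambda>t. norm (f t - s t)) \<in> borel_measurable M"
proof -
  have s': "s \<in> measurable M (count_space (s ` space M))"
    using s measurable_simple_function[OF s]
    by (intro measurable_count_space_eq2[THEN iffD2]) (auto simp: simple_function_def)
  have c: "countable (s ` space M)"
    using s by (simp add: simple_function_def uncountable_infinite countable_finite)
  have "(\<lambda>t. norm (f t - v)) \<in> borel_measurable M" for v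
    by (rule measurable_compose[OF f]) (intro borel_measurable_continuous_onI continuous_intros)
  then show ?thesis
    using measurable_compose_countable'[OF _ s' c, where f="\<lambda>v t. norm (f t - v)"] by simp
qed

text \<open>A bounded linear map sends the approximating simple functions to simple functions and
  enlarges the error by at most its operator bound. With l an inner product it turns vector
  integrals into real ones.\<close>

lemma has_bochner_bounded_linear:
  fixes l :: "'b::real_normed_vector \<Rightarrow> 'c::real_normed_vector"
  assumes l: "bounded_linear l" and f: "has_bochner M f x"
  shows "has_bochner M (\<lambda>t. l (f t)) (l x)"
proof -
  interpret l: bounded_linear l by fact
  obtain s where fm: "f \<in> borel_measurable M"
    and s: "\<And>i. Bochner_Integration.simple_bochner_integrable M (s i)"
    and lim: "(\<lambda>i. \<integral>\<^sup>+ t. ennreal (norm (f t - s i t)) \<partial>M) \<longlonglongrightarrow> 0"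
    and lim2: "(\<lambda>i. Bochner_Integration.simple_bochner_integral M (s i)) \<longlonglongrightarrow> x"
    using f unfolding has_bochner_def by blast
  have lm: "l \<in> borel_measurable borel"
    by (intro borel_measurable_continuous_onI l.continuous_on continuous_on_id)
  obtain K where K: "K > 0" "\<And>z. norm (l z) \<le> norm z * K"
    using l.pos_bounded by blast
  have sm: "simple_function M (s i)" for i
    using s[of i] by (cases rule: simple_bochner_integrable.cases)
  have *: "(\<integral>\<^sup>+ t. ennreal (norm (l (f t) - l (s i t))) \<partial>M)
      \<le> ennreal K * (\<integral>\<^sup>+ t. ennreal (norm (f t - s i t)) \<partial>M)" for i
  proof -
    have "(\<integral>\<^sup>+ t. ennreal (norm (l (f t) - l (s i t))) \<partial>M)
        \<le> (\<integral>\<^sup>+ t. ennreal K * ennreal (norm (f t - s i t)) \<partial>M)"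
      using K by (intro nn_integral_mono)
        (auto simp: ennreal_mult[symmetric] l.diff[symmetric] mult.commute intro!: ennreal_leI)
    also have "\<dots> = ennreal K * (\<integral>\<^sup>+ t. ennreal (norm (f t - s i t)) \<partial>M)"
      by (intro nn_integral_cmult measurable_compose[OF borel_measurable_norm_diff_simple[OF fm sm]])
        simp
    finally show ?thesis .
  qed
  have "(\<lambda>i. ennreal K * (\<integral>\<^sup>+ t. ennreal (norm (f t - s i t)) \<partial>M)) \<longlonglongrightarrow> 0"
    using ennreal_tendsto_cmult[OF _ lim, of "ennreal K"] by simp
  then have l1: "(\<lambda>i. \<integral>\<^sup>+ t. ennreal (norm (l (f t) - l (s i t))) \<partial>M) \<longlonglongrightarrow> 0"
    by (rule tendsto_sandwich[OF always_eventually[rule_format] always_eventually[rule_format]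
          tendsto_const, rotated -1]) (use * in auto)
  have l2: "(\<lambda>i. Bochner_Integration.simple_bochner_integral M (\<lambda>t. l (s i t))) \<longlonglongrightarrow> l x"
    using l.tendsto[OF lim2] s by (simp add: simple_bochner_integral_linear l.linear_axioms)
  have l3: "Bochner_Integration.simple_bochner_integrable M (\<lambda>t. l (s i t))" for i
    using s[of i] by (intro simple_bochner_integrable_compose2[where p="\<lambda>u v. l u" and g="s i", simplified])
      (auto simp: l.zero)
  show ?thesis
    unfolding has_bochner_def using measurable_compose[OF fm lm] l1 l2 l3
    by (intro conjI exI[of _ "\<lambda>i t. l (s i t)"]) auto
qed

lemma has_bochner_inner:
  fixes f :: "'a \<Rightarrow> 'b::real_inner"
  assumes "has_bochner M f x"
  shows "has_bochner_integral M (\<lambda>t. f t \<bullet> y) (x \<bullet> y)"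
  using has_bochner_bounded_linear[OF bounded_linear_inner_left assms]
  by (simp add: has_bochner_iff_has_bochner_integral)

text \<open>Pairing with z = x - y itself yields (norm z)^2 \<le> norm z * \<integral> b. Only real
  integrands occur, so measurability of the vector-valued difference is never at issue.\<close>

lemma norm_has_bochner_diff_le:
  fixes f g :: "'a \<Rightarrow> 'b::real_inner"
  assumes f: "has_bochner M f x" and g: "has_bochner M g y" and b: "integrable M b"
    and le: "AE t in M. norm (f t - g t) \<le> b t"
  shows "norm (x - y) \<le> (\<integral>t. b t \<partial>M)"
proof (cases "x = y")
  case True
  have "AE t in M. 0 \<le> b t"
    using le by eventually_elim (meson norm_ge_zero order.trans)
  then show ?thesis
    using True by (simp add: integral_nonneg_AE)
next
  case False
  let ?z = "x - y"
  have i: "has_bochner_integral M (\<lambda>t. f t \<bullet> ?z - g t \<bullet> ?z) (x \<bullet> ?z - y \<bullet> ?z)"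
    using has_bochner_inner[OF f] has_bochner_inner[OF g] by (rule has_bochner_integral_diff)
  have "(norm ?z)\<^sup>2 = (\<integral>t. f t \<bullet> ?z - g t \<bullet> ?z \<partial>M)"
    using i by (simp add: has_bochner_integral_iff power2_norm_eq_inner inner_diff_left)
  also have "\<dots> \<le> (\<integral>t. norm ?z * b t \<partial>M)"
  proof (rule integral_mono_AE)
    show "AE t in M. f t \<bullet> ?z - g t \<bullet> ?z \<le> norm ?z * b t"
      using le
    proof eventually_elim
      case (elim t)
      have "f t \<bullet> ?z - g t \<bullet> ?z \<le> norm (f t - g t) * norm ?z"
        using norm_cauchy_schwarz[of "f t - g t" ?z] by (simp add: inner_diff_left)
      also have "\<dots> \<le> norm ?z * b t"
        using mult_left_mono[OF elim norm_ge_zero[of ?z]] by (simp add: mult.commute)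
      finally show ?case .
    qed
  qed (use i b in \<open>auto simp: has_bochner_integral_iff\<close>)
  also have "\<dots> = norm ?z * (\<integral>t. b t \<partial>M)"
    by simp
  finally show ?thesis
    using False by (simp add: power2_eq_square)
qed

lemma has_bochner_zero: "has_bochner M (\<lambda>t. 0 :: 'b::real_normed_vector) 0"
proof -
  have "Bochner_Integration.simple_bochner_integrable M (\<lambda>t. 0 :: 'b)"
    by (intro simple_bochner_integrable.intros) auto
  moreover have "Bochner_Integration.simple_bochner_integral M (\<lambda>t. 0 :: 'b) = 0"
    by (auto simp: simple_bochner_integral_def intro: sum.neutral)
  ultimately show ?thesis
    unfolding has_bochner_def by (intro conjI exI[of _ "\<lambda>i t. 0"]) auto
qed

lemma norm_has_bochner_le:
  fixes f :: "'a \<Rightarrow> 'b::real_inner"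
  assumes "has_bochner M f x" "integrable M b" "AE t in M. norm (f t) \<le> b t"
  shows "norm x \<le> (\<integral>t. b t \<partial>M)"
  using norm_has_bochner_diff_le[OF assms(1) has_bochner_zero assms(2)] assms(3) by simp

text \<open>Integrating 2 l |f g| \<le> l^2 f^2 + g^2 bounds a linear function of l by a quadratic
  one; l = I / A is the optimal choice, and for A = 0 a large l is contradictory unless I =
  0.\<close>

lemma Cauchy_Schwarz_integral:
  fixes f g :: "'a \<Rightarrow> real"
  assumes [measurable]: "f \<in> borel_measurable M" "g \<in> borel_measurable M"
    and f: "integrable M (\<lambda>x. (f x)\<^sup>2)" and g: "integrable M (\<lambda>x. (g x)\<^sup>2)"
  shows "integrable M (\<lambda>x. f x * g x)"
    and "(\<integral>x. \<bar>f x * g x\<bar> \<partial>M) \<le> sqrt (\<integral>x. (f x)\<^sup>2 \<partial>M) * sqrt (\<integral>x. (g x)\<^sup>2 \<partial>M)"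
proof -
  have le: "\<bar>f x * g x\<bar> \<le> (f x)\<^sup>2 + (g x)\<^sup>2" for x
  proof -
    have "\<bar>f x\<bar> * \<bar>g x\<bar> \<ge> 0"
      by simp
    then show ?thesis
      using sum_squares_bound[of "\<bar>f x\<bar>" "\<bar>g x\<bar>"] unfolding abs_mult power2_abs by linarith
  qed
  show i: "integrable M (\<lambda>x. f x * g x)"
    by (rule Bochner_Integration.integrable_bound[OF Bochner_Integration.integrable_add[OF f g]])
      (use le in \<open>simp_all\<close>)
  define A B I where "A = (\<integral>x. (f x)\<^sup>2 \<partial>M)" and "B = (\<integral>x. (g x)\<^sup>2 \<partial>M)" and
    "I = (\<integral>x. \<bar>f x * g x\<bar> \<partial>M)"
  have nn: "A \<ge> 0" "B \<ge> 0" "I \<ge> 0"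
    unfolding A_def B_def I_def by auto
  have q: "2 * l * I \<le> l\<^sup>2 * A + B" if l: "l \<ge> 0" for l
  proof -
    have "(\<integral>x. 2 * l * \<bar>f x * g x\<bar> \<partial>M) \<le> (\<integral>x. l\<^sup>2 * (f x)\<^sup>2 + (g x)\<^sup>2 \<partial>M)"
    proof (rule integral_mono)
      fix x
      show "2 * l * \<bar>f x * g x\<bar> \<le> l\<^sup>2 * (f x)\<^sup>2 + (g x)\<^sup>2"
        using sum_squares_bound[of "l * \<bar>f x\<bar>" "\<bar>g x\<bar>"] l
        by (simp add: abs_mult power_mult_distrib mult.assoc)
    qed (use i f g in auto)
    then show ?thesis
      using f g unfolding A_def B_def I_def by simp
  qed
  have "I\<^sup>2 \<le> A * B"
  proof (cases "A = 0")
    case True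
    have "I = 0"
    proof (rule ccontr)
      assume "I \<noteq> 0"
      then have "I > 0" using nn by simp
      then show False
        using q[of "(B + 1) / (2 * I)"] True nn by simp
    qed
    then show ?thesis using True by simp
  next
    case False
    then have "A > 0" using nn by simp
    then show ?thesis
      using q[of "I / A"] nn by (simp add: field_simps power2_eq_square)
  qed
  then show "I \<le> sqrt A * sqrt B"
    by (simp add: real_le_rsqrt real_sqrt_mult[symmetric])
qed

section \<open>Strong measurability and the seminorm of L2\<close>

text \<open>Completeness of Lebesgue measure, applied to extensions by zero outside S. It enters
  because \<open>strongly_measurable\<close> only asks for convergence almost everywhere.\<close>

lemma borel_measurable_lebesgue_on_AE_cong:
  fixes f g :: "real \<Rightarrow> real"
  assumes S: "S \<in> sets lebesgue" and f: "f \<in> borel_measurable (lebesgue_on S)"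
    and ae: "AE x in lebesgue_on S. f x = g x"
  shows "g \<in> borel_measurable (lebesgue_on S)"
proof -
  have "(\<lambda>x. if x \<in> S then f x else 0) \<in> borel_measurable lebesgue"
    using f S by (simp add: borel_measurable_if)
  moreover have "AE x in lebesgue. (if x \<in> S then f x else 0) = (if x \<in> S then g x else 0)"
    using ae S by (auto simp: AE_restrict_space_iff elim: eventually_mono)
  ultimately have "(\<lambda>x. if x \<in> S then g x else 0) \<in> borel_measurable lebesgue"
    by (rule borel_measurable_AE)
  then show ?thesis
    using S by (simp add: borel_measurable_if)
qed

lemma strongly_measurable_norm:
  fixes f :: "real \<Rightarrow> 'b::real_normed_vector"
  assumes S: "S \<in> sets lebesgue" and f: "strongly_measurable (lebesgue_on S) f"
  shows "(\<lambda>t. norm (f t)) \<in> borel_measurable (lebesgue_on S)"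
proof -
  obtain s where s: "\<And>i. simple_function (lebesgue_on S) (s i)"
    and lim: "AE t in lebesgue_on S. (\<lambda>i. s i t) \<longlonglongrightarrow> f t"
    using f unfolding strongly_measurable_def by blast
  have "(\<lambda>t. norm (s i t)) \<in> borel_measurable (lebesgue_on S)" for i
    by (rule borel_measurable_simple_function[OF simple_function_compose1[OF s]])
  then have "(\<lambda>t. lim (\<lambda>i. norm (s i t))) \<in> borel_measurable (lebesgue_on S)"
    by (rule borel_measurable_lim_metric)
  moreover have "AE t in lebesgue_on S. lim (\<lambda>i. norm (s i t)) = norm (f t)"
    using lim by eventually_elim (auto intro!: limI tendsto_norm)
  ultimately show ?thesis
    by (rule borel_measurable_lebesgue_on_AE_cong[OF S])
qed

lemma strongly_measurable_compose2:
  fixes h :: "'b::topological_space \<Rightarrow> 'c::topological_space \<Rightarrow> 'd::topological_space"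
  assumes "strongly_measurable M f" "strongly_measurable M g"
    and h: "continuous_on UNIV (\<lambda>(x, y). h x y)"
  shows "strongly_measurable M (\<lambda>t. h (f t) (g t))"
proof -
  obtain s where s: "\<And>i. simple_function M (s i)" "AE t in M. (\<lambda>i. s i t) \<longlonglongrightarrow> f t"
    using assms(1) unfolding strongly_measurable_def by blast
  obtain r where r: "\<And>i. simple_function M (r i)" "AE t in M. (\<lambda>i. r i t) \<longlonglongrightarrow> g t"
    using assms(2) unfolding strongly_measurable_def by blast
  have "AE t in M. (\<lambda>i. h (s i t) (r i t)) \<longlonglongrightarrow> h (f t) (g t)"
    using s(2) r(2)
  proof eventually_elim
    case (elim t)
    have "(\<lambda>i. (s i t, r i t)) \<longlonglongrightarrow> (f t, g t)"
      using elim by (intro tendsto_Pair)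
    then show ?case
      using continuous_on_tendsto_compose[OF h, of "\<lambda>i. (s i t, r i t)" "(f t, g t)"] by simp
  qed
  then show ?thesis
    unfolding strongly_measurable_def
    by (intro exI[of _ "\<lambda>i t. h (s i t) (r i t)"] conjI allI)
      (rule simple_function_compose2[OF s(1) r(1)], assumption)
qed

lemma strongly_measurable_const: "strongly_measurable M (\<lambda>t. c)"
  unfolding strongly_measurable_def by (rule exI[of _ "\<lambda>i t. c"]) simp

lemma borel_measurable_imp_strongly_measurable:
  fixes g :: "'a \<Rightarrow> real"
  assumes "g \<in> borel_measurable M"
  shows "strongly_measurable M g"
proof -
  obtain s where "\<And>i. simple_function M (s i)" "\<And>x. x \<in> space M \<Longrightarrow> (\<lambda>i. s i x) \<longlonglongrightarrow> g x"
    using borel_measurable_implies_sequence_metric[OF assms, of 0] by metis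
  then show ?thesis
    unfolding strongly_measurable_def by (intro exI[of _ s] conjI allI AE_I2)
qed

lemma L2_borel_measurable_norm:
  assumes "p \<in> L2 a"
  shows "(\<lambda>t. norm (p t)) \<in> borel_measurable (lebesgue_on {0..a})"
  using assms unfolding L2_def by (auto intro: strongly_measurable_norm)

lemma L2_integrable: "p \<in> L2 a \<Longrightarrow> integrable (lebesgue_on {0..a}) (\<lambda>t. (norm (p t))\<^sup>2)"
  unfolding L2_def by simp

lemma L2_norm_nonneg: "0 \<le> L2_norm a p"
  unfolding L2_norm_def by simp

lemma L2_dominated:
  assumes p: "strongly_measurable (lebesgue_on {0..a}) p"
    and b: "integrable (lebesgue_on {0..a}) b"
    and le: "AE t in lebesgue_on {0..a}. (norm (p t))\<^sup>2 \<le> b t"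
  shows "p \<in> L2 a"
proof -
  have [measurable]: "(\<lambda>t. norm (p t)) \<in> borel_measurable (lebesgue_on {0..a})"
    by (rule strongly_measurable_norm[OF _ p]) simp
  have "integrable (lebesgue_on {0..a}) (\<lambda>t. (norm (p t))\<^sup>2)"
    by (rule Bochner_Integration.integrable_bound[OF b]) (use le in \<open>auto elim: eventually_mono\<close>)
  then show ?thesis
    using p unfolding L2_def by simp
qed

lemma L2_norm_add:
  fixes p q :: "real \<Rightarrow> 'e::complex_hilbert"
  assumes p: "p \<in> L2 a" and q: "q \<in> L2 a"
  shows "(\<lambda>t. p t + q t) \<in> L2 a" "L2_norm a (\<lambda>t. p t + q t) \<le> L2_norm a p + L2_norm a q"
proof -
  let ?M = "lebesgue_on {0..a}"
  note m[measurable] = L2_borel_measurable_norm[OF p] L2_borel_measurable_norm[OF q]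
  note i = L2_integrable[OF p] L2_integrable[OF q]
  note cs = Cauchy_Schwarz_integral[OF m i]
  have ib: "integrable ?M (\<lambda>t. (norm (p t))\<^sup>2 + 2 * (norm (p t) * norm (q t)) + (norm (q t))\<^sup>2)"
    using i cs(1) by simp
  have le: "(norm (p t + q t))\<^sup>2 \<le> (norm (p t))\<^sup>2 + 2 * (norm (p t) * norm (q t)) + (norm (q t))\<^sup>2" for t
    using power_mono[OF norm_triangle_ineq[of "p t" "q t"], of 2] by (simp add: power2_sum)
  have sm: "strongly_measurable ?M (\<lambda>t. p t + q t)"
    using p q unfolding L2_def
    by (auto intro!: strongly_measurable_compose2[where h="(+)" and f=p and g=q] continuous_intros
        simp: case_prod_unfold)
  show r: "(\<lambda>t. p t + q t) \<in> L2 a"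
    by (rule L2_dominated[OF sm ib]) (use le in simp)
  let ?P = "L2_norm a p" and ?Q = "L2_norm a q"
  have "(\<integral>t. (norm (p t + q t))\<^sup>2 \<partial>?M)
      \<le> (\<integral>t. (norm (p t))\<^sup>2 + 2 * (norm (p t) * norm (q t)) + (norm (q t))\<^sup>2 \<partial>?M)"
    by (rule integral_mono[OF L2_integrable[OF r] ib]) (use le in simp)
  also have "\<dots> = ?P\<^sup>2 + 2 * (\<integral>t. norm (p t) * norm (q t) \<partial>?M) + ?Q\<^sup>2"
    using i cs(1) by (simp add: L2_norm_def)
  also have "\<dots> \<le> ?P\<^sup>2 + 2 * (?P * ?Q) + ?Q\<^sup>2"
    using cs(2) by (simp add: L2_norm_def)
  also have "\<dots> = (?P + ?Q)\<^sup>2"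
    by (simp add: power2_sum)
  finally show "L2_norm a (\<lambda>t. p t + q t) \<le> ?P + ?Q"
    unfolding L2_norm_def[of a "\<lambda>t. p t + q t"]
    by (rule real_le_lsqrt[rotated -1]) (simp_all add: L2_norm_nonneg)
qed

lemma L2_scaleR:
  fixes x :: "'e::complex_hilbert"
  assumes g: "g \<in> borel_measurable (lebesgue_on {0..a})"
    and i: "integrable (lebesgue_on {0..a}) (\<lambda>t. (g t)\<^sup>2)"
  shows "(\<lambda>t. g t *\<^sub>R x) \<in> L2 a"
    and "L2_norm a (\<lambda>t. g t *\<^sub>R x) = sqrt (\<integral>t. (g t)\<^sup>2 \<partial>lebesgue_on {0..a}) * norm x"
proof -
  have sm: "strongly_measurable (lebesgue_on {0..a}) (\<lambda>t. g t *\<^sub>R x)"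
    by (rule strongly_measurable_compose2[where g="\<lambda>t. x" and h="(*\<^sub>R)",
          OF borel_measurable_imp_strongly_measurable[OF g] strongly_measurable_const])
      (auto simp: case_prod_unfold intro!: continuous_intros)
  show "(\<lambda>t. g t *\<^sub>R x) \<in> L2 a"
    by (rule L2_dominated[OF sm, of "\<lambda>t. (g t)\<^sup>2 * (norm x)\<^sup>2"])
      (use i in \<open>auto simp: power_mult_distrib\<close>)
  show "L2_norm a (\<lambda>t. g t *\<^sub>R x) = sqrt (\<integral>t. (g t)\<^sup>2 \<partial>lebesgue_on {0..a}) * norm x"
    unfolding L2_norm_def by (simp add: power_mult_distrib real_sqrt_mult)
qed

lemma L2_norm_scaleR:
  fixes p :: "real \<Rightarrow> 'e::complex_hilbert"
  assumes p: "p \<in> L2 a"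
  shows "(\<lambda>t. r *\<^sub>R p t) \<in> L2 a" "L2_norm a (\<lambda>t. r *\<^sub>R p t) = \<bar>r\<bar> * L2_norm a p"
proof -
  have sm: "strongly_measurable (lebesgue_on {0..a}) (\<lambda>t. r *\<^sub>R p t)"
    using p unfolding L2_def
    by (intro strongly_measurable_compose2[where f="\<lambda>t. r" and g=p and h="(*\<^sub>R)", OF strongly_measurable_const])
      (auto simp: case_prod_unfold intro!: continuous_intros)
  show "(\<lambda>t. r *\<^sub>R p t) \<in> L2 a"
    by (rule L2_dominated[OF sm, of "\<lambda>t. r\<^sup>2 * (norm (p t))\<^sup>2"])
      (use L2_integrable[OF p] in \<open>auto simp: power_mult_distrib\<close>)
  show "L2_norm a (\<lambda>t. r *\<^sub>R p t) = \<bar>r\<bar> * L2_norm a p"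
    unfolding L2_norm_def by (simp add: power_mult_distrib real_sqrt_mult)
qed

lemma L2_sum:
  fixes p :: "'i \<Rightarrow> real \<Rightarrow> 'e::complex_hilbert"
  assumes "finite I" "\<And>i. i \<in> I \<Longrightarrow> p i \<in> L2 a"
  shows "(\<lambda>t. \<Sum>i\<in>I. p i t) \<in> L2 a" "L2_norm a (\<lambda>t. \<Sum>i\<in>I. p i t) \<le> (\<Sum>i\<in>I. L2_norm a (p i))"
proof -
  have "(\<lambda>t. \<Sum>i\<in>I. p i t) \<in> L2 a \<and> L2_norm a (\<lambda>t. \<Sum>i\<in>I. p i t) \<le> (\<Sum>i\<in>I. L2_norm a (p i))"
    using assms
  proof (induction I rule: finite_induct)
    case empty
    then show ?case
      by (simp add: L2_def strongly_measurable_const L2_norm_def)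
  next
    case (insert i I)
    then have i: "p i \<in> L2 a" and I: "(\<lambda>t. \<Sum>i\<in>I. p i t) \<in> L2 a"
      "L2_norm a (\<lambda>t. \<Sum>i\<in>I. p i t) \<le> (\<Sum>i\<in>I. L2_norm a (p i))"
      by auto
    show ?case
      using L2_norm_add[OF i I(1)] I(2) insert.hyps by simp
  qed
  then show "(\<lambda>t. \<Sum>i\<in>I. p i t) \<in> L2 a" "L2_norm a (\<lambda>t. \<Sum>i\<in>I. p i t) \<le> (\<Sum>i\<in>I. L2_norm a (p i))"
    by auto
qed

lemma L2_norm_cong_AE:
  assumes p: "p \<in> L2 a" and q: "q \<in> L2 a" and "AE t in lebesgue_on {0..a}. p t = q t"
  shows "L2_norm a p = L2_norm a q"
proof -
  have "(\<integral>t. (norm (p t))\<^sup>2 \<partial>lebesgue_on {0..a}) = (\<integral>t. (norm (q t))\<^sup>2 \<partial>lebesgue_on {0..a})"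
    using assms(3) L2_integrable[OF p] L2_integrable[OF q]
    by (intro integral_cong_AE) (auto elim: eventually_mono)
  then show ?thesis
    unfolding L2_norm_def by simp
qed

section \<open>Laplace transforms and fractional integrals\<close>

text \<open>Fubini and translation invariance. Functions on the half-line are cut off by indicators,
  so that their convolution becomes one on the whole line.\<close>

lemma convolution_lborel:
  fixes u v :: "real \<Rightarrow> real"
  assumes u: "integrable lborel u" and v: "integrable lborel v"
  shows "integrable lborel (\<lambda>t. \<integral>s. u (t - s) * v s \<partial>lborel)"
    and "(\<integral>t. (\<integral>s. u (t - s) * v s \<partial>lborel) \<partial>lborel) = (\<integral>t. u t \<partial>lborel) * (\<integral>s. v s \<partial>lborel)"
proof -
  have [measurable]: "u \<in> borel_measurable borel" "v \<in> borel_measurable borel"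
    using u v by auto
  have shift: "(\<integral>t. w (t - s) \<partial>lborel) = (\<integral>t. w t \<partial>lborel)" for w :: "real \<Rightarrow> real" and s
    using lborel_integral_real_affine[of 1 w "- s"] by (simp add: add.commute)
  have shifti: "integrable lborel (\<lambda>t. u (t - s))" for s
    using lborel_integrable_real_affine[OF u, of 1 "- s"] by (simp add: add.commute)
  let ?f = "\<lambda>t s. u (t - s) * v s"
  have "integrable (lborel \<Otimes>\<^sub>M lborel) (\<lambda>(s, t). ?f t s)"
  proof (rule lborel_pair.Fubini_integrable)
    have "(\<integral>t. norm (?f t s) \<partial>lborel) = (\<integral>t. \<bar>u t\<bar> \<partial>lborel) * \<bar>v s\<bar>" for s
      using shift[of "\<lambda>t. \<bar>u t\<bar>" s] by (simp add: abs_mult)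
    then show "integrable lborel (\<lambda>s. \<integral>t. norm (case (s, t) of (s, t) \<Rightarrow> ?f t s) \<partial>lborel)"
      using v by simp
    show "AE s in lborel. integrable lborel (\<lambda>t. case (s, t) of (s, t) \<Rightarrow> ?f t s)"
      using shifti by simp
  qed measurable
  note i = this
  show "integrable lborel (\<lambda>t. \<integral>s. ?f t s \<partial>lborel)"
    using lborel_pair.integrable_snd[OF i] .
  have "(\<integral>t. (\<integral>s. ?f t s \<partial>lborel) \<partial>lborel) = (\<integral>s. (\<integral>t. ?f t s \<partial>lborel) \<partial>lborel)"
    using lborel_pair.integral_snd[OF i] lborel_pair.integral_fst[OF i] by simp
  then show "(\<integral>t. (\<integral>s. ?f t s \<partial>lborel) \<partial>lborel) = (\<integral>t. u t \<partial>lborel) * (\<integral>s. v s \<partial>lborel)"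
    using shift[of u] by simp
qed

text \<open>The Riemann-Liouville integral of order \<alpha>. For t \<le> 0 the interval of
  integration is empty and the value is 0.\<close>

definition frac_int :: "real \<Rightarrow> (real \<Rightarrow> real) \<Rightarrow> real \<Rightarrow> real" where
  "frac_int \<alpha> f t = (\<integral>s. indicator {0<..<t} s * ((t - s) powr (\<alpha> - 1) * f s) \<partial>lborel) / Gamma \<alpha>"

definition laplace :: "(real \<Rightarrow> real) \<Rightarrow> real \<Rightarrow> real" where
  "laplace f \<nu> = (\<integral>t. indicator {0<..} t * (exp (- (\<nu> * t)) * f t) \<partial>lborel)"

text \<open>Absolute convergence has to be recorded separately: a divergent integral gives
  \<open>laplace\<close> the default value 0.\<close>

definition laplace_at :: "(real \<Rightarrow> real) \<Rightarrow> real \<Rightarrow> bool" where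
  "laplace_at f \<nu> \<longleftrightarrow> integrable lborel (\<lambda>t. indicator {0<..} t * (exp (- (\<nu> * t)) * f t))"

text \<open>Substitution t \<mapsto> \<nu> t in Euler's integral for Gamma. Working with nonnegative
  integrals delivers convergence and value together.\<close>

lemma powr_kernel_laplace:
  fixes \<alpha> \<nu> :: real
  assumes "\<alpha> > 0" "\<nu> > 0"
  shows "integrable lborel (\<lambda>t. indicator {0<..} t * (exp (- (\<nu> * t)) * t powr (\<alpha> - 1)))"
    and "(\<integral>t. indicator {0<..} t * (exp (- (\<nu> * t)) * t powr (\<alpha> - 1)) \<partial>lborel) = Gamma \<alpha> * \<nu> powr (- \<alpha>)"
proof -
  let ?g = "\<lambda>t::real. indicator {0<..} t * (exp (- (\<nu> * t)) * t powr (\<alpha> - 1))"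
  let ?h = "\<lambda>t::real. indicator {0..} t * t powr (\<alpha> - 1) / exp t"
  have eq: "?h (0 + \<nu> * t) = \<nu> powr (\<alpha> - 1) * ?g t" for t
    using assms by (auto simp: indicator_def powr_mult exp_minus field_simps zero_le_mult_iff)
  have "ennreal (Gamma \<alpha>) = (\<integral>\<^sup>+t. ennreal (?h t) \<partial>lborel)"
    by (rule Gamma_conv_nn_integral_real) fact
  also have "\<dots> = \<bar>\<nu>\<bar> * (\<integral>\<^sup>+t. ennreal (?h (0 + \<nu> * t)) \<partial>lborel)"
    by (rule nn_integral_real_affine) (use assms in \<open>auto intro!: measurable_compose[OF _ measurable_ennreal]\<close>)
  also have "\<dots> = \<bar>\<nu>\<bar> * (\<integral>\<^sup>+t. ennreal (\<nu> powr (\<alpha> - 1)) * ennreal (?g t) \<partial>lborel)"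
    by (subst eq) (simp add: ennreal_mult')
  also have "\<dots> = \<bar>\<nu>\<bar> * (ennreal (\<nu> powr (\<alpha> - 1)) * (\<integral>\<^sup>+t. ennreal (?g t) \<partial>lborel))"
    by (subst nn_integral_cmult) auto
  also have "\<dots> = ennreal (\<nu> powr \<alpha>) * (\<integral>\<^sup>+t. ennreal (?g t) \<partial>lborel)"
    using assms by (simp add: mult.assoc[symmetric] ennreal_mult[symmetric] powr_diff)
  finally have *: "ennreal (Gamma \<alpha>) = ennreal (\<nu> powr \<alpha>) * (\<integral>\<^sup>+t. ennreal (?g t) \<partial>lborel)" .
  have "ennreal (Gamma \<alpha> * \<nu> powr (- \<alpha>)) = ennreal (\<nu> powr (- \<alpha>)) * ennreal (Gamma \<alpha>)"
    using assms Gamma_real_pos[of \<alpha>] by (simp add: ennreal_mult mult.commute)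
  also have "\<dots> = (ennreal (\<nu> powr (- \<alpha>)) * ennreal (\<nu> powr \<alpha>)) * (\<integral>\<^sup>+t. ennreal (?g t) \<partial>lborel)"
    by (subst *) (simp add: mult.assoc)
  also have "ennreal (\<nu> powr (- \<alpha>)) * ennreal (\<nu> powr \<alpha>) = 1"
    using assms by (simp add: ennreal_mult[symmetric] powr_add[symmetric])
  finally have **: "(\<integral>\<^sup>+t. ennreal (?g t) \<partial>lborel) = ennreal (Gamma \<alpha> * \<nu> powr (- \<alpha>))"
    by simp
  have "has_bochner_integral lborel ?g (Gamma \<alpha> * \<nu> powr (- \<alpha>))"
    by (rule has_bochner_integral_nn_integral) (use ** assms Gamma_real_pos[of \<alpha>] in auto)
  then show "integrable lborel ?g" "integral\<^sup>L lborel ?g = Gamma \<alpha> * \<nu> powr (- \<alpha>)"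
    by (simp_all add: has_bochner_integral_iff)
qed

text \<open>Since exp (- \<nu> t) = exp (- \<nu> (t - s)) exp (- \<nu> s), the damped fractional
  integral is the convolution of the damped kernel with the damped f.\<close>

lemma laplace_frac_int:
  assumes \<alpha>: "\<alpha> > 0" and \<nu>: "\<nu> > 0" and f: "laplace_at f \<nu>"
  shows "laplace_at (frac_int \<alpha> f) \<nu>" "laplace (frac_int \<alpha> f) \<nu> = \<nu> powr (- \<alpha>) * laplace f \<nu>"
proof -
  let ?u = "\<lambda>t::real. indicator {0<..} t * (exp (- (\<nu> * t)) * t powr (\<alpha> - 1))"
  let ?v = "\<lambda>t::real. indicator {0<..} t * (exp (- (\<nu> * t)) * f t)"
  have eq1: "?u (t - s) * ?v s = indicator {0<..} t * exp (- (\<nu> * t)) *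
      (indicator {0<..<t} s * ((t - s) powr (\<alpha> - 1) * f s))" for t s
    by (auto simp: indicator_def algebra_simps exp_add[symmetric] exp_diff[symmetric])
  have eq: "(\<integral>s. ?u (t - s) * ?v s \<partial>lborel) =
      Gamma \<alpha> * (indicator {0<..} t * (exp (- (\<nu> * t)) * frac_int \<alpha> f t))" for t
    unfolding eq1 using Gamma_real_pos[OF \<alpha>] by (simp add: frac_int_def)
  note c = convolution_lborel[OF powr_kernel_laplace(1)[OF \<alpha> \<nu>] f[unfolded laplace_at_def], unfolded eq]
  show "laplace_at (frac_int \<alpha> f) \<nu>"
    using c(1) Gamma_real_pos[OF \<alpha>] unfolding laplace_at_def by simp
  show "laplace (frac_int \<alpha> f) \<nu> = \<nu> powr (- \<alpha>) * laplace f \<nu>"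
    using c(2) Gamma_real_pos[OF \<alpha>] powr_kernel_laplace(2)[OF \<alpha> \<nu>] unfolding laplace_def by simp
qed

section \<open>Uniqueness of the Laplace transform\<close>

lemma AE_lborel_zero_imp_zero:
  fixes f :: "real \<Rightarrow> real"
  assumes c: "continuous_on {0<..} f" and ae: "AE t in lborel. 0 < t \<longrightarrow> f t = 0" and t: "0 < t"
  shows "f t = 0"
proof (rule ccontr)
  assume nz: "f t \<noteq> 0"
  let ?S = "{0<..} \<inter> f -` (- {0})"
  have o: "open ?S"
    by (rule continuous_open_preimage[OF c]) auto
  have "AE t in lebesgue. t \<notin> ?S"
    using AE_completion[OF ae] by eventually_elim auto
  moreover have "?S \<in> sets lebesgue"
    using o by (auto intro: lebesgue_openin)
  ultimately have "negligible ?S"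
    by (simp add: negligible_iff_null_sets AE_iff_null_sets)
  then show False
    using open_not_negligible[OF o] nz t by blast
qed

text \<open>Lerch's theorem: substituting \<open>u = exp (- t)\<close> turns the vanishing of the transform at
  \<open>\<nu> + 1, \<nu> + 2, \<dots>\<close> into orthogonality to all polynomials on \<open>[0,1]\<close>.\<close>

lemma laplace_zero_imp_zero:
  fixes P :: "real \<Rightarrow> real"
  assumes c: "continuous_on {0..} P" and bd: "\<And>t. t \<ge> 0 \<Longrightarrow> \<bar>P t\<bar> \<le> C * exp (\<omega> * t)"
    and z: "\<And>\<nu>. \<nu> > \<omega>' \<Longrightarrow> laplace P \<nu> = 0" and t0: "t > 0"
  shows "P t = 0"
proof -
  \<comment> \<open>The margin 1 over \<omega> gives |f t| \<le> C exp (- t), and all abscissae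
    \<nu> + 1, \<nu> + 2, ... stay above \<omega>'.\<close>
  define \<nu> where "\<nu> = max \<omega> \<omega>' + 1"
  define f where "f t = exp (- (\<nu> * t)) * P t" for t
  have C: "C \<ge> 0"
    using bd[of 0] by auto
  have fb: "\<bar>f t\<bar> \<le> C * exp (- t)" if "t \<ge> 0" for t
  proof -
    have "\<bar>f t\<bar> = exp (- (\<nu> * t)) * \<bar>P t\<bar>"
      by (simp add: f_def abs_mult)
    also have "\<dots> \<le> exp (- (\<nu> * t)) * (C * exp (\<omega> * t))"
      using bd[OF that] by (simp add: mult_left_mono)
    also have "\<dots> = C * exp (- ((\<nu> - \<omega>) * t))"
      by (simp add: left_diff_distrib exp_diff exp_minus field_simps)
    also have "\<dots> \<le> C * exp (- t)"
    proof (intro mult_left_mono C)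
      have "1 * t \<le> (\<nu> - \<omega>) * t"
        using that by (intro mult_right_mono) (auto simp: \<nu>_def)
      then show "exp (- ((\<nu> - \<omega>) * t)) \<le> exp (- t)" by simp
    qed
    finally show ?thesis .
  qed
  have cf: "continuous_on {0..} f"
    unfolding f_def by (intro continuous_intros c)
  have fm[measurable]: "(\<lambda>t. indicator {0<..} t * f t) \<in> borel_measurable borel"
    using borel_measurable_continuous_on_indicator[OF _ continuous_on_subset[OF cf], of "{0<..}"]
    by (auto simp: subset_eq)
  have ie: "integrable lborel (\<lambda>t. indicator {0<..} t * exp (- t) :: real)"
    using powr_kernel_laplace(1)[of 1 1]
    by (rule Bochner_Integration.integrable_bound) (auto simp: indicator_def intro!: AE_I2)
  have fi: "integrable lborel (\<lambda>t. indicator {0<..} t * f t)"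
    by (rule Bochner_Integration.integrable_bound[OF integrable_mult_right[OF ie, of C]])
      (use fm fb C in \<open>auto simp: abs_mult split: split_indicator\<close>)
  have fin: "integrable lborel (\<lambda>t. indicator {0<..} t * f t * exp (- t) ^ n)" for n
    by (rule Bochner_Integration.integrable_bound[OF fi])
      (auto simp: abs_mult power_le_one intro!: mult_left_le split: split_indicator)
  have zn: "(\<integral>t. indicator {0<..} t * f t * exp (- t) ^ Suc n \<partial>lborel) = 0" for n
  proof -
    have "(\<integral>t. indicator {0<..} t * f t * exp (- t) ^ Suc n \<partial>lborel) = laplace P (\<nu> + Suc n)"
      unfolding laplace_def
    proof (intro Bochner_Integration.integral_cong refl)
      fix t :: real
      have "exp (- t) ^ Suc n = exp (- (real (Suc n) * t))"
        by (simp only: exp_of_nat_mult[symmetric] mult_minus_right)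
      then show "indicator {0<..} t * f t * exp (- t) ^ Suc n =
          indicator {0<..} t * (exp (- ((\<nu> + real (Suc n)) * t)) * P t)"
        by (simp add: f_def distrib_right mult_exp_exp del: power_Suc of_nat_Suc)
    qed
    also have "\<dots> = 0"
      by (rule z) (auto simp: \<nu>_def)
    finally show ?thesis .
  qed
  \<comment> \<open>This is f in the variable u = exp (- t). The value 0 at u = 0 is its limit,
    because |f t| \<le> C exp (- t) becomes |h u| \<le> C u.\<close>
  define h where "h u = (if u = 0 then 0 else f (- ln u))" for u :: real
  have hb: "\<bar>h u\<bar> \<le> C * u" if "u \<in> {0..1}" for u
    using that fb[of "- ln u"] by (auto simp: h_def)
  have "continuous_on {0..1} h"
    unfolding continuous_on_eq_continuous_within
  proof
    fix u :: real assume u: "u \<in> {0..1}"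
    show "continuous (at u within {0..1}) h"
    proof (cases "u = 0")
      case True
      have "((\<lambda>u. h u) \<longlongrightarrow> 0) (at 0 within {0..1})"
      proof (rule tendsto_rabs_zero_cancel, rule tendsto_sandwich)
        show "\<forall>\<^sub>F u in at 0 within {0..1}. 0 \<le> \<bar>h u\<bar>" by simp
        show "\<forall>\<^sub>F u in at 0 within {0..1}. \<bar>h u\<bar> \<le> C * u"
          using hb by (auto simp: eventually_at_filter)
        show "((\<lambda>u. C * u) \<longlongrightarrow> 0) (at 0 within {0..1})"
          by (auto intro!: tendsto_eq_intros)
      qed simp
      moreover have "h 0 = 0"
        by (simp add: h_def)
      ultimately show ?thesis
        using True by (simp add: continuous_within)
    next
      case False
      have "continuous_on {0<..1} (\<lambda>u. f (- ln u))"
        by (rule continuous_on_compose2[OF cf]) (auto intro!: continuous_intros)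
      then have "continuous_on {0<..1} h"
        by (rule continuous_on_eq) (auto simp: h_def)
      then have "continuous (at u within {0<..1}) h"
        using u False by (auto simp: continuous_on_eq_continuous_within)
      moreover have "at u within {0<..1} = at u within {0..1}"
        by (rule at_within_nhd[of u "{0<..}"]) (use u False in auto)
      ultimately show ?thesis
        by (simp add: continuous_within)
    qed
  qed
  note ch = this
  have Ji: "integrable lborel (\<lambda>t. indicator {0<..} t * ((f t)\<^sup>2 * exp (- t)))"
  proof -
    have "integrable lborel (\<lambda>t. (indicator {0<..} t * f t) * ((indicator {0<..} t * f t) * exp (- t)))"
    proof (rule Bochner_Integration.integrable_bound[OF integrable_mult_right[OF fi, of C]])
      have "\<bar>indicator {0<..} t * f t * exp (- t)\<bar> \<le> C" for t
      proof (cases "t > 0")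
        case True
        have "\<bar>f t\<bar> * exp (- t) \<le> (C * exp (- t)) * exp (- t)"
          using fb[of t] True by (intro mult_right_mono) auto
        also have "\<dots> \<le> C * 1"
          using C True by (subst mult.assoc, intro mult_left_mono) (auto simp: exp_add[symmetric])
        finally show ?thesis using True by (simp add: abs_mult)
      qed (use C in simp)
      then have "norm ((indicator {0<..} t * f t) * (indicator {0<..} t * f t * exp (- t)))
          \<le> \<bar>indicator {0<..} t * f t\<bar> * C" for t
        unfolding real_norm_def abs_mult[of "indicator {0<..} t * f t" "_ * exp _"]
        by (rule mult_left_mono) simp
      then show "AE t in lborel. norm ((indicator {0<..} t * f t) * ((indicator {0<..} t * f t) * exp (- t)))
          \<le> norm (C * (indicator {0<..} t * f t))"
        using C by (intro AE_I2) (simp add: abs_mult[of _ C] mult.commute[of C])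
    qed simp
    moreover have "(\<lambda>t. (indicator {0<..} t * f t) * ((indicator {0<..} t * f t) * exp (- t))) =
            (\<lambda>t. indicator {0<..} t * ((f t)\<^sup>2 * exp (- t)))"
      by (auto simp: indicator_def power2_eq_square)
    ultimately show ?thesis by simp
  qed
  \<comment> \<open>Under u = exp (- t) this is the integral of h^2 over [0,1]. Replacing one factor
    h by a polynomial within e of it changes the integral by at most e * I, and the changed integral
    vanishes.\<close>
  define J where "J = (\<integral>t. indicator {0<..} t * ((f t)\<^sup>2 * exp (- t)) \<partial>lborel)"
  define I where "I = (\<integral>t. \<bar>indicator {0<..} t * f t\<bar> \<partial>lborel)"
  have "\<bar>J\<bar> \<le> e * I" if e: "e > 0" for e
  proof -
    obtain g where g: "real_polynomial_function g" "\<And>x. x \<in> {0..1} \<Longrightarrow> \<bar>h x - g x\<bar> < e"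
      using Stone_Weierstrass_real_polynomial_function[OF compact_Icc ch e] by blast
    obtain a n where gs: "g = (\<lambda>x. \<Sum>i\<le>n. a i * x ^ i)"
      using g(1) real_polynomial_function_iff_sum by blast
    let ?G = "\<lambda>t. indicator {0<..} t * f t * (exp (- t) * g (exp (- t)))"
    have Geq: "?G t = (\<Sum>i\<le>n. a i * (indicator {0<..} t * f t * exp (- t) ^ Suc i))" for t
      by (simp add: gs sum_distrib_left algebra_simps)
    have Gi: "integrable lborel ?G"
      unfolding Geq by (intro Bochner_Integration.integrable_sum integrable_mult_right fin)
    have G0: "(\<integral>t. ?G t \<partial>lborel) = 0"
      unfolding Geq using fin zn by (simp del: power_Suc)
    have bnd: "\<bar>indicator {0<..} t * ((f t)\<^sup>2 * exp (- t)) - ?G t\<bar> \<le> e * \<bar>indicator {0<..} t * f t\<bar>" for t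
    proof (cases "t > 0")
      case True
      have "h (exp (- t)) = f t" by (simp add: h_def)
      then have "\<bar>f t - g (exp (- t))\<bar> \<le> e"
        using g(2)[of "exp (- t)"] True by simp
      then have "\<bar>f t\<bar> * (exp (- t) * \<bar>f t - g (exp (- t))\<bar>) \<le> \<bar>f t\<bar> * (1 * e)"
        using True e by (intro mult_left_mono mult_mono) auto
      moreover have "(f t)\<^sup>2 * exp (- t) - f t * (exp (- t) * g (exp (- t))) =
          f t * (exp (- t) * (f t - g (exp (- t))))"
        by (simp add: power2_eq_square algebra_simps)
      ultimately show ?thesis
        using True by (simp add: abs_mult mult.commute)
    qed (simp add: indicator_def)
    have "\<bar>J\<bar> = \<bar>\<integral>t. indicator {0<..} t * ((f t)\<^sup>2 * exp (- t)) - ?G t \<partial>lborel\<bar>"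
      using G0 Ji Gi by (simp add: J_def)
    also have "\<dots> \<le> (\<integral>t. e * \<bar>indicator {0<..} t * f t\<bar> \<partial>lborel)"
      by (rule order_trans[OF integral_abs_bound integral_mono])
        (use Ji Gi fi bnd in \<open>auto intro!: Bochner_Integration.integrable_diff integrable_abs integrable_mult_right\<close>)
    finally show ?thesis
      by (simp add: I_def)
  qed
  note small = this
  have "J = 0"
  proof (rule ccontr)
    assume nz: "J \<noteq> 0"
    have "I \<ge> 0" unfolding I_def by simp
    have "\<bar>J\<bar> \<le> \<bar>J\<bar> / (2 * (I + 1)) * I"
      using nz \<open>I \<ge> 0\<close> by (intro small) simp
    also have "\<dots> = \<bar>J\<bar> * (I / (2 * (I + 1)))" by simp
    also have "\<dots> < \<bar>J\<bar> * 1"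
      using nz \<open>I \<ge> 0\<close> by (intro mult_strict_left_mono) (auto simp: field_simps)
    finally show False by simp
  qed
  then have "AE t in lborel. indicator {0<..} t * ((f t)\<^sup>2 * exp (- t)) = 0"
    using integral_nonneg_eq_0_iff_AE[OF Ji] unfolding J_def by simp
  then have "AE t in lborel. 0 < t \<longrightarrow> f t = 0"
    by eventually_elim (auto simp: indicator_def split: if_splits)
  then have "f t = 0"
    using t0 by (intro AE_lborel_zero_imp_zero[OF continuous_on_subset[OF cf]]) auto
  then show ?thesis
    by (simp add: f_def)
qed

section \<open>Controlling a function whose primitive is a fractional integral\<close>

text \<open>Forward increments suffice because the derivative is known to exist. Bounds on
  increments of a kernel mean thereby bound its derivative without differentiation under the
  integral sign.\<close>

lemma DERIV_bound_right:
  fixes f :: "real \<Rightarrow> real"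
  assumes D: "(f has_real_derivative D) (at t)" and d: "d > 0"
    and le: "\<And>h. 0 < h \<Longrightarrow> h < d \<Longrightarrow> \<bar>f (t + h) - f t\<bar> \<le> c * h"
  shows "\<bar>D\<bar> \<le> c"
proof (rule tendsto_upperbound)
  have "((\<lambda>h. (f (t + h) - f t) / h) \<longlongrightarrow> D) (at_right 0)"
    using D unfolding DERIV_def by (rule tendsto_mono[OF at_le, rotated]) simp
  then show "((\<lambda>h. \<bar>(f (t + h) - f t) / h\<bar>) \<longlongrightarrow> \<bar>D\<bar>) (at_right 0)"
    by (rule tendsto_rabs)
  show "\<forall>\<^sub>F h in at_right 0. \<bar>(f (t + h) - f t) / h\<bar> \<le> c"
    unfolding eventually_at_right_field using d le by (intro exI[of _ d]) (auto simp: divide_simps)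
qed simp

text \<open>The density left by the substitution s = t \<sigma> in the fractional integral after the
  factor t^\<alpha> is taken out; it lives on (0,1) and does not depend on t.\<close>

definition kernel :: "real \<Rightarrow> real \<Rightarrow> real" where
  "kernel \<alpha> \<sigma> = indicator {0<..<1} \<sigma> * (1 - \<sigma>) powr (\<alpha> - 1) / Gamma \<alpha>"

lemma kernel_nonneg: "\<alpha> > 0 \<Longrightarrow> kernel \<alpha> \<sigma> \<ge> 0"
  using Gamma_real_pos[of \<alpha>] by (simp add: kernel_def)

text \<open>The substance is Beta(1, \<alpha>) = 1 / \<alpha>. The mass is 1 / \<Gamma>(\<alpha> +
  1), and kernel means contribute it as a factor to every bound below.\<close>

lemma has_bochner_integral_kernel:
  assumes "\<alpha> > 0"
  shows "has_bochner_integral lborel (kernel \<alpha>) (1 / (\<alpha> * Gamma \<alpha>))"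
proof -
  have "((\<lambda>t. t powr (1 - 1) * (1 - t) powr (\<alpha> - 1)) has_integral Beta 1 \<alpha>) {0..1}"
    by (rule has_integral_Beta_real) (use assms in auto)
  then have nn: "(\<integral>\<^sup>+t. ennreal (indicator {0..1} t * (t powr (1 - 1) * (1 - t) powr (\<alpha> - 1))) \<partial>lborel) = Beta 1 \<alpha>"
    by (intro nn_integral_has_integral_lebesgue) auto
  have "(\<integral>\<^sup>+t. ennreal (indicator {0<..<1} t * (1 - t) powr (\<alpha> - 1)) \<partial>lborel) = Beta 1 \<alpha>"
    unfolding nn[symmetric]
  proof (rule nn_integral_cong_AE)
    have "AE t in lborel. t \<noteq> 0 \<and> t \<noteq> (1::real)"
      using AE_lborel_singleton by (intro AE_conjI) auto
    then show "AE t in lborel. ennreal (indicator {0<..<1} t * (1 - t) powr (\<alpha> - 1)) =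
       ennreal (indicator {0..1} t * (t powr (1 - 1) * (1 - t) powr (\<alpha> - 1)))"
      by eventually_elim (auto simp: indicator_def)
  qed
  moreover have "Beta 1 \<alpha> = 1 / \<alpha>"
  proof -
    have "\<alpha> \<notin> \<int>\<^sub>\<le>\<^sub>0"
      using assms by (auto elim!: nonpos_Ints_cases)
    then show ?thesis
      using assms Gamma_plus1[of \<alpha>] by (simp add: Beta_def add.commute Gamma_eq_zero_iff)
  qed
  ultimately have "has_bochner_integral lborel (\<lambda>t. indicator {0<..<1} t * (1 - t) powr (\<alpha> - 1)) (1 / \<alpha>)"
    using assms by (intro has_bochner_integral_nn_integral) auto
  then show ?thesis
    unfolding kernel_def has_bochner_integral_iff by simp
qed

text \<open>Splitting the increment of s^\<alpha> \<kappa>(s) + \<alpha> s^(\<alpha> - 1) K(s) by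
  the product rule gives four terms. These are their sizes, up to a common constant, if |K| \<le> 1,
  |\<kappa>(s)| \<le> 1 / s and the increments of K and \<kappa> are at most |t' - t| / t and |t' -
  t| / t^2; K will be a kernel mean and \<kappa> its derivative.\<close>

definition powr_modulus :: "real \<Rightarrow> real \<Rightarrow> real \<Rightarrow> real" where
  "powr_modulus \<alpha> t t' = \<bar>t' powr \<alpha> - t powr \<alpha>\<bar> / t' + t powr \<alpha> * \<bar>t' - t\<bar> / t\<^sup>2 +
     \<alpha> * \<bar>t' powr (\<alpha> - 1) - t powr (\<alpha> - 1)\<bar> + \<alpha> * t powr (\<alpha> - 1) * \<bar>t' - t\<bar> / t"

text \<open>Both orders of the arguments occur because the estimate behind
  \<open>powr_modulus\<close> takes the smaller point first, whereas t' may approach t from either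
  side.\<close>

lemma powr_modulus_tendsto:
  assumes "t > 0"
  shows "((\<lambda>t'. powr_modulus \<alpha> t t') \<longlongrightarrow> 0) (at t)" "((\<lambda>t'. powr_modulus \<alpha> t' t) \<longlongrightarrow> 0) (at t)"
  unfolding powr_modulus_def using assms by (auto intro!: tendsto_eq_intros)

text \<open>An average of f over (0,t) whose weights do not move with t, so that increments in t act
  on f alone.\<close>

definition kernel_mean :: "real \<Rightarrow> (real \<Rightarrow> real) \<Rightarrow> real \<Rightarrow> real" where
  "kernel_mean \<alpha> f t = (\<integral>\<sigma>. kernel \<alpha> \<sigma> * f (t * \<sigma>) \<partial>lborel)"

lemma frac_int_eq_kernel_mean:
  assumes t: "t > 0"
  shows "frac_int \<alpha> f t = t powr \<alpha> * kernel_mean \<alpha> f t"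
proof -
  have eq: "indicator {0<..<t} (0 + t * \<sigma>) * ((t - (0 + t * \<sigma>)) powr (\<alpha> - 1) * f (0 + t * \<sigma>)) =
     Gamma \<alpha> * t powr (\<alpha> - 1) * (kernel \<alpha> \<sigma> * f (t * \<sigma>))" if "Gamma \<alpha> \<noteq> 0" for \<sigma>
  proof -
    have "(t - t * \<sigma>) = t * (1 - \<sigma>)" by (simp add: algebra_simps)
    then show ?thesis
      using t that by (auto simp: kernel_def indicator_def powr_mult zero_less_mult_iff)
  qed
  show ?thesis
  \<comment> \<open>At a pole \<open>Gamma\<close> has the value 0, and division by it makes both
    sides 0; the identity holds there by convention.\<close>
  proof (cases "Gamma \<alpha> = 0")
    case False
    have "(\<integral>s. indicator {0<..<t} s * ((t - s) powr (\<alpha> - 1) * f s) \<partial>lborel)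
        = \<bar>t\<bar> *\<^sub>R (\<integral>\<sigma>. Gamma \<alpha> * t powr (\<alpha> - 1) * (kernel \<alpha> \<sigma> * f (t * \<sigma>)) \<partial>lborel)"
      by (subst lborel_integral_real_affine[of t _ 0]) (use t in simp, simp only: eq[OF False])
    then have "frac_int \<alpha> f t = \<bar>t\<bar> * (Gamma \<alpha> * t powr (\<alpha> - 1) * kernel_mean \<alpha> f t) / Gamma \<alpha>"
      unfolding frac_int_def kernel_mean_def by simp
    also have "\<dots> = t powr \<alpha> * kernel_mean \<alpha> f t"
      using t False by (simp add: powr_diff)
    finally show ?thesis .
  qed (simp add: frac_int_def kernel_mean_def kernel_def)
qed

lemma kernel_integrable:
  assumes \<alpha>: "\<alpha> > 0" and [measurable]: "w \<in> borel_measurable borel"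
    and B: "\<And>\<sigma>. 0 < \<sigma> \<Longrightarrow> \<sigma> < 1 \<Longrightarrow> \<bar>w \<sigma>\<bar> \<le> B"
  shows "integrable lborel (\<lambda>\<sigma>. kernel \<alpha> \<sigma> * w \<sigma>)"
    and "\<bar>\<integral>\<sigma>. kernel \<alpha> \<sigma> * w \<sigma> \<partial>lborel\<bar> \<le> B / (\<alpha> * Gamma \<alpha>)"
proof -
  note k = has_bochner_integral_kernel[OF \<alpha>]
  have ki: "integrable lborel (kernel \<alpha>)"
    using k by (simp add: has_bochner_integral_iff)
  have le: "\<bar>kernel \<alpha> \<sigma> * w \<sigma>\<bar> \<le> kernel \<alpha> \<sigma> * B" for \<sigma>
  proof (cases "0 < \<sigma> \<and> \<sigma> < 1")
    case True
    then show ?thesis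
      using B[of \<sigma>] kernel_nonneg[OF \<alpha>, of \<sigma>] by (simp add: abs_mult mult_left_mono)
  qed (auto simp: kernel_def)
  have B0: "B \<ge> 0"
    using B[of "1/2"] by auto
  show i: "integrable lborel (\<lambda>\<sigma>. kernel \<alpha> \<sigma> * w \<sigma>)"
    by (rule Bochner_Integration.integrable_bound[OF integrable_mult_left[OF ki, of B]])
      (use ki le B0 kernel_nonneg[OF \<alpha>] in \<open>auto simp: abs_mult\<close>)
  have "\<bar>\<integral>\<sigma>. kernel \<alpha> \<sigma> * w \<sigma> \<partial>lborel\<bar> \<le> (\<integral>\<sigma>. kernel \<alpha> \<sigma> * B \<partial>lborel)"
    by (rule order_trans[OF integral_abs_bound integral_mono]) (use i ki le in auto)
  also have "\<dots> = B / (\<alpha> * Gamma \<alpha>)"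
    using k by (simp add: has_bochner_integral_iff)
  finally show "\<bar>\<integral>\<sigma>. kernel \<alpha> \<sigma> * w \<sigma> \<partial>lborel\<bar> \<le> B / (\<alpha> * Gamma \<alpha>)" .
qed

text \<open>Values of \<psi> at negative arguments are arbitrary and may spoil measurability. Under
  the kernel only arguments t \<sigma> \<ge> 0 matter, where a Borel copy agrees with
  \<psi>.\<close>

lemma continuous_on_atLeast_measurable_extension:
  fixes \<psi> :: "real \<Rightarrow> real"
  assumes c: "continuous_on {0..} \<psi>"
  obtains \<psi>' where "\<psi>' \<in> borel_measurable borel" "\<And>t. t \<ge> 0 \<Longrightarrow> \<psi>' t = \<psi> t"
proof
  show "(\<lambda>t. indicator {0..} t * \<psi> t) \<in> borel_measurable borel"
    using borel_measurable_continuous_on_indicator[OF _ c] by simp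
qed auto

text \<open>The three bounds stand for derivative bounds of order s^(-k) with k = 0, 1, 2, phrased
  by differences because these pass through the integral over \<sigma>. They reach up to 2a so that
  forward increments are still available at t = a.\<close>

context
  fixes \<alpha> a b :: real and \<psi> :: "real \<Rightarrow> real"
  assumes \<alpha>: "\<alpha> > 0" and a: "a > 0" and c\<psi>: "continuous_on {0..} \<psi>"
    and b0: "\<And>s. 0 < s \<Longrightarrow> s \<le> 2 * a \<Longrightarrow> \<bar>\<psi> s\<bar> \<le> b"
    and b1: "\<And>s h. 0 < s \<Longrightarrow> 0 \<le> h \<Longrightarrow> s + h \<le> 2 * a \<Longrightarrow> \<bar>\<psi> (s + h) - \<psi> s\<bar> \<le> b * h / s"
    and b2: "\<And>s h k. 0 < s \<Longrightarrow> 0 \<le> h \<Longrightarrow> 0 \<le> k \<Longrightarrow> s + h + k \<le> 2 * a \<Longrightarrow>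
      \<bar>\<psi> (s + h + k) - \<psi> (s + k) - (\<psi> (s + h) - \<psi> s)\<bar> \<le> b * h * k / s\<^sup>2"
begin

lemma bound_nonneg: "b \<ge> 0"
  using b0[of a] a by auto

lemma kernel_mean_comb:
  assumes w: "\<And>\<sigma>. 0 < \<sigma> \<Longrightarrow> \<sigma> < 1 \<Longrightarrow>
      \<bar>c1 * \<psi> (t1 * \<sigma>) + c2 * \<psi> (t2 * \<sigma>) + c3 * \<psi> (t3 * \<sigma>) + c4 * \<psi> (t4 * \<sigma>)\<bar> \<le> B"
    and t: "t1 \<in> {0..2 * a}" "t2 \<in> {0..2 * a}" "t3 \<in> {0..2 * a}" "t4 \<in> {0..2 * a}"
  shows "\<bar>c1 * kernel_mean \<alpha> \<psi> t1 + c2 * kernel_mean \<alpha> \<psi> t2 + c3 * kernel_mean \<alpha> \<psi> t3 + c4 * kernel_mean \<alpha> \<psi> t4\<bar> \<le> B / (\<alpha> * Gamma \<alpha>)"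
proof -
  obtain \<psi>' where [measurable]: "\<psi>' \<in> borel_measurable borel" and eq: "\<And>t. t \<ge> 0 \<Longrightarrow> \<psi>' t = \<psi> t"
    using continuous_on_atLeast_measurable_extension[OF c\<psi>] by blast
  have Keq: "kernel_mean \<alpha> \<psi> t = (\<integral>\<sigma>. kernel \<alpha> \<sigma> * \<psi>' (t * \<sigma>) \<partial>lborel)" if "t \<in> {0..2 * a}" for t
    unfolding kernel_mean_def
    by (intro Bochner_Integration.integral_cong refl) (use that eq in \<open>auto simp: kernel_def indicator_def\<close>)
  have i: "integrable lborel (\<lambda>\<sigma>. kernel \<alpha> \<sigma> * \<psi>' (t * \<sigma>))" if t: "t \<in> {0..2 * a}" for t
  proof (rule kernel_integrable(1)[OF \<alpha>, of _ "max b \<bar>\<psi> 0\<bar>"])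
    fix \<sigma> :: real assume s: "0 < \<sigma>" "\<sigma> < 1"
    have "t * \<sigma> \<le> 2 * a"
      using mult_mono[of t "2 * a" \<sigma> 1] s t a by auto
    then show "\<bar>\<psi>' (t * \<sigma>)\<bar> \<le> max b \<bar>\<psi> 0\<bar>"
      using b0[of "t * \<sigma>"] s t eq[of "t * \<sigma>"] by (cases "t = 0") (auto simp: eq)
  qed measurable
  let ?w = "\<lambda>\<sigma>. c1 * \<psi>' (t1 * \<sigma>) + c2 * \<psi>' (t2 * \<sigma>) + c3 * \<psi>' (t3 * \<sigma>) + c4 * \<psi>' (t4 * \<sigma>)"
  have "\<bar>\<integral>\<sigma>. kernel \<alpha> \<sigma> * ?w \<sigma> \<partial>lborel\<bar> \<le> B / (\<alpha> * Gamma \<alpha>)"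
    by (rule kernel_integrable(2)[OF \<alpha>]) (use w t eq in auto)
  also have "(\<integral>\<sigma>. kernel \<alpha> \<sigma> * ?w \<sigma> \<partial>lborel) = (\<integral>\<sigma>. c1 * (kernel \<alpha> \<sigma> * \<psi>' (t1 * \<sigma>)) + c2 * (kernel \<alpha> \<sigma> * \<psi>' (t2 * \<sigma>))
      + c3 * (kernel \<alpha> \<sigma> * \<psi>' (t3 * \<sigma>)) + c4 * (kernel \<alpha> \<sigma> * \<psi>' (t4 * \<sigma>)) \<partial>lborel)"
    by (intro Bochner_Integration.integral_cong refl) (simp add: algebra_simps)
  also have "\<dots> = c1 * kernel_mean \<alpha> \<psi> t1 + c2 * kernel_mean \<alpha> \<psi> t2 + c3 * kernel_mean \<alpha> \<psi> t3 + c4 * kernel_mean \<alpha> \<psi> t4"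
    using t by (simp add: i Keq)
  finally show ?thesis .
qed

lemma kernel_mean_bound: "0 < t \<Longrightarrow> t \<le> 2 * a \<Longrightarrow> \<bar>kernel_mean \<alpha> \<psi> t\<bar> \<le> b / (\<alpha> * Gamma \<alpha>)"
proof -
  assume t: "0 < t" "t \<le> 2 * a"
  have "\<bar>\<psi> (t * \<sigma>)\<bar> \<le> b" if "0 < \<sigma>" "\<sigma> < 1" for \<sigma>
  proof (rule b0)
    show "t * \<sigma> \<le> 2 * a"
      using that t mult_left_le[of \<sigma> t] by linarith
  qed (use that t in auto)
  then show ?thesis
    using kernel_mean_comb[of 1 t 0 t 0 t 0 t b] t by simp
qed

text \<open>Passing from t and h to t \<sigma> and h \<sigma> leaves h / t unchanged, so the bound
  for \<psi> is inherited with the mass of the kernel as the only extra factor. Second differences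
  scale in the same way.\<close>

lemma kernel_mean_diff: "0 < t \<Longrightarrow> 0 \<le> h \<Longrightarrow> t + h \<le> 2 * a \<Longrightarrow> \<bar>kernel_mean \<alpha> \<psi> (t + h) - kernel_mean \<alpha> \<psi> t\<bar> \<le> b * h / t / (\<alpha> * Gamma \<alpha>)"
proof -
  assume t: "0 < t" "0 \<le> h" "t + h \<le> 2 * a"
  have "\<bar>\<psi> ((t + h) * \<sigma>) - \<psi> (t * \<sigma>)\<bar> \<le> b * h / t" if "0 < \<sigma>" "\<sigma> < 1" for \<sigma>
    using that t b1[of "t * \<sigma>" "h * \<sigma>"] mult_left_mono[of \<sigma> 1 "t + h"]
    by (auto simp: distrib_right)
  then show ?thesis
    using kernel_mean_comb[of 1 "t + h" "-1" t 0 t 0 t "b * h / t"] t by simp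
qed

lemma kernel_mean_diff2: "0 < t \<Longrightarrow> 0 \<le> h \<Longrightarrow> 0 \<le> k \<Longrightarrow> t + h + k \<le> 2 * a \<Longrightarrow>
    \<bar>kernel_mean \<alpha> \<psi> (t + h + k) - kernel_mean \<alpha> \<psi> (t + k) - (kernel_mean \<alpha> \<psi> (t + h) - kernel_mean \<alpha> \<psi> t)\<bar> \<le> b * h * k / t\<^sup>2 / (\<alpha> * Gamma \<alpha>)"
proof -
  assume t: "0 < t" "0 \<le> h" "0 \<le> k" "t + h + k \<le> 2 * a"
  have "\<bar>\<psi> ((t + h + k) * \<sigma>) - \<psi> ((t + k) * \<sigma>) - (\<psi> ((t + h) * \<sigma>) - \<psi> (t * \<sigma>))\<bar> \<le> b * h * k / t\<^sup>2"
    if "0 < \<sigma>" "\<sigma> < 1" for \<sigma>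
    using that t b2[of "t * \<sigma>" "h * \<sigma>" "k * \<sigma>"] mult_left_mono[of \<sigma> 1 "t + h + k"]
    by (auto simp: distrib_right power2_eq_square)
  then show ?thesis
    using kernel_mean_comb[of 1 "t + h + k" "-1" "t + k" "-1" "t + h" 1 t "b * h * k / t\<^sup>2"] t
    by (simp add: algebra_simps)
qed

text \<open>A mean over (0,t) sees only the values of \<psi> there, and at argument 0 it is \<psi> 0
  times the mass of the kernel. This is the source of the small-time behaviour of the primitive of
  S.\<close>

lemma kernel_mean_at_0:
  assumes t: "0 < t" "t \<le> 2 * a" and e: "\<And>s. 0 < s \<Longrightarrow> s < t \<Longrightarrow> \<bar>\<psi> s - \<psi> 0\<bar> \<le> e"
  shows "\<bar>kernel_mean \<alpha> \<psi> t - \<psi> 0 / (\<alpha> * Gamma \<alpha>)\<bar> \<le> e / (\<alpha> * Gamma \<alpha>)"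
proof -
  have "\<bar>\<psi> (t * \<sigma>) - \<psi> 0\<bar> \<le> e" if "0 < \<sigma>" "\<sigma> < 1" for \<sigma>
    using that t by (intro e) auto
  then have "\<bar>kernel_mean \<alpha> \<psi> t - kernel_mean \<alpha> \<psi> 0\<bar> \<le> e / (\<alpha> * Gamma \<alpha>)"
    using kernel_mean_comb[of 1 t "-1" 0 0 t 0 t e] t by simp
  moreover have "kernel_mean \<alpha> \<psi> 0 = \<psi> 0 / (\<alpha> * Gamma \<alpha>)"
    using has_bochner_integral_kernel[OF \<alpha>] by (simp add: kernel_mean_def has_bochner_integral_iff)
  ultimately show ?thesis by simp
qed

context
  fixes \<phi> :: "real \<Rightarrow> real"
  assumes c\<phi>: "continuous_on {0<..} \<phi>"
    and i\<phi>: "\<And>t. integrable lborel (\<lambda>s. indicator {0<..<t} s * \<phi> s)"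
    and eq\<phi>: "\<And>t. t > 0 \<Longrightarrow> (\<integral>s. indicator {0<..<t} s * \<phi> s \<partial>lborel) = frac_int \<alpha> \<psi> t"
begin

text \<open>By the hypothesis on \<phi> and the scaling identity, the kernel mean is t^(-\<alpha>)
  times the primitive of \<phi>; the product rule and the fundamental theorem of calculus do the
  rest.\<close>

lemma kernel_mean_deriv:
  assumes t: "0 < t"
  shows "(kernel_mean \<alpha> \<psi> has_real_derivative (t powr (- \<alpha>) * \<phi> t - \<alpha> / t * kernel_mean \<alpha> \<psi> t)) (at t)"
proof -
  define I where "I t = (\<integral>s. indicator {0<..<t} s * \<phi> s \<partial>lborel)" for t
  \<comment> \<open>\<phi> may be unbounded near 0, so the integral up to t / 2 is split off; on
    [t/2, 2t] the integrand is continuous and t is an interior point.\<close>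
  have I_eq: "I s = I (t/2) + integral {t/2..s} \<phi>" if s: "s \<in> {t/2..2*t}" for s
  proof -
    have cs: "continuous_on {t/2..s} \<phi>"
      by (rule continuous_on_subset[OF c\<phi>]) (use t in auto)
    have bi: "set_integrable lborel {t/2..s} \<phi>"
      by (rule borel_integrable_compact[OF compact_Icc cs, folded set_integrable_def])
    have "integral {t/2..s} \<phi> = (\<integral>r. indicator {t/2..s} r * \<phi> r \<partial>lborel)"
      using set_borel_integral_eq_integral(2)[OF bi] by (simp add: set_lebesgue_integral_def)
    moreover have "I s = (\<integral>r. indicator {0<..<t/2} r * \<phi> r + indicator {t/2..s} r * \<phi> r \<partial>lborel)"
      unfolding I_def
    proof (rule integral_cong_AE)
      have "AE r in lborel. r \<noteq> s" by (rule AE_lborel_singleton)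
      then show "AE r in lborel. indicator {0<..<s} r * \<phi> r =
          indicator {0<..<t/2} r * \<phi> r + indicator {t/2..s} r * \<phi> r"
        by eventually_elim (use s t in \<open>auto simp: indicator_def\<close>)
    qed (use i\<phi> bi in \<open>auto simp: set_integrable_def\<close>)
    ultimately show ?thesis
      using i\<phi> bi unfolding I_def by (simp add: set_integrable_def)
  qed
  have "((\<lambda>s. integral {t/2..s} \<phi>) has_real_derivative \<phi> t) (at t within {t/2..2*t})"
    by (rule integral_has_real_derivative) (use t in \<open>auto intro: continuous_on_subset[OF c\<phi>]\<close>)
  then have "((\<lambda>s. I (t/2) + integral {t/2..s} \<phi>) has_real_derivative \<phi> t) (at t within {t/2..2*t})"
    by (auto intro!: derivative_eq_intros)
  then have "(I has_real_derivative \<phi> t) (at t within {t/2..2*t})"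
    by (rule has_field_derivative_transform_within[where d=1])
      (use t in \<open>simp_all add: I_eq[symmetric]\<close>)
  then have "(I has_real_derivative \<phi> t) (at t)"
    using t at_within_interior[of t "{t/2..2*t}"] by (simp add: interior_atLeastAtMost_real)
  then have D: "((\<lambda>s. s powr (- \<alpha>) * I s) has_real_derivative
      (- \<alpha> * t powr (- \<alpha> - 1) * I t + t powr (- \<alpha>) * \<phi> t)) (at t)"
    using t by (auto intro!: derivative_eq_intros)
  have KI: "kernel_mean \<alpha> \<psi> s = s powr (- \<alpha>) * I s" if "s > 0" for s
    using eq\<phi>[OF that] frac_int_eq_kernel_mean[OF that, of \<alpha> \<psi>] that
    by (simp add: I_def mult.assoc[symmetric] powr_add[symmetric])
  have "(kernel_mean \<alpha> \<psi> has_real_derivative (- \<alpha> * t powr (- \<alpha> - 1) * I t + t powr (- \<alpha>) * \<phi> t)) (at t)"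
    by (rule has_field_derivative_transform_within[OF D, where d=t]) (use t in \<open>auto simp: KI dist_real_def\<close>)
  moreover have "- \<alpha> * t powr (- \<alpha> - 1) * I t = - (\<alpha> / t * kernel_mean \<alpha> \<psi> t)"
    using t by (simp add: KI powr_diff)
  ultimately show ?thesis by (simp add: algebra_simps)
qed

text \<open>Solving the derivative formula for \<phi> gives \<phi> = t^\<alpha> \<kappa> + \<alpha>
  t^(\<alpha> - 1) K, where K is the kernel mean and \<kappa> its derivative. Values, first and
  second differences of K bound K, \<kappa> and the increments of \<kappa>. The fractional integral
  is thus inverted without a fractional derivative.\<close>

lemma frac_int_inverse_bounds:
  assumes t: "0 < t" "t < 2 * a"
  shows "\<bar>\<phi> t\<bar> \<le> b * (1 + \<alpha>) / (\<alpha> * Gamma \<alpha>) * t powr (\<alpha> - 1)"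
    and "t \<le> t' \<Longrightarrow> t' < 2 * a \<Longrightarrow> \<bar>\<phi> t' - \<phi> t\<bar> \<le> b / (\<alpha> * Gamma \<alpha>) * powr_modulus \<alpha> t t'"
proof -
  define c where "c = b / (\<alpha> * Gamma \<alpha>)"
  have c: "c \<ge> 0"
    using bound_nonneg \<alpha> Gamma_real_pos[OF \<alpha>] by (simp add: c_def)
  define \<kappa> where "\<kappa> s = s powr (- \<alpha>) * \<phi> s - \<alpha> / s * kernel_mean \<alpha> \<psi> s" for s
  have D: "(kernel_mean \<alpha> \<psi> has_real_derivative \<kappa> s) (at s)" if "s > 0" for s
    using kernel_mean_deriv[OF that] by (simp add: \<kappa>_def)
  have K: "\<bar>kernel_mean \<alpha> \<psi> s\<bar> \<le> c" if "0 < s" "s < 2 * a" for s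
    using kernel_mean_bound[of s] that by (simp add: c_def)
  have Kd: "\<bar>kernel_mean \<alpha> \<psi> s' - kernel_mean \<alpha> \<psi> s\<bar> \<le> c * (s' - s) / s" if "0 < s" "s \<le> s'" "s' < 2 * a" for s s'
    using kernel_mean_diff[of s "s' - s"] that by (simp add: c_def mult.commute)
  have k: "\<bar>\<kappa> s\<bar> \<le> c / s" if s: "0 < s" "s < 2 * a" for s
  proof (rule DERIV_bound_right[OF D])
    show "0 < 2 * a - s" using s by simp
    fix h assume "0 < h" "h < 2 * a - s"
    then show "\<bar>kernel_mean \<alpha> \<psi> (s + h) - kernel_mean \<alpha> \<psi> s\<bar> \<le> c / s * h"
      using Kd[of s "s + h"] s by (simp add: mult.commute)
  qed (use s in simp)
  \<comment> \<open>For fixed s' - s the function r \<mapsto> K(r + (s' - s)) - K(r) has derivative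
    \<kappa> s' - \<kappa> s at s, and its increments are second differences of K.\<close>
  have kd: "\<bar>\<kappa> s' - \<kappa> s\<bar> \<le> c * (s' - s) / s\<^sup>2" if s: "0 < s" "s \<le> s'" "s' < 2 * a" for s s'
  proof (rule DERIV_bound_right[of "\<lambda>r. kernel_mean \<alpha> \<psi> (r + (s' - s)) - kernel_mean \<alpha> \<psi> r"])
    show "((\<lambda>r. kernel_mean \<alpha> \<psi> (r + (s' - s)) - kernel_mean \<alpha> \<psi> r) has_real_derivative \<kappa> s' - \<kappa> s) (at s)"
      using D[of s'] D[of s] s DERIV_shift[of "kernel_mean \<alpha> \<psi>" "\<kappa> s'" s "s' - s"] by (intro DERIV_diff) auto
    show "0 < 2 * a - s'" using s by simp
    fix h assume "0 < h" "h < 2 * a - s'"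
    then show "\<bar>kernel_mean \<alpha> \<psi> (s + h + (s' - s)) - kernel_mean \<alpha> \<psi> (s + h) - (kernel_mean \<alpha> \<psi> (s + (s' - s)) - kernel_mean \<alpha> \<psi> s)\<bar> \<le> c * (s' - s) / s\<^sup>2 * h"
      using kernel_mean_diff2[of s h "s' - s"] s by (simp add: c_def algebra_simps)
  qed
  have phi: "\<phi> s = s powr \<alpha> * \<kappa> s + \<alpha> * s powr (\<alpha> - 1) * kernel_mean \<alpha> \<psi> s" if "s > 0" for s
    using that by (simp add: \<kappa>_def right_diff_distrib mult.assoc[symmetric] powr_add[symmetric] powr_diff)
  have "\<bar>\<phi> t\<bar> \<le> t powr \<alpha> * \<bar>\<kappa> t\<bar> + \<alpha> * t powr (\<alpha> - 1) * \<bar>kernel_mean \<alpha> \<psi> t\<bar>"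
    using phi[OF t(1)] \<alpha> abs_triangle_ineq[of "t powr \<alpha> * \<kappa> t" "\<alpha> * t powr (\<alpha> - 1) * kernel_mean \<alpha> \<psi> t"]
    by (simp add: abs_mult)
  also have "\<dots> \<le> t powr \<alpha> * (c / t) + \<alpha> * t powr (\<alpha> - 1) * c"
    using k[OF t] K[OF t] \<alpha> by (intro add_mono mult_left_mono) auto
  also have "\<dots> = b * (1 + \<alpha>) / (\<alpha> * Gamma \<alpha>) * t powr (\<alpha> - 1)"
    using t by (simp add: c_def powr_diff add_divide_distrib algebra_simps)
  finally show "\<bar>\<phi> t\<bar> \<le> b * (1 + \<alpha>) / (\<alpha> * Gamma \<alpha>) * t powr (\<alpha> - 1)" .
  assume t': "t \<le> t'" "t' < 2 * a"
  have eq: "\<phi> t' - \<phi> t = (t' powr \<alpha> - t powr \<alpha>) * \<kappa> t' + t powr \<alpha> * (\<kappa> t' - \<kappa> t) +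
      \<alpha> * (t' powr (\<alpha> - 1) - t powr (\<alpha> - 1)) * kernel_mean \<alpha> \<psi> t' + \<alpha> * t powr (\<alpha> - 1) * (kernel_mean \<alpha> \<psi> t' - kernel_mean \<alpha> \<psi> t)"
    using t t' by (simp add: phi algebra_simps)
  have tri: "\<bar>A1 + A2 + A3 + A4\<bar> \<le> \<bar>A1\<bar> + \<bar>A2\<bar> + \<bar>A3\<bar> + \<bar>A4\<bar>" for A1 A2 A3 A4 :: real
    by linarith
  have "\<bar>\<phi> t' - \<phi> t\<bar> \<le> \<bar>t' powr \<alpha> - t powr \<alpha>\<bar> * \<bar>\<kappa> t'\<bar> + t powr \<alpha> * \<bar>\<kappa> t' - \<kappa> t\<bar> +
      \<alpha> * \<bar>t' powr (\<alpha> - 1) - t powr (\<alpha> - 1)\<bar> * \<bar>kernel_mean \<alpha> \<psi> t'\<bar> + \<alpha> * t powr (\<alpha> - 1) * \<bar>kernel_mean \<alpha> \<psi> t' - kernel_mean \<alpha> \<psi> t\<bar>"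
    unfolding eq using \<alpha> by (rule_tac order_trans[OF tri]) (simp add: abs_mult)
  also have "\<dots> \<le> \<bar>t' powr \<alpha> - t powr \<alpha>\<bar> * (c / t') + t powr \<alpha> * (c * (t' - t) / t\<^sup>2) +
      \<alpha> * \<bar>t' powr (\<alpha> - 1) - t powr (\<alpha> - 1)\<bar> * c + \<alpha> * t powr (\<alpha> - 1) * (c * (t' - t) / t)"
    using k[of t'] kd[of t t'] K[of t'] Kd[of t t'] \<alpha> t t'
    by (intro add_mono mult_left_mono) auto
  also have "\<dots> = c * powr_modulus \<alpha> t t'"
    using t' by (simp add: powr_modulus_def algebra_simps)
  finally show "\<bar>\<phi> t' - \<phi> t\<bar> \<le> b / (\<alpha> * Gamma \<alpha>) * powr_modulus \<alpha> t t'"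
    by (simp add: c_def)
qed

end
end

section \<open>Solution operators of analytic type\<close>

lemma cinner_diff_left: "cinner (x - y) z = cinner x z - cinner y (z::'e::complex_hilbert)"
proof -
  have "cinner (x - y) z + cinner y z = cinner x z"
    by (metis cinner_add_left diff_add_cancel)
  then show ?thesis by (simp add: algebra_simps)
qed

lemma norm_scaleC: "norm (c *\<^sub>C x) = cmod c * norm (x::'e::complex_hilbert)"
proof -
  have 1: "cinner (c *\<^sub>C x) (c *\<^sub>C x) = c * cnj c * cinner x x"
    by (metis cinner_scaleC_left cinner_commute complex_cnj_mult mult.assoc)
  have "(norm (c *\<^sub>C x))\<^sup>2 = Re (cinner (c *\<^sub>C x) (c *\<^sub>C x))"
    by (simp add: power2_norm_eq_inner inner_eq_Re_cinner)
  also have "\<dots> = (cmod c)\<^sup>2 * Re (cinner x x)"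
    unfolding 1 complex_norm_square[symmetric] by (simp flip: of_real_power)
  also have "\<dots> = (cmod c * norm x)\<^sup>2"
    by (simp add: power_mult_distrib power2_norm_eq_inner inner_eq_Re_cinner)
  finally show ?thesis
    by (simp add: power2_eq_iff_nonneg)
qed

text \<open>A unimodular factor c makes the complex inner product real and nonnegative, which
  reduces the claim to the real Cauchy-Schwarz inequality.\<close>

lemma norm_cinner_le: "cmod (cinner x y) \<le> norm x * norm (y::'e::complex_hilbert)"
proof (cases "cinner x y = 0")
  case False
  define c where "c = cnj (cinner x y) / cmod (cinner x y)"
  have "c * cinner x y = of_real (cmod (cinner x y))"
    using False complex_norm_square[of "cinner x y"]
    by (simp add: c_def divide_simps mult.commute power2_eq_square)
  then have "cmod (cinner x y) = Re (cinner (c *\<^sub>C x) y)"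
    by (simp only: cinner_scaleC_left Re_complex_of_real)
  also have "\<dots> \<le> norm (c *\<^sub>C x) * norm y"
    using norm_cauchy_schwarz[of "c *\<^sub>C x" y] by (simp add: inner_eq_Re_cinner)
  also have "norm (c *\<^sub>C x) = norm x"
    using False by (simp add: norm_scaleC c_def norm_divide)
  finally show ?thesis .
qed auto

lemma bounded_linear_scaleC: "bounded_linear (\<lambda>x. c *\<^sub>C (x::'e::complex_hilbert))"
  by (rule bounded_linear_intro[where K="cmod c"])
    (auto simp: scaleC_add_right scaleR_scaleC scaleC_scaleC norm_scaleC mult.commute)

lemma in_sector_iff:
  assumes "\<theta> \<le> pi / 2"
  shows "z \<in> sector \<theta> \<longleftrightarrow> 0 < Re z \<and> \<bar>Arg z\<bar> < \<theta>"
proof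
  assume z: "z \<in> sector \<theta>"
  then have "cos (Arg z) > 0"
    using assms by (intro cos_gt_zero_pi) (auto simp: sector_def)
  moreover have "Re z = cmod z * cos (Arg z)"
    by (metis Re_rcis rcis_cmod_Arg)
  ultimately show "0 < Re z \<and> \<bar>Arg z\<bar> < \<theta>"
    using z by (auto simp: sector_def)
qed (auto simp: sector_def)

lemma open_sector:
  assumes "\<theta> \<le> pi / 2"
  shows "open (sector \<theta>)"
proof -
  have "continuous_on {z. 0 < Re z} Arg"
    by (rule continuous_on_subset[of "- \<real>\<^sub>\<le>\<^sub>0"])
      (auto simp: complex_nonpos_Reals_iff intro!: continuous_at_imp_continuous_on continuous_at_Arg)
  then have "open ({z. 0 < Re z} \<inter> Arg -` {- \<theta><..<\<theta>})"
    by (intro continuous_open_preimage) (auto simp: open_halfspace_Re_gt)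
  moreover have "sector \<theta> = {z. 0 < Re z} \<inter> Arg -` {- \<theta><..<\<theta>}"
    by (rule set_eqI)
      (simp add: in_sector_iff[OF assms] abs_less_iff minus_less_iff[of "Arg _"] conj_commute)
  ultimately show ?thesis by simp
qed

text \<open>The sector is a cone, so a disc around 1 inside it scales to discs around every t > 0.
  Radii proportional to t are what produces the powers t^(-k) in Cauchy's inequality.\<close>

lemma ball_subset_sector:
  assumes \<theta>: "0 < \<theta>" "\<theta> \<le> pi / 2"
  obtains \<rho> where "0 < \<rho>" "\<rho> \<le> 1" "\<And>t. 0 < t \<Longrightarrow> ball (complex_of_real t) (\<rho> * t) \<subseteq> sector \<theta>"
proof -
  have "1 \<in> sector \<theta>"
    using \<theta> by (simp add: sector_def)
  then obtain r where r: "r > 0" "ball 1 r \<subseteq> sector \<theta>"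
    using open_sector[OF \<theta>(2)] open_contains_ball by blast
  show ?thesis
  proof
    show "0 < min r 1" "min r 1 \<le> 1" using r by auto
    fix t :: real assume t: "0 < t"
    show "ball (complex_of_real t) (min r 1 * t) \<subseteq> sector \<theta>"
    proof
      fix z assume z: "z \<in> ball (complex_of_real t) (min r 1 * t)"
      define w where "w = z / of_real t"
      have zw: "z = of_real t * w" using t by (simp add: w_def)
      have "dist (complex_of_real t) z = t * dist 1 w"
        unfolding dist_norm zw using t norm_mult[of "of_real t" "1 - w"] by (simp add: right_diff_distrib)
      then have "t * dist 1 w < t * r"
        using z t by (auto simp: mult.commute intro: order.strict_trans2)
      then have "w \<in> sector \<theta>"
        using r t by auto
      then show "z \<in> sector \<theta>"
        using t by (simp add: zw sector_def)
    qed
  qed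
qed

text \<open>The operator-norm difference quotient is applied to x and paired with y. Estimates for
  scalar holomorphic functions then become available for every pair x, y.\<close>

lemma operator_analytic_imp_holomorphic:
  fixes T :: "complex \<Rightarrow> 'e::complex_hilbert \<Rightarrow> 'e"
  assumes o: "open \<Omega>" and T: "operator_analytic_on T \<Omega>"
  shows "(\<lambda>z. cinner (T z x) y) holomorphic_on \<Omega>"
  unfolding holomorphic_on_open[OF o]
proof
  fix z assume z: "z \<in> \<Omega>"
  then obtain T' where T': "bounded_clinear T'"
    and lim: "((\<lambda>h. onorm (\<lambda>x. (1 / h) *\<^sub>C (T (z + h) x - T z x) - T' x)) \<longlongrightarrow> 0) (at 0)"
    using T unfolding operator_analytic_on_def by blast
  have bl: "bounded_linear (T w)" if "w \<in> \<Omega>" for w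
    using T that unfolding operator_analytic_on_def bounded_clinear_def by blast
  have "eventually (\<lambda>h. z + h \<in> \<Omega>) (at 0)"
  proof -
    have "((\<lambda>h. z + h) \<longlongrightarrow> z + 0) (at 0)"
      by (intro tendsto_intros)
    then show ?thesis
      using topological_tendstoD[of "\<lambda>h. z + h" "z + 0" "at 0" \<Omega>] o z by simp
  qed
  then have ev: "\<forall>\<^sub>F h in at 0. norm ((cinner (T (z + h) x) y - cinner (T z x) y) / h - cinner (T' x) y) \<le>
      onorm (\<lambda>x. (1 / h) *\<^sub>C (T (z + h) x - T z x) - T' x) * norm x * norm y"
  proof eventually_elim
    case (elim h)
    let ?D = "\<lambda>x. (1 / h) *\<^sub>C (T (z + h) x - T z x) - T' x"
    have "bounded_linear ?D"
      using T' bl[OF elim] bl[OF z]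
      by (intro bounded_linear_sub bounded_linear_compose[OF bounded_linear_scaleC])
        (auto simp: bounded_clinear_def)
    then have D: "norm (?D x) \<le> onorm ?D * norm x"
      by (rule onorm)
    have "(cinner (T (z + h) x) y - cinner (T z x) y) / h - cinner (T' x) y = cinner (?D x) y"
      by (simp add: cinner_diff_left cinner_scaleC_left)
    also have "norm \<dots> \<le> norm (?D x) * norm y"
      by (rule norm_cinner_le)
    also have "\<dots> \<le> onorm ?D * norm x * norm y"
      using D by (rule mult_right_mono) simp
    finally show ?case .
  qed
  have "((\<lambda>h. (cinner (T (z + h) x) y - cinner (T z x) y) / h - cinner (T' x) y) \<longlongrightarrow> 0) (at 0)"
    by (rule Lim_null_comparison[OF ev]) (use lim in \<open>auto intro!: tendsto_eq_intros\<close>)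
  then have "((\<lambda>z. cinner (T z x) y) has_field_derivative cinner (T' x) y) (at z)"
    unfolding DERIV_def by (simp add: LIM_zero_iff)
  then show "\<exists>f'. ((\<lambda>z. cinner (T z x) y) has_field_derivative f') (at z)"
    by blast
qed

text \<open>Cauchy's inequality on the disc of radius \<rho> t / 2 bounds the k-th derivative at t
  by k! B (2 / (\<rho> t))^k. The constant 8 B / \<rho>^2 is the one for k = 2, and by \<rho> \<le>
  1 it also covers 2 B / \<rho> for k = 1. The mean value theorem, used once or twice, turns
  derivatives into differences.\<close>

lemma holomorphic_real_differences:
  fixes g :: "complex \<Rightarrow> complex"
  assumes \<Omega>: "open \<Omega>" and g: "g holomorphic_on \<Omega>" and \<rho>: "0 < \<rho>" "\<rho> \<le> 1"
    and ball: "\<And>t. 0 < t \<Longrightarrow> t \<le> R \<Longrightarrow> ball (complex_of_real t) (\<rho> * t) \<subseteq> \<Omega>"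
    and B: "\<And>t z. 0 < t \<Longrightarrow> t \<le> R \<Longrightarrow> z \<in> ball (complex_of_real t) (\<rho> * t) \<Longrightarrow> cmod (g z) \<le> B"
  defines "\<psi> \<equiv> \<lambda>t. Re (g (complex_of_real t))"
  shows "0 < s \<Longrightarrow> 0 \<le> h \<Longrightarrow> s + h \<le> R \<Longrightarrow> \<bar>\<psi> (s + h) - \<psi> s\<bar> \<le> (8 * B / \<rho>\<^sup>2) * h / s"
    and "0 < s \<Longrightarrow> 0 \<le> h \<Longrightarrow> 0 \<le> k \<Longrightarrow> s + h + k \<le> R \<Longrightarrow>
      \<bar>\<psi> (s + h + k) - \<psi> (s + k) - (\<psi> (s + h) - \<psi> s)\<bar> \<le> (8 * B / \<rho>\<^sup>2) * h * k / s\<^sup>2"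
proof -
  have B0: "B \<ge> 0" if "0 < t" "t \<le> R" for t
  proof -
    have "complex_of_real t \<in> ball (of_real t) (\<rho> * t)"
      using that \<rho> by simp
    then show ?thesis
      using B[OF that] norm_ge_zero order_trans by blast
  qed
  have dom: "complex_of_real t \<in> \<Omega>" if "0 < t" "t \<le> R" for t
    using ball[OF that] that \<rho> by auto
  have cauchy: "cmod ((deriv ^^ n) g (of_real t)) \<le> fact n * B / (\<rho> * t / 2) ^ n" if t: "0 < t" "t \<le> R" for t n
  proof (rule Cauchy_inequality)
    have sub: "cball (complex_of_real t) (\<rho> * t / 2) \<subseteq> ball (complex_of_real t) (\<rho> * t)"
    proof -
      have "0 < \<rho> * t" using t \<rho> by simp
      then show ?thesis by auto
    qed
    then have sub': "cball (complex_of_real t) (\<rho> * t / 2) \<subseteq> \<Omega>"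
      using ball[OF t] by blast
    show "g holomorphic_on ball (complex_of_real t) (\<rho> * t / 2)"
      using sub' ball_subset_cball holomorphic_on_subset[OF g] by blast
    show "continuous_on (cball (complex_of_real t) (\<rho> * t / 2)) g"
      using holomorphic_on_imp_continuous_on[OF g] continuous_on_subset sub' by blast
    show "0 < \<rho> * t / 2" using t \<rho> by simp
    fix z assume "cmod (of_real t - z) = \<rho> * t / 2"
    then have "z \<in> cball (complex_of_real t) (\<rho> * t / 2)"
      by (simp add: dist_norm)
    then show "cmod (g z) \<le> B"
      using B[OF t] sub by blast
  qed
  define \<psi>1 where "\<psi>1 t = Re (deriv g (complex_of_real t))" for t
  have real_deriv: "((\<lambda>t. Re (u (complex_of_real t))) has_real_derivative Re u') (at t within A)"
    if "(u has_field_derivative u') (at (complex_of_real t))" for u u' t A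
  proof -
    have "((\<lambda>t. u (complex_of_real t)) has_vector_derivative u') (at t within A)"
      using that by (rule has_vector_derivative_real_field)
    then show ?thesis
      using bounded_linear.has_vector_derivative[OF bounded_linear_Re]
      by (simp add: has_real_derivative_iff_has_vector_derivative)
  qed
  have D0: "(\<psi> has_real_derivative \<psi>1 t) (at t within A)" if "0 < t" "t \<le> R" for t A
    unfolding \<psi>_def \<psi>1_def using dom[OF that] holomorphic_derivI[OF g \<Omega>] by (intro real_deriv) auto
  have D1: "(\<psi>1 has_real_derivative Re (deriv (deriv g) (of_real t))) (at t within A)" if "0 < t" "t \<le> R" for t A
    unfolding \<psi>1_def using dom[OF that] holomorphic_derivI[OF holomorphic_deriv[OF g \<Omega>] \<Omega>]
    by (intro real_deriv) auto
  have b1: "\<bar>\<psi>1 t\<bar> \<le> (8 * B / \<rho>\<^sup>2) / t" if t: "0 < t" "t \<le> R" for t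
  proof -
    have "\<bar>\<psi>1 t\<bar> \<le> B / (\<rho> * t / 2)"
      using cauchy[OF t, of 1] abs_Re_le_cmod[of "deriv g (of_real t)"] by (simp add: \<psi>1_def)
    also have "\<dots> = (2 * B * \<rho> / \<rho>\<^sup>2) / t"
      using \<rho> by (simp add: power2_eq_square)
    also have "\<dots> \<le> (8 * B / \<rho>\<^sup>2) / t"
      using B0[OF t] \<rho> t mult_left_mono[of \<rho> 1 "2 * B"] by (intro divide_right_mono) auto
    finally show ?thesis .
  qed
  have b2: "\<bar>Re (deriv (deriv g) (of_real t))\<bar> \<le> (8 * B / \<rho>\<^sup>2) / t\<^sup>2" if t: "0 < t" "t \<le> R" for t
  proof -
    have "\<bar>Re (deriv (deriv g) (of_real t))\<bar> \<le> 2 * B / (\<rho> * t / 2)\<^sup>2"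
      using cauchy[OF t, of 2] abs_Re_le_cmod[of "deriv (deriv g) (of_real t)"] by (simp add: numeral_2_eq_2)
    also have "\<dots> = (8 * B / \<rho>\<^sup>2) / t\<^sup>2"
      by (simp add: power_mult_distrib power_divide)
    finally show ?thesis .
  qed
  have mvt: "\<bar>u s' - u s\<bar> \<le> c * (s' - s)"
    if "s \<le> s'" "\<And>t. t \<in> {s..s'} \<Longrightarrow> (u has_real_derivative u' t) (at t within {s..s'})"
      "\<And>t. t \<in> {s..s'} \<Longrightarrow> \<bar>u' t\<bar> \<le> c" for u u' :: "real \<Rightarrow> real" and s s' c
    using field_differentiable_bound[of "{s..s'}" u u' c s' s] that by simp
  show "\<bar>\<psi> (s + h) - \<psi> s\<bar> \<le> (8 * B / \<rho>\<^sup>2) * h / s" if s: "0 < s" "0 \<le> h" "s + h \<le> R"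
  proof -
    have "\<bar>\<psi> (s + h) - \<psi> s\<bar> \<le> (8 * B / \<rho>\<^sup>2) / s * ((s + h) - s)"
    proof (rule mvt)
      fix t assume t: "t \<in> {s..s + h}"
      then show "(\<psi> has_real_derivative \<psi>1 t) (at t within {s..s + h})"
        using s by (intro D0) auto
      show "\<bar>\<psi>1 t\<bar> \<le> (8 * B / \<rho>\<^sup>2) / s"
        using s t B0[of s] \<rho> by (intro order_trans[OF b1] divide_left_mono) auto
    qed (use s in simp)
    then show ?thesis by simp
  qed
  assume s: "0 < s" "0 \<le> h" "0 \<le> k" "s + h + k \<le> R"
  \<comment> \<open>The increment over k is formed first; its derivative is an increment of \<psi>1,
    to which the bound on the second derivative applies.\<close>
  let ?u = "\<lambda>t. \<psi> (t + k) - \<psi> t"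
  have "\<bar>?u (s + h) - ?u s\<bar> \<le> ((8 * B / \<rho>\<^sup>2) / s\<^sup>2 * k) * ((s + h) - s)"
  proof (rule mvt[where u="?u"])
    fix t assume t: "t \<in> {s..s + h}"
    have tk: "((\<lambda>t. \<psi> (t + k)) has_real_derivative \<psi>1 (t + k)) (at t)"
      using D0[of "t + k" UNIV] s t by (simp add: DERIV_shift)
    show "(?u has_real_derivative (\<psi>1 (t + k) - \<psi>1 t)) (at t within {s..s + h})"
      by (intro DERIV_diff D0 has_field_derivative_at_within[OF tk]) (use s t in auto)
    have "\<bar>\<psi>1 (t + k) - \<psi>1 t\<bar> \<le> (8 * B / \<rho>\<^sup>2) / s\<^sup>2 * ((t + k) - t)"
    proof (rule mvt)
      fix r assume r: "r \<in> {t..t + k}"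
      then show "(\<psi>1 has_real_derivative Re (deriv (deriv g) (of_real r))) (at r within {t..t + k})"
        using s t by (intro D1) auto
      show "\<bar>Re (deriv (deriv g) (of_real r))\<bar> \<le> (8 * B / \<rho>\<^sup>2) / s\<^sup>2"
        using s t r B0[of s] \<rho> by (intro order_trans[OF b2] divide_left_mono power_mono) auto
    qed (use s in simp)
    then show "\<bar>\<psi>1 (t + k) - \<psi>1 t\<bar> \<le> (8 * B / \<rho>\<^sup>2) / s\<^sup>2 * k" by simp
  qed (use s in simp)
  then show "\<bar>\<psi> (s + h + k) - \<psi> (s + k) - (\<psi> (s + h) - \<psi> s)\<bar> \<le> (8 * B / \<rho>\<^sup>2) * h * k / s\<^sup>2"
    by (simp add: algebra_simps)
qed

text \<open>The scalar functions are bounded on the discs by B * norm x * norm y, so one constant C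
  serves all x and y. The operator T is the one supplied by the class.\<close>

lemma analytic_class_bounds:
  fixes A :: "'e::complex_hilbert \<Rightarrow> 'e"
  assumes \<theta>: "0 < \<theta>\<^sub>0" "\<theta>\<^sub>0 \<le> pi / 2" and A: "analytic_class \<alpha> \<omega>\<^sub>0 \<theta>\<^sub>0 D A" and R: "R > 0"
  obtains T M \<omega> C where "solution_operator \<alpha> D A T" "M \<ge> 0" "\<omega> \<ge> 0"
    "\<And>t. t > 0 \<Longrightarrow> onorm (T t) \<le> M * exp (\<omega> * t)"
    "\<And>s x y. 0 < s \<Longrightarrow> s \<le> R \<Longrightarrow> \<bar>T s x \<bullet> y\<bar> \<le> C * norm x * norm y"
    "\<And>s h x y. 0 < s \<Longrightarrow> 0 \<le> h \<Longrightarrow> s + h \<le> R \<Longrightarrow>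
       \<bar>T (s + h) x \<bullet> y - T s x \<bullet> y\<bar> \<le> C * norm x * norm y * h / s"
    "\<And>s h k x y. 0 < s \<Longrightarrow> 0 \<le> h \<Longrightarrow> 0 \<le> k \<Longrightarrow> s + h + k \<le> R \<Longrightarrow>
      \<bar>T (s + h + k) x \<bullet> y - T (s + k) x \<bullet> y - (T (s + h) x \<bullet> y - T s x \<bullet> y)\<bar>
        \<le> C * norm x * norm y * h * k / s\<^sup>2"
proof -
  obtain T T\<^sub>C where T: "solution_operator \<alpha> D A T"
    and eq: "\<forall>t>0. \<forall>x. T\<^sub>C (complex_of_real t) x = T t x"
    and an: "operator_analytic_on T\<^sub>C (sector \<theta>\<^sub>0)"
    and bd: "\<forall>\<theta> \<omega>. 0 < \<theta> \<and> \<theta> < \<theta>\<^sub>0 \<and> \<omega> > \<omega>\<^sub>0 \<longrightarrow>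
           (\<exists>M>0. \<forall>z\<in>sector \<theta>. onorm (T\<^sub>C z) \<le> M * exp (\<omega> * Re z))"
    using A unfolding analytic_class_def by (elim exE conjE) (rule that)
  note eq = eq[rule_format]
  \<comment> \<open>The exponent must exceed the given one strictly; being nonnegative, it also
    makes the bound increase with Re z.\<close>
  define \<omega> where "\<omega> = max 0 (\<omega>\<^sub>0 + 1)"
  obtain M where M: "M > 0" "\<And>z. z \<in> sector (\<theta>\<^sub>0 / 2) \<Longrightarrow> onorm (T\<^sub>C z) \<le> M * exp (\<omega> * Re z)"
  proof -
    have "\<omega> > \<omega>\<^sub>0" by (simp add: \<omega>_def)
    then show thesis
      using that bd[rule_format, of "\<theta>\<^sub>0 / 2" \<omega>] \<theta> by auto
  qed
  obtain \<rho> where \<rho>: "0 < \<rho>" "\<rho> \<le> 1" "\<And>t. 0 < t \<Longrightarrow> ball (complex_of_real t) (\<rho> * t) \<subseteq> sector (\<theta>\<^sub>0 / 2)"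
    using ball_subset_sector[of "\<theta>\<^sub>0 / 2"] \<theta> by auto
  have op: "open (sector \<theta>\<^sub>0)" using open_sector \<theta> by blast
  have sub: "sector (\<theta>\<^sub>0 / 2) \<subseteq> sector \<theta>\<^sub>0" using \<theta> by (auto simp: sector_def)
  \<comment> \<open>On a disc around t \<le> R of radius \<rho> t \<le> t the real part is at most
    2R.\<close>
  define B where "B = M * exp (\<omega> * (2 * R))"
  define C where "C = 8 * B / \<rho>\<^sup>2"
  have B0: "B > 0" using M by (simp add: B_def)
  have "\<omega> \<ge> 0" by (simp add: \<omega>_def)
  have onB: "onorm (T\<^sub>C z) \<le> B" if "0 < t" "t \<le> R" "z \<in> ball (complex_of_real t) (\<rho> * t)" for t z
  proof -
    have "Re z \<le> t + \<bar>Re (z - of_real t)\<bar>" by simp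
    also have "\<bar>Re (z - of_real t)\<bar> \<le> \<rho> * t"
      using that abs_Re_le_cmod[of "z - of_real t"] by (simp add: dist_norm norm_minus_commute)
    also have "\<rho> * t \<le> 1 * t" using that \<rho> by (intro mult_right_mono) auto
    finally have "Re z \<le> 2 * R" using that by simp
    then have "M * exp (\<omega> * Re z) \<le> B"
      unfolding B_def using M \<open>\<omega> \<ge> 0\<close> by (simp add: mult_left_mono)
    moreover have "z \<in> sector (\<theta>\<^sub>0 / 2)" using \<rho>(3) that by blast
    ultimately show ?thesis using M(2) by fastforce
  qed
  have bl: "bounded_linear (T\<^sub>C z)" if "z \<in> sector \<theta>\<^sub>0" for z
    using an that unfolding operator_analytic_on_def bounded_clinear_def by blast
  have gB: "cmod (cinner (T\<^sub>C z x) y) \<le> B * norm x * norm y"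
    if "0 < t" "t \<le> R" "z \<in> ball (complex_of_real t) (\<rho> * t)" for t z x y
  proof -
    have "norm (T\<^sub>C z x) \<le> onorm (T\<^sub>C z) * norm x"
      using \<rho>(3) sub that by (intro onorm bl) blast
    also have "\<dots> \<le> B * norm x"
      using onB[OF that] by (rule mult_right_mono) simp
    finally have "norm (T\<^sub>C z x) * norm y \<le> B * norm x * norm y"
      by (rule mult_right_mono) simp
    then show ?thesis
      using norm_cinner_le order_trans by blast
  qed
  have real: "Re (cinner (T\<^sub>C (complex_of_real t) x) y) = T t x \<bullet> y" if "t > 0" for t x y
    using eq[OF that] by (simp add: inner_eq_Re_cinner)
  have ball: "ball (complex_of_real t) (\<rho> * t) \<subseteq> sector \<theta>\<^sub>0" if "0 < t" "t \<le> R" for t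
    using \<rho>(3)[OF that(1)] sub by blast
  note hol = operator_analytic_imp_holomorphic[OF op an]
  have diff1: "\<bar>Re (cinner (T\<^sub>C (complex_of_real (s + h)) x) y) - Re (cinner (T\<^sub>C (complex_of_real s) x) y)\<bar>
      \<le> 8 * (B * norm x * norm y) / \<rho>\<^sup>2 * h / s" if "0 < s" "0 \<le> h" "s + h \<le> R" for s h x y
    by (rule holomorphic_real_differences(1)[OF op hol \<rho>(1,2) _ _ that], erule (1) ball, erule (2) gB)
  have diff2: "\<bar>Re (cinner (T\<^sub>C (complex_of_real (s + h + k)) x) y) - Re (cinner (T\<^sub>C (complex_of_real (s + k)) x) y)
      - (Re (cinner (T\<^sub>C (complex_of_real (s + h)) x) y) - Re (cinner (T\<^sub>C (complex_of_real s) x) y))\<bar>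
      \<le> 8 * (B * norm x * norm y) / \<rho>\<^sup>2 * h * k / s\<^sup>2"
    if "0 < s" "0 \<le> h" "0 \<le> k" "s + h + k \<le> R" for s h k x y
    by (rule holomorphic_real_differences(2)[OF op hol \<rho>(1,2) _ _ that], erule (1) ball, erule (2) gB)
  show ?thesis
  proof (rule that[OF T])
    show "M \<ge> 0" "\<omega> \<ge> 0" using M \<open>\<omega> \<ge> 0\<close> by auto
    show "onorm (T t) \<le> M * exp (\<omega> * t)" if t: "t > 0" for t
    proof -
      have "complex_of_real t \<in> sector (\<theta>\<^sub>0 / 2)" using \<rho>(1) \<rho>(3)[OF t] t by auto
      moreover have "T\<^sub>C (complex_of_real t) = T t" using eq[OF t] by auto
      ultimately show ?thesis using M(2)[of "complex_of_real t"] by simp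
    qed
    show "\<bar>T s x \<bullet> y\<bar> \<le> C * norm x * norm y" if s: "0 < s" "s \<le> R" for s x y
    proof -
      have "\<bar>T s x \<bullet> y\<bar> \<le> B * norm x * norm y"
        using gB[OF s, of "of_real s" x y] abs_Re_le_cmod[of "cinner (T\<^sub>C s x) y"] real[OF s(1)] s \<rho> by auto
      also have "\<dots> \<le> C * norm x * norm y"
      proof (intro mult_right_mono)
        have "\<rho>\<^sup>2 \<le> 1" using \<rho> by (simp add: power_le_one)
        then have "B * \<rho>\<^sup>2 \<le> 8 * B" using B0 mult_left_mono[of "\<rho>\<^sup>2" 1 B] by linarith
        then show "B \<le> C" using \<rho> by (simp add: C_def pos_le_divide_eq)
      qed auto
      finally show ?thesis .
    qed
    show "\<bar>T (s + h) x \<bullet> y - T s x \<bullet> y\<bar> \<le> C * norm x * norm y * h / s"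
      if s: "0 < s" "0 \<le> h" "s + h \<le> R" for s h x y
      using diff1[OF s, of x y] real[of s x y] real[of "s + h" x y] s by (simp add: C_def mult.assoc)
    show "\<bar>T (s + h + k) x \<bullet> y - T (s + k) x \<bullet> y - (T (s + h) x \<bullet> y - T s x \<bullet> y)\<bar>
        \<le> C * norm x * norm y * h * k / s\<^sup>2"
      if s: "0 < s" "0 \<le> h" "0 \<le> k" "s + h + k \<le> R" for s h k x y
      using diff2[OF s, of x y] real[of s x y] real[of "s + h" x y] real[of "s + k" x y]
        real[of "s + h + k" x y] s by (simp add: C_def mult.assoc)
  qed
qed

section \<open>The primitive of the resolvent operator\<close>

text \<open>The given integrals are taken over \<open>lebesgue_on\<close>, the convolutions over
  \<open>lborel\<close>. Once the extension by zero is Borel measurable, passing between a measure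
  and its completion changes neither integrability nor value.\<close>

lemma has_bochner_integral_lebesgue_on_lborel:
  fixes f :: "real \<Rightarrow> real"
  assumes A: "A \<in> sets borel" and m: "(\<lambda>t. indicator A t * f t) \<in> borel_measurable borel"
    and f: "has_bochner_integral (lebesgue_on A) f I"
  shows "has_bochner_integral lborel (\<lambda>t. indicator A t * f t) I"
proof -
  have A': "A \<in> sets lebesgue" using A by simp
  have "integrable lebesgue (\<lambda>t. indicator A t *\<^sub>R f t)" "(\<integral>t. indicator A t *\<^sub>R f t \<partial>lebesgue) = I"
    using f A' unfolding has_bochner_integral_iff
    by (simp_all add: integrable_restrict_space integral_restrict_space)
  then show ?thesis
    using m by (simp add: has_bochner_integral_iff integrable_completion integral_completion)
qed

lemma borel_measurable_indicator_cont:
  fixes f :: "real \<Rightarrow> real"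
  assumes "continuous_on A f" "B \<subseteq> A" "B \<in> sets borel"
  shows "(\<lambda>t. indicator B t * f t) \<in> borel_measurable borel"
  using borel_measurable_continuous_on_indicator[OF assms(3) continuous_on_subset[OF assms(1,2)]] by simp

text \<open>Dominated convergence applies to the kernel mean along a convergent sequence of
  arguments, since \<psi> is bounded on compact intervals. At t = 0 the factor t^\<alpha> and the
  fractional integral are both 0.\<close>

lemma continuous_on_frac_int:
  assumes \<alpha>: "\<alpha> > 0" and c: "continuous_on {0..} \<psi>"
  shows "continuous_on {0..} (frac_int \<alpha> \<psi>)"
proof -
  obtain \<psi>' where [measurable]: "\<psi>' \<in> borel_measurable borel" and eq: "\<And>t. t \<ge> 0 \<Longrightarrow> \<psi>' t = \<psi> t"
    using continuous_on_atLeast_measurable_extension[OF c] by blast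
  have km: "kernel_mean \<alpha> \<psi> t = (\<integral>\<sigma>. kernel \<alpha> \<sigma> * \<psi>' (t * \<sigma>) \<partial>lborel)" if "t \<ge> 0" for t
    unfolding kernel_mean_def
    by (intro Bochner_Integration.integral_cong refl) (use that eq in \<open>auto simp: kernel_def indicator_def\<close>)
  have k: "integrable lborel (kernel \<alpha>)"
    using has_bochner_integral_kernel[OF \<alpha>] by (simp add: has_bochner_integral_iff)
  have "continuous_on {0..} (kernel_mean \<alpha> \<psi>)"
    unfolding continuous_on_sequentially comp_def
  proof (intro allI ballI impI, elim conjE)
    fix x :: "nat \<Rightarrow> real" and a :: real
    assume a: "a \<in> {0..}" and x: "\<forall>n. x n \<in> {0..}" and lim: "x \<longlonglongrightarrow> a"
    obtain T where T: "\<And>n. \<bar>x n\<bar> \<le> T"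
      using convergent_imp_Bseq[OF convergentI[OF lim]] by (auto simp: Bseq_def)
    have "bounded (\<psi> ` {0..T})"
      by (intro compact_imp_bounded compact_continuous_image continuous_on_subset[OF c]) auto
    then obtain b where b: "\<And>s. s \<in> {0..T} \<Longrightarrow> \<bar>\<psi> s\<bar> \<le> b"
      unfolding bounded_iff by (auto simp: ball_simps) (metis atLeastAtMost_iff)
    have "(\<lambda>n. \<integral>\<sigma>. kernel \<alpha> \<sigma> * \<psi>' (x n * \<sigma>) \<partial>lborel) \<longlonglongrightarrow> (\<integral>\<sigma>. kernel \<alpha> \<sigma> * \<psi>' (a * \<sigma>) \<partial>lborel)"
    proof (rule integral_dominated_convergence[where w="\<lambda>\<sigma>. kernel \<alpha> \<sigma> * b"])
      show "AE \<sigma> in lborel. (\<lambda>n. kernel \<alpha> \<sigma> * \<psi>' (x n * \<sigma>)) \<longlonglongrightarrow> kernel \<alpha> \<sigma> * \<psi>' (a * \<sigma>)"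
      proof (rule AE_I2)
        fix \<sigma> :: real
        show "(\<lambda>n. kernel \<alpha> \<sigma> * \<psi>' (x n * \<sigma>)) \<longlonglongrightarrow> kernel \<alpha> \<sigma> * \<psi>' (a * \<sigma>)"
        proof (cases "\<sigma> \<in> {0<..<1}")
          case True
          have "(\<lambda>n. \<psi> (x n * \<sigma>)) \<longlonglongrightarrow> \<psi> (a * \<sigma>)"
            by (rule continuous_on_tendsto_compose[OF c tendsto_mult_right[OF lim]]) (use a x True in auto)
          then show ?thesis
            using True a x eq by (auto intro!: tendsto_mult_left)
        qed (auto simp: kernel_def)
      qed
      show "AE \<sigma> in lborel. norm (kernel \<alpha> \<sigma> * \<psi>' (x n * \<sigma>)) \<le> kernel \<alpha> \<sigma> * b" for n
      proof (rule AE_I2)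
        fix \<sigma> :: real
        show "norm (kernel \<alpha> \<sigma> * \<psi>' (x n * \<sigma>)) \<le> kernel \<alpha> \<sigma> * b"
        proof (cases "\<sigma> \<in> {0<..<1}")
          case True
          have xn: "0 \<le> x n" "x n \<le> T" using x T[of n] by auto
          then have "x n * \<sigma> \<le> T" using mult_left_le[of \<sigma> "x n"] True by auto
          then have "\<bar>\<psi>' (x n * \<sigma>)\<bar> \<le> b"
            using b[of "x n * \<sigma>"] True xn eq by auto
          then show ?thesis
            using kernel_nonneg[OF \<alpha>, of \<sigma>] by (simp add: abs_mult mult_left_mono)
        qed (auto simp: kernel_def)
      qed
      have [measurable]: "kernel \<alpha> \<in> borel_measurable borel" using k by auto
      show "(\<lambda>\<sigma>. kernel \<alpha> \<sigma> * \<psi>' (a * \<sigma>)) \<in> borel_measurable lborel"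
        "(\<lambda>\<sigma>. kernel \<alpha> \<sigma> * \<psi>' (x n * \<sigma>)) \<in> borel_measurable lborel" for n
        by measurable
    qed (use k in simp)
    then show "(\<lambda>n. kernel_mean \<alpha> \<psi> (x n)) \<longlonglongrightarrow> kernel_mean \<alpha> \<psi> a"
      using a x by (simp add: km)
  qed
  then have "continuous_on {0..} (\<lambda>t. t powr \<alpha> * kernel_mean \<alpha> \<psi> t)"
    using \<alpha> by (intro continuous_on_mult continuous_on_powr' continuous_on_id continuous_on_const) auto
  then show ?thesis
  proof (rule continuous_on_eq)
    fix t :: real assume "t \<in> {0..}"
    then show "t powr \<alpha> * kernel_mean \<alpha> \<psi> t = frac_int \<alpha> \<psi> t"
      using frac_int_eq_kernel_mean[of t \<alpha> \<psi>] by (cases "t = 0") (auto simp: frac_int_def)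
  qed
qed

lemma continuous_on_primitive:
  fixes \<phi> :: "real \<Rightarrow> real"
  assumes i: "\<And>t. integrable lborel (\<lambda>s. indicator {0<..<t} s * \<phi> s)"
  shows "continuous_on {0..} (\<lambda>t. \<integral>s. indicator {0<..<t} s * \<phi> s \<partial>lborel)"
  unfolding continuous_on_sequentially comp_def
proof (intro allI ballI impI, elim conjE)
  fix x :: "nat \<Rightarrow> real" and a :: real
  assume a: "a \<in> {0..}" and x: "\<forall>n. x n \<in> {0..}" and lim: "x \<longlonglongrightarrow> a"
  obtain T where T: "\<And>n. \<bar>x n\<bar> \<le> T"
    using convergent_imp_Bseq[OF convergentI[OF lim]] by (auto simp: Bseq_def)
  show "(\<lambda>n. \<integral>s. indicator {0<..<x n} s * \<phi> s \<partial>lborel) \<longlonglongrightarrow> (\<integral>s. indicator {0<..<a} s * \<phi> s \<partial>lborel)"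
  proof (rule integral_dominated_convergence[where w="\<lambda>s. \<bar>indicator {0<..<T} s * \<phi> s\<bar>"])
    show "AE s in lborel. (\<lambda>n. indicator {0<..<x n} s * \<phi> s) \<longlonglongrightarrow> indicator {0<..<a} s * \<phi> s"
      using AE_lborel_singleton[of a]
    proof eventually_elim
      case (elim s)
      have "\<forall>\<^sub>F n in sequentially. indicator {0<..<x n} s * \<phi> s = indicator {0<..<a} s * \<phi> s"
      proof (cases "s < a")
        case True
        then show ?thesis
          using order_tendstoD(1)[OF lim True] by (auto elim!: eventually_mono simp: indicator_def)
      next
        case False
        then have "\<forall>\<^sub>F n in sequentially. x n < s"
          using order_tendstoD(2)[OF lim, of s] elim by simp
        then show ?thesis
          by eventually_elim (use False in \<open>auto simp: indicator_def\<close>)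
      qed
      then show ?case
        by (rule tendsto_eventually)
    qed
    show "AE s in lborel. norm (indicator {0<..<x n} s * \<phi> s) \<le> \<bar>indicator {0<..<T} s * \<phi> s\<bar>" for n
      using T[of n] by (intro AE_I2) (auto simp: indicator_def abs_le_iff)
  qed (use i in \<open>auto intro: integrable_abs borel_measurable_integrable\<close>)
qed

lemma laplace_at_exp_bound:
  assumes c: "continuous_on {0..} f" and b: "\<And>t. t > 0 \<Longrightarrow> \<bar>f t\<bar> \<le> C * exp (\<omega> * t)" and \<nu>: "\<nu> > \<omega>"
  shows "laplace_at f \<nu>"
  unfolding laplace_at_def
proof (rule Bochner_Integration.integrable_bound)
  show "integrable lborel (\<lambda>t. C * (indicator {0<..} t * (exp (- ((\<nu> - \<omega>) * t)) * t powr (1 - 1))))"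
    using powr_kernel_laplace(1)[of 1 "\<nu> - \<omega>"] \<nu> by (intro integrable_mult_right) auto
  have "(\<lambda>t. indicator {0<..} t * f t) \<in> borel_measurable borel"
    by (rule borel_measurable_indicator_cont[OF c]) auto
  then have [measurable]: "(\<lambda>t. indicator {0<..} t * f t) \<in> borel_measurable lborel" by simp
  have "(\<lambda>t. exp (- (\<nu> * t)) * (indicator {0<..} t * f t)) \<in> borel_measurable lborel"
    by measurable
  then show "(\<lambda>t. indicator {0<..} t * (exp (- (\<nu> * t)) * f t)) \<in> borel_measurable lborel"
    by (simp add: mult.left_commute)
  show "AE t in lborel. norm (indicator {0<..} t * (exp (- (\<nu> * t)) * f t))
      \<le> norm (C * (indicator {0<..} t * (exp (- ((\<nu> - \<omega>) * t)) * t powr (1 - 1))))"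
  proof (rule AE_I2)
    fix t :: real
    show "norm (indicator {0<..} t * (exp (- (\<nu> * t)) * f t))
      \<le> norm (C * (indicator {0<..} t * (exp (- ((\<nu> - \<omega>) * t)) * t powr (1 - 1))))"
    proof (cases "t > 0")
      case True
      have "exp (- (\<nu> * t)) * \<bar>f t\<bar> \<le> exp (- (\<nu> * t)) * (C * exp (\<omega> * t))"
        using b[OF True] by (rule mult_left_mono) simp
      also have "\<dots> = C * exp (- ((\<nu> - \<omega>) * t))"
        by (simp add: left_diff_distrib exp_diff exp_minus field_simps)
      also have "\<dots> \<le> \<bar>C\<bar> * exp (- ((\<nu> - \<omega>) * t))"
        by (rule mult_right_mono) auto
      finally show ?thesis
        using True by (simp add: abs_mult)
    qed simp
  qed
qed

lemma laplace_add_cmult: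
  assumes "laplace_at f \<nu>" "laplace_at g \<nu>"
  shows "laplace_at (\<lambda>t. c * f t + d * g t) \<nu>" "laplace (\<lambda>t. c * f t + d * g t) \<nu> = c * laplace f \<nu> + d * laplace g \<nu>"
proof -
  have eq: "indicator {0<..} t * (exp (- (\<nu> * t)) * (c * f t + d * g t)) =
     c * (indicator {0<..} t * (exp (- (\<nu> * t)) * f t)) + d * (indicator {0<..} t * (exp (- (\<nu> * t)) * g t))" for t
    by (simp add: algebra_simps)
  show "laplace_at (\<lambda>t. c * f t + d * g t) \<nu>"
    using assms unfolding laplace_at_def eq by simp
  show "laplace (\<lambda>t. c * f t + d * g t) \<nu> = c * laplace f \<nu> + d * laplace g \<nu>"
    using assms unfolding laplace_at_def laplace_def eq by simp
qed

lemma laplace_const: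
  assumes "\<nu> > 0"
  shows "laplace_at (\<lambda>t. c) \<nu>" "laplace (\<lambda>t. c) \<nu> = c / \<nu>"
proof -
  have eq: "indicator {0<..} t * (exp (- (\<nu> * t)) * c) =
    c * (indicator {0<..} t * (exp (- (\<nu> * t)) * t powr (1 - 1)))" for t
    by (auto simp: indicator_def)
  show "laplace_at (\<lambda>t. c) \<nu>" "laplace (\<lambda>t. c) \<nu> = c / \<nu>"
    using powr_kernel_laplace[of 1 \<nu>] assms unfolding laplace_at_def laplace_def eq
    by (simp_all add: powr_minus_divide)
qed

lemma laplace_cong:
  assumes "\<And>t. t > 0 \<Longrightarrow> f t = g t"
  shows "laplace f \<nu> = laplace g \<nu>" "laplace_at f \<nu> \<longleftrightarrow> laplace_at g \<nu>"
proof -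
  have "indicator {0<..} t * (exp (- (\<nu> * t)) * f t) = indicator {0<..} t * (exp (- (\<nu> * t)) * g t)" for t
    using assms by (auto simp: indicator_def)
  then show "laplace f \<nu> = laplace g \<nu>" "laplace_at f \<nu> \<longleftrightarrow> laplace_at g \<nu>"
    unfolding laplace_def laplace_at_def by presburger+
qed

context
  fixes \<alpha> M \<omega> :: real and D :: "'e::complex_hilbert set" and A :: "'e \<Rightarrow> 'e" and T S :: "real \<Rightarrow> 'e \<Rightarrow> 'e"
  assumes \<alpha>: "0 < \<alpha>" "\<alpha> < 1" and T: "solution_operator \<alpha> D A T" and S: "resolvent_operator \<alpha> D A S"
    and M: "M \<ge> 0" and \<omega>: "\<omega> \<ge> 0" and bT: "\<And>t. t > 0 \<Longrightarrow> onorm (T t) \<le> M * exp (\<omega> * t)"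
begin

lemma continuous_on_solution_operator: "continuous_on {0..} (\<lambda>t. T t x \<bullet> y)"
  using T unfolding solution_operator_def by (auto intro!: continuous_intros)

lemma continuous_on_resolvent_operator: "continuous_on {0<..} (\<lambda>t. S t x \<bullet> y)"
  using S unfolding resolvent_operator_def by (auto intro!: continuous_intros)

lemma bounded_linear_solution_operator: "t \<ge> 0 \<Longrightarrow> bounded_linear (T t)"
  using T unfolding solution_operator_def bounded_clinear_def by blast

lemma solution_operator_inner_bound: "t > 0 \<Longrightarrow> \<bar>T t x \<bullet> y\<bar> \<le> M * norm x * norm y * exp (\<omega> * t)"
proof -
  assume t: "t > 0"
  have "\<bar>T t x \<bullet> y\<bar> \<le> norm (T t x) * norm y"
    by (rule Cauchy_Schwarz_ineq2)
  also have "\<dots> \<le> (onorm (T t) * norm x) * norm y"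
    using t by (intro mult_right_mono onorm bounded_linear_solution_operator) auto
  also have "\<dots> \<le> (M * exp (\<omega> * t) * norm x) * norm y"
    using bT[OF t] by (intro mult_right_mono) auto
  finally show ?thesis by (simp add: ac_simps)
qed

lemma laplace_at_solution_operator: "\<nu> > \<omega> \<Longrightarrow> laplace_at (\<lambda>t. T t x \<bullet> y) \<nu>"
  by (rule laplace_at_exp_bound[OF continuous_on_solution_operator solution_operator_inner_bound])

text \<open>Because A commutes with T(s) on D, the integrand of the Volterra equation contains T(s)
  applied to the fixed vector A x. The unbounded operator thus no longer acts on the varying
  argument, and the scalar factor is continuous.\<close>

lemma solution_operator_volterra:
  assumes x: "x \<in> D" and t: "t > 0"
  shows "T t x \<bullet> y = x \<bullet> y + frac_int \<alpha> (\<lambda>s. T s (A x) \<bullet> y) t"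
proof -
  obtain I where I: "has_bochner (lebesgue_on {0..t}) (\<lambda>s. (t - s) powr (\<alpha> - 1) *\<^sub>R A (T s x)) I"
    and Tt: "T t x = x + (1 / Gamma \<alpha>) *\<^sub>R I"
    using T x t unfolding solution_operator_def by (meson less_imp_le)
  have comm: "A (T s x) = T s (A x)" if "s \<ge> 0" for s
    using T x that unfolding solution_operator_def by blast
  let ?f = "\<lambda>s. (t - s) powr (\<alpha> - 1) * (T s (A x) \<bullet> y)"
  have i: "has_bochner_integral (lebesgue_on {0..t}) ?f (I \<bullet> y)"
    using has_bochner_inner[OF I, of y]
    by (rule has_bochner_integral_cong[THEN iffD1, rotated -1]) (auto simp: comm)
  have m: "(\<lambda>s. indicator {0..t} s * ?f s) \<in> borel_measurable borel"
  proof -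
    have [measurable]: "(\<lambda>s. indicator {0..t} s * (T s (A x) \<bullet> y)) \<in> borel_measurable borel"
      by (rule borel_measurable_indicator_cont[OF continuous_on_solution_operator]) auto
    have "(\<lambda>s. (t - s) powr (\<alpha> - 1) * (indicator {0..t} s * (T s (A x) \<bullet> y))) \<in> borel_measurable borel"
      by measurable
    then show ?thesis by (simp add: mult.left_commute)
  qed
  have "has_bochner_integral lborel (\<lambda>s. indicator {0..t} s * ?f s) (I \<bullet> y)"
    by (rule has_bochner_integral_lebesgue_on_lborel[OF _ m i]) simp
  then have "I \<bullet> y = (\<integral>s. indicator {0..t} s * ?f s \<partial>lborel)"
    by (simp add: has_bochner_integral_iff)
  also have "\<dots> = (\<integral>s. indicator {0<..<t} s * ?f s \<partial>lborel)"
  proof (rule integral_cong_AE)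
    show "AE s in lborel. indicator {0..t} s * ?f s = indicator {0<..<t} s * ?f s"
      using AE_lborel_singleton[of 0] AE_lborel_singleton[of t]
      by eventually_elim (auto simp: indicator_def)
    have "(\<lambda>s. indicator {0<..<t} s * (indicator {0..t} s * ?f s)) \<in> borel_measurable borel"
      using m by measurable
    moreover have "(\<lambda>s. indicator {0<..<t} s * (indicator {0..t} s * ?f s)) = (\<lambda>s. indicator {0<..<t} s * ?f s)"
      by (auto simp: indicator_def)
    ultimately show "(\<lambda>s. indicator {0<..<t} s * ?f s) \<in> borel_measurable lborel" by simp
  qed (use m in simp)
  finally show ?thesis
    unfolding Tt by (simp add: inner_add_left frac_int_def)
qed

text \<open>Both sides have the Laplace transform \<open>\<nu>\<^sup>-\<^sup>1 (\<nu>\<^sup>\<alpha> I - A)\<^sup>-\<^sup>1 x \<bullet> y\<close>.\<close>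

lemma resolvent_operator_primitive:
  shows "integrable lborel (\<lambda>s. indicator {0<..<t} s * (S s x \<bullet> y))"
    and "t > 0 \<Longrightarrow> (\<integral>s. indicator {0<..<t} s * (S s x \<bullet> y) \<partial>lborel) = frac_int \<alpha> (\<lambda>s. T s x \<bullet> y) t"
proof -
  obtain \<omega>' where \<omega>': "\<omega>' \<ge> 0" and res: "\<And>\<nu>. Re \<nu> > \<omega>' \<Longrightarrow> \<nu> powr complex_of_real \<alpha> \<in> resolvent_set D A"
    and lap: "\<And>\<nu> x. Re \<nu> > \<omega>' \<Longrightarrow> has_bochner (lebesgue_on {0<..}) (\<lambda>t. exp (- (\<nu> * complex_of_real t)) *\<^sub>C S t x)
               (resolvent D A (\<nu> powr complex_of_real \<alpha>) x)"
    using S unfolding resolvent_operator_def by blast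
  \<comment> \<open>Real \<nu> are enough for the uniqueness theorem, and for them \<nu>^\<alpha>
    and exp (- \<nu> t) are real, so pairing with y stays within real transforms.\<close>
  define R where "R \<nu> = resolvent D A (complex_of_real (\<nu> powr \<alpha>))" for \<nu>
  have R: "R \<nu> z \<in> D" "\<nu> powr \<alpha> *\<^sub>R R \<nu> z - A (R \<nu> z) = z" if "\<nu> > \<omega>'" for \<nu> z
  proof -
    have "complex_of_real \<nu> powr complex_of_real \<alpha> \<in> resolvent_set D A"
      using that by (intro res) simp
    then have b: "bij_betw (\<lambda>x. complex_of_real (\<nu> powr \<alpha>) *\<^sub>C x - A x) D UNIV"
      using that \<omega>' by (simp add: powr_of_real resolvent_set_def)
    then have z: "z \<in> (\<lambda>x. complex_of_real (\<nu> powr \<alpha>) *\<^sub>C x - A x) ` D"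
      by (simp add: bij_betw_def)
    show "R \<nu> z \<in> D"
      unfolding R_def resolvent_def using inv_into_into[OF z] .
    show "\<nu> powr \<alpha> *\<^sub>R R \<nu> z - A (R \<nu> z) = z"
      unfolding R_def resolvent_def using f_inv_into_f[OF z] by (simp add: scaleR_scaleC)
  qed
  have lapS: "laplace_at (\<lambda>t. S t x \<bullet> y) \<nu>" "laplace (\<lambda>t. S t x \<bullet> y) \<nu> = R \<nu> x \<bullet> y" if \<nu>: "\<nu> > \<omega>'" for \<nu>
  proof -
    have "has_bochner_integral (lebesgue_on {0<..})
       (\<lambda>t. (exp (- (complex_of_real \<nu> * complex_of_real t)) *\<^sub>C S t x) \<bullet> y) (R \<nu> x \<bullet> y)"
      using has_bochner_inner[OF lap[of "complex_of_real \<nu>" x]] \<nu> \<omega>' by (simp add: powr_of_real R_def)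
    moreover have "(exp (- (complex_of_real \<nu> * complex_of_real t)) *\<^sub>C S t x) \<bullet> y = exp (- (\<nu> * t)) * (S t x \<bullet> y)" for t
    proof -
      have "exp (- (complex_of_real \<nu> * complex_of_real t)) = complex_of_real (exp (- (\<nu> * t)))"
        by (simp add: exp_of_real flip: of_real_mult of_real_minus)
      then show ?thesis by (simp flip: scaleR_scaleC)
    qed
    ultimately have i: "has_bochner_integral (lebesgue_on {0<..}) (\<lambda>t. exp (- (\<nu> * t)) * (S t x \<bullet> y)) (R \<nu> x \<bullet> y)"
      by simp
    have "has_bochner_integral lborel (\<lambda>t. indicator {0<..} t * (exp (- (\<nu> * t)) * (S t x \<bullet> y))) (R \<nu> x \<bullet> y)"
    proof (rule has_bochner_integral_lebesgue_on_lborel[OF _ _ i])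
      show "(\<lambda>t. indicator {0<..} t * (exp (- (\<nu> * t)) * (S t x \<bullet> y))) \<in> borel_measurable borel"
        by (rule borel_measurable_indicator_cont[of "{0<..}"]) (auto intro!: continuous_intros continuous_on_resolvent_operator)
    qed simp
    then show "laplace_at (\<lambda>t. S t x \<bullet> y) \<nu>" "laplace (\<lambda>t. S t x \<bullet> y) \<nu> = R \<nu> x \<bullet> y"
      by (simp_all add: laplace_at_def laplace_def has_bochner_integral_iff)
  qed
  \<comment> \<open>For u = R \<nu> x one has T x = \<nu>^\<alpha> T u - T A u, and the transformed
    Volterra equation for u says that \<nu>^\<alpha> times the transform of T u is \<nu>^(\<alpha> -
    1) u plus the transform of T A u. The terms with A u cancel.\<close>
  have lapT: "laplace (\<lambda>t. T t x \<bullet> y) \<nu> = \<nu> powr (\<alpha> - 1) * (R \<nu> x \<bullet> y)" if \<nu>: "\<nu> > \<omega>'" "\<nu> > \<omega>" for \<nu>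
  proof -
    have \<nu>0: "\<nu> > 0" using \<nu> \<omega> by simp
    define u where "u = R \<nu> x"
    have u: "u \<in> D" "\<nu> powr \<alpha> *\<^sub>R u - A u = x"
      using R[OF \<nu>(1)] by (auto simp: u_def)
    note lAu = laplace_at_solution_operator[OF \<nu>(2), of "A u" y]
    have "laplace (\<lambda>t. T t u \<bullet> y) \<nu> = laplace (\<lambda>t. 1 * (u \<bullet> y) + 1 * frac_int \<alpha> (\<lambda>s. T s (A u) \<bullet> y) t) \<nu>"
      by (rule laplace_cong) (simp add: solution_operator_volterra[OF u(1)])
    also have "\<dots> = (u \<bullet> y) / \<nu> + \<nu> powr (- \<alpha>) * laplace (\<lambda>t. T t (A u) \<bullet> y) \<nu>"
      unfolding laplace_add_cmult(2)[OF laplace_const(1)[OF \<nu>0] laplace_frac_int(1)[OF \<alpha>(1) \<nu>0 lAu]]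
        laplace_const(2)[OF \<nu>0] laplace_frac_int(2)[OF \<alpha>(1) \<nu>0 lAu] by simp
    finally have e: "laplace (\<lambda>t. T t u \<bullet> y) \<nu> = (u \<bullet> y) / \<nu> + \<nu> powr (- \<alpha>) * laplace (\<lambda>t. T t (A u) \<bullet> y) \<nu>" .
    have "laplace (\<lambda>t. T t x \<bullet> y) \<nu> = laplace (\<lambda>t. \<nu> powr \<alpha> * (T t u \<bullet> y) + (- 1) * (T t (A u) \<bullet> y)) \<nu>"
    proof (rule laplace_cong)
      fix t :: real assume "t > 0"
      then interpret bounded_linear "T t" by (intro bounded_linear_solution_operator) simp
      show "T t x \<bullet> y = \<nu> powr \<alpha> * (T t u \<bullet> y) + (- 1) * (T t (A u) \<bullet> y)"
        unfolding u(2)[symmetric] diff scaleR inner_diff_left by simp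
    qed
    also have "\<dots> = \<nu> powr \<alpha> * laplace (\<lambda>t. T t u \<bullet> y) \<nu> - laplace (\<lambda>t. T t (A u) \<bullet> y) \<nu>"
      unfolding laplace_add_cmult(2)[OF laplace_at_solution_operator[OF \<nu>(2), of u y] lAu] by simp
    also have "\<dots> = \<nu> powr \<alpha> * (u \<bullet> y) / \<nu>"
      using \<nu>0 unfolding e by (simp add: distrib_left mult.assoc[symmetric] powr_add[symmetric])
    finally show ?thesis
      using \<nu>0 by (simp add: u_def powr_diff)
  qed
  define \<nu>1 where "\<nu>1 = max \<omega> \<omega>' + 1"
  have \<nu>1: "\<nu>1 > \<omega>" "\<nu>1 > \<omega>'" "\<nu>1 > 0"
    using \<omega> by (auto simp: \<nu>1_def)
  define C1 where "C1 = (\<integral>t. \<bar>indicator {0<..} t * (exp (- (\<nu>1 * t)) * (S t x \<bullet> y))\<bar> \<partial>lborel)"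
  have i1: "integrable lborel (\<lambda>t. indicator {0<..} t * (exp (- (\<nu>1 * t)) * (S t x \<bullet> y)))"
    using lapS(1)[OF \<nu>1(2)] by (simp add: laplace_at_def)
  \<comment> \<open>No bound on S near 0 is available yet. Integrability there is read off from
    absolute convergence of the transform at \<nu>1, since exp (\<nu>1 (t - s)) \<ge> 1 for s <
    t.\<close>
  have le1: "\<bar>indicator {0<..<t} s * (S s x \<bullet> y)\<bar> \<le>
      exp (\<nu>1 * t) * \<bar>indicator {0<..} s * (exp (- (\<nu>1 * s)) * (S s x \<bullet> y))\<bar>" for s t
  proof (cases "s \<in> {0<..<t}")
    case True
    then have "\<nu>1 * s \<le> \<nu>1 * t" using \<nu>1 by (intro mult_left_mono) auto
    then have "1 \<le> exp (\<nu>1 * t) * exp (- (\<nu>1 * s))" by (simp add: mult_exp_exp)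
    then have "1 * \<bar>S s x \<bullet> y\<bar> \<le> (exp (\<nu>1 * t) * exp (- (\<nu>1 * s))) * \<bar>S s x \<bullet> y\<bar>"
      by (rule mult_right_mono) simp
    then show ?thesis using True by (simp add: abs_mult)
  qed simp
  have iS: "integrable lborel (\<lambda>s. indicator {0<..<t} s * (S s x \<bullet> y))" for t
  proof (rule Bochner_Integration.integrable_bound[OF integrable_mult_right[OF integrable_abs[OF i1], of "exp (\<nu>1 * t)"]])
    show "(\<lambda>s. indicator {0<..<t} s * (S s x \<bullet> y)) \<in> borel_measurable lborel"
      using borel_measurable_indicator_cont[OF continuous_on_resolvent_operator, of "{0<..<t}"] by (simp add: subset_eq)
  qed (use le1 in simp)
  then show "integrable lborel (\<lambda>s. indicator {0<..<t} s * (S s x \<bullet> y))" .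
  assume t0: "t > 0"
  define H where "H t = (\<integral>s. indicator {0<..<t} s * (S s x \<bullet> y) \<partial>lborel)" for t
  \<comment> \<open>The primitive is the fractional integral of order 1, so one transform rule
    serves both sides.\<close>
  have H: "H t = frac_int 1 (\<lambda>s. S s x \<bullet> y) t" for t
    unfolding H_def frac_int_def
    by (simp, intro Bochner_Integration.integral_cong refl) (auto simp: indicator_def)
  define P where "P t = 1 * H t + (- 1) * frac_int \<alpha> (\<lambda>s. T s x \<bullet> y) t" for t
  define C where "C = C1 + M * norm x * norm y / (\<alpha> * Gamma \<alpha>)"
  have "P t = 0"
  proof (rule laplace_zero_imp_zero[where P=P and t=t and C=C and \<omega>=\<nu>1 and \<omega>'=\<nu>1])
    show "continuous_on {0..} P"
      unfolding P_def H_def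
      by (intro continuous_intros continuous_on_primitive iS continuous_on_frac_int \<alpha> continuous_on_solution_operator)
    show "\<bar>P t\<bar> \<le> C * exp (\<nu>1 * t)" if t: "t \<ge> 0" for t
    proof -
      have "\<bar>H t\<bar> \<le> (\<integral>s. exp (\<nu>1 * t) * \<bar>indicator {0<..} s * (exp (- (\<nu>1 * s)) * (S s x \<bullet> y))\<bar> \<partial>lborel)"
        unfolding H_def
        by (rule order_trans[OF integral_abs_bound integral_mono]) (use iS i1 le1 in auto)
      then have h: "\<bar>H t\<bar> \<le> C1 * exp (\<nu>1 * t)"
        by (simp add: C1_def mult.commute)
      define C2 where "C2 = M * norm x * norm y / (\<alpha> * Gamma \<alpha>)"
      have f: "\<bar>frac_int \<alpha> (\<lambda>s. T s x \<bullet> y) t\<bar> \<le> C2 * exp (\<nu>1 * t)"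
      proof (cases "t = 0")
        case True
        then show ?thesis using M \<alpha> Gamma_real_pos[OF \<alpha>(1)] by (simp add: frac_int_def C2_def)
      next
        case False
        then have tp: "t > 0" using t by simp
        obtain \<psi>' where [measurable]: "\<psi>' \<in> borel_measurable borel" and eq: "\<And>t. t \<ge> 0 \<Longrightarrow> \<psi>' t = T t x \<bullet> y"
          using continuous_on_atLeast_measurable_extension[OF continuous_on_solution_operator] by blast
        have "kernel_mean \<alpha> (\<lambda>s. T s x \<bullet> y) t = (\<integral>\<sigma>. kernel \<alpha> \<sigma> * \<psi>' (t * \<sigma>) \<partial>lborel)"
          unfolding kernel_mean_def
          by (intro Bochner_Integration.integral_cong refl) (use tp eq in \<open>auto simp: kernel_def indicator_def\<close>)
        also have "\<bar>\<dots>\<bar> \<le> M * norm x * norm y * exp (\<omega> * t) / (\<alpha> * Gamma \<alpha>)"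
        proof (rule kernel_integrable(2)[OF \<alpha>(1)])
          fix \<sigma> :: real assume s: "0 < \<sigma>" "\<sigma> < 1"
          have "\<bar>\<psi>' (t * \<sigma>)\<bar> \<le> M * norm x * norm y * exp (\<omega> * (t * \<sigma>))"
            using solution_operator_inner_bound[of "t * \<sigma>" x y] eq[of "t * \<sigma>"] s tp by simp
          also have "\<dots> \<le> M * norm x * norm y * exp (\<omega> * t)"
            using mult_left_le[of \<sigma> t] s tp \<omega> M by (intro mult_left_mono iffD2[OF exp_le_cancel_iff]) auto
          finally show "\<bar>\<psi>' (t * \<sigma>)\<bar> \<le> M * norm x * norm y * exp (\<omega> * t)" .
        qed measurable
        finally have km: "\<bar>kernel_mean \<alpha> (\<lambda>s. T s x \<bullet> y) t\<bar> \<le> C2 * exp (\<omega> * t)"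
          by (simp add: C2_def)
        have "C2 \<ge> 0" using M \<alpha> Gamma_real_pos[OF \<alpha>(1)] by (simp add: C2_def)
        \<comment> \<open>This crude bound, followed by 1 + t \<le> exp t, absorbs the power into
          the margin 1 by which \<nu>1 exceeds \<omega>.\<close>
        have "t powr \<alpha> \<le> 1 + t"
        proof (cases "t \<ge> 1")
          case True
          then have "t powr \<alpha> \<le> t powr 1" using \<alpha> by (intro powr_mono) auto
          then show ?thesis using tp by simp
        next
          case False
          then have "t powr \<alpha> \<le> 1" using \<alpha> tp by (intro powr_le1) auto
          then show ?thesis using tp by simp
        qed
        also have "\<dots> \<le> exp t" by simp
        finally have "\<bar>frac_int \<alpha> (\<lambda>s. T s x \<bullet> y) t\<bar> \<le> exp t * (C2 * exp (\<omega> * t))"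
          unfolding frac_int_eq_kernel_mean[OF tp] abs_mult using km by (intro mult_mono) auto
        also have "\<dots> = C2 * exp ((\<omega> + 1) * t)"
          by (simp add: distrib_right exp_add)
        also have "\<dots> \<le> C2 * exp (\<nu>1 * t)"
          using \<open>C2 \<ge> 0\<close> tp by (intro mult_left_mono iffD2[OF exp_le_cancel_iff] mult_right_mono) (auto simp: \<nu>1_def)
        finally show ?thesis .
      qed
      have "\<bar>P t\<bar> \<le> \<bar>H t\<bar> + \<bar>frac_int \<alpha> (\<lambda>s. T s x \<bullet> y) t\<bar>"
        by (simp add: P_def)
      also have "\<dots> \<le> C * exp (\<nu>1 * t)"
        using h f by (simp add: C_def C2_def distrib_right)
      finally show ?thesis .
    qed
    show "laplace P \<nu> = 0" if \<nu>: "\<nu> > \<nu>1" for \<nu>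
    proof -
      have \<nu>': "\<nu> > \<omega>" "\<nu> > \<omega>'" "\<nu> > 0" using \<nu> \<nu>1 by auto
      note f1 = laplace_frac_int[OF zero_less_one \<nu>'(3) lapS(1)[OF \<nu>'(2)], folded H]
      note f2 = laplace_frac_int[OF \<alpha>(1) \<nu>'(3) laplace_at_solution_operator[OF \<nu>'(1), of x y]]
      have "laplace P \<nu> = 1 * laplace H \<nu> + (- 1) * laplace (frac_int \<alpha> (\<lambda>s. T s x \<bullet> y)) \<nu>"
        unfolding P_def[abs_def] using f1(1) f2(1) H[abs_def] by (intro laplace_add_cmult) (simp_all add: H[abs_def])
      also have "\<dots> = \<nu> powr (- 1) * (R \<nu> x \<bullet> y) - \<nu> powr (- \<alpha>) * (\<nu> powr (\<alpha> - 1) * (R \<nu> x \<bullet> y))"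
        using f1(2) f2(2) lapS(2)[OF \<nu>'(2)] lapT[OF \<nu>'(2,1)] by (simp add: H[abs_def])
      also have "\<dots> = 0"
        using \<nu>'(3) by (simp add: mult.assoc[symmetric] powr_add[symmetric])
      finally show ?thesis .
    qed
  qed (rule t0)
  then show "(\<integral>s. indicator {0<..<t} s * (S s x \<bullet> y) \<partial>lborel) = frac_int \<alpha> (\<lambda>s. T s x \<bullet> y) t"
    by (simp add: P_def H_def)
qed

end

lemma norm_le_inner_bound:
  fixes x :: "'a::real_inner"
  assumes "c \<ge> 0" and "\<And>y. \<bar>x \<bullet> y\<bar> \<le> c * norm y"
  shows "norm x \<le> c"
proof (cases "x = 0")
  case False
  have "norm x * norm x \<le> c * norm x"
    using assms(2)[of x] by (simp add: power2_norm_eq_inner[symmetric] power2_eq_square)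
  then show ?thesis
    using False by simp
qed (use assms in simp)

text \<open>The last estimate says that \<open>t\<^sup>-\<^sup>\<alpha> \<integral>\<^sub>0\<^sup>t S(s)x ds\<close> tends to \<open>x / \<Gamma>(\<alpha> + 1)\<close>, without requiring the vector-valued
  integral to exist.\<close>

lemma resolvent_operator_estimates:
  fixes A :: "'e::complex_hilbert \<Rightarrow> 'e"
  assumes \<alpha>: "0 < \<alpha>" "\<alpha> < 1" and a: "a > 0" and \<theta>: "0 < \<theta>\<^sub>0" "\<theta>\<^sub>0 \<le> pi / 2"
    and A: "analytic_class \<alpha> \<omega>\<^sub>0 \<theta>\<^sub>0 D A" and S: "resolvent_operator \<alpha> D A S"
  obtains C where "C \<ge> 0"
    "\<And>t x. 0 < t \<Longrightarrow> t \<le> a \<Longrightarrow> norm (S t x) \<le> C * t powr (\<alpha> - 1) * norm x"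
    "continuous_on {0<..a} (\<lambda>t. Blinfun (S t))"
    "\<And>x e. e > 0 \<Longrightarrow> \<exists>d>0. d \<le> a \<and> (\<forall>t y. 0 < t \<longrightarrow> t \<le> d \<longrightarrow>
       \<bar>(\<integral>s. indicator {0<..<t} s * (S s x \<bullet> y) \<partial>lborel) - t powr \<alpha> * (x \<bullet> y) / (\<alpha> * Gamma \<alpha>)\<bar>
         \<le> t powr \<alpha> * e * norm y)"
proof -
  obtain T M \<omega> C where T: "solution_operator \<alpha> D A T" and M: "M \<ge> 0" and \<omega>: "\<omega> \<ge> 0"
    and bT: "\<And>t. t > 0 \<Longrightarrow> onorm (T t) \<le> M * exp (\<omega> * t)"
    and b0: "\<And>s x y. 0 < s \<Longrightarrow> s \<le> 2 * a \<Longrightarrow> \<bar>T s x \<bullet> y\<bar> \<le> C * norm x * norm y"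
    and b1: "\<And>s h x y. 0 < s \<Longrightarrow> 0 \<le> h \<Longrightarrow> s + h \<le> 2 * a \<Longrightarrow>
       \<bar>T (s + h) x \<bullet> y - T s x \<bullet> y\<bar> \<le> C * norm x * norm y * h / s"
    and b2: "\<And>s h k x y. 0 < s \<Longrightarrow> 0 \<le> h \<Longrightarrow> 0 \<le> k \<Longrightarrow> s + h + k \<le> 2 * a \<Longrightarrow>
      \<bar>T (s + h + k) x \<bullet> y - T (s + k) x \<bullet> y - (T (s + h) x \<bullet> y - T s x \<bullet> y)\<bar>
        \<le> C * norm x * norm y * h * k / s\<^sup>2"
  proof -
    have "2 * a > 0" using a by simp
    then show thesis
      by (rule analytic_class_bounds[OF \<theta> A]) (rule that)
  qed
  note TS = \<alpha> T S M \<omega> bT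
  note prim = resolvent_operator_primitive[OF TS]
  note pb = frac_int_inverse_bounds[OF \<alpha>(1) a continuous_on_solution_operator[OF TS] b0 b1 b2 continuous_on_resolvent_operator[OF TS] prim]
  have bl: "bounded_linear (S t)" if "t > 0" for t
    using S that unfolding resolvent_operator_def bounded_clinear_def by blast
  define c where "c = 1 / (\<alpha> * Gamma \<alpha>)"
  have c: "c > 0" using \<alpha> Gamma_real_pos[OF \<alpha>(1)] by (simp add: c_def)
  \<comment> \<open>The sign of C is not recorded, hence the absolute value; c is the mass of the
    kernel.\<close>
  define C' where "C' = \<bar>C\<bar> * c"
  have C': "C' \<ge> 0" using c by (simp add: C'_def)
  have Cle: "C * norm x * norm y / (\<alpha> * Gamma \<alpha>) \<le> C' * norm x * norm y" for x y :: 'e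
    using c unfolding C'_def c_def by (auto intro!: mult_right_mono divide_right_mono)
  show ?thesis
  proof (rule that)
    show "C' * (1 + \<alpha>) \<ge> 0" using C' \<alpha> by simp
    show "norm (S t x) \<le> C' * (1 + \<alpha>) * t powr (\<alpha> - 1) * norm x" if t: "0 < t" "t \<le> a" for t x
    proof (rule norm_le_inner_bound)
      fix y
      have "\<bar>S t x \<bullet> y\<bar> \<le> (C * norm x * norm y / (\<alpha> * Gamma \<alpha>)) * ((1 + \<alpha>) * t powr (\<alpha> - 1))"
        using pb(1)[of t x y] t a by (simp add: mult.assoc)
      also have "\<dots> \<le> (C' * norm x * norm y) * ((1 + \<alpha>) * t powr (\<alpha> - 1))"
        using Cle \<alpha> by (intro mult_right_mono) auto
      finally show "\<bar>S t x \<bullet> y\<bar> \<le> C' * (1 + \<alpha>) * t powr (\<alpha> - 1) * norm x * norm y"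
        by (simp add: mult_ac)
    qed (use C' \<alpha> in simp)
    have pm: "powr_modulus \<alpha> t t' \<ge> 0" if "t > 0" "t' > 0" for t t'
      using that \<alpha> by (auto simp: powr_modulus_def)
    have diff: "norm (S t' x - S t x) \<le> C' * (powr_modulus \<alpha> t t' + powr_modulus \<alpha> t' t) * norm x"
      if t: "t \<in> {0<..a}" "t' \<in> {0<..a}" for t t' x
    proof (rule norm_le_inner_bound)
      fix y
      have *: "\<bar>S r' x \<bullet> y - S r x \<bullet> y\<bar> \<le> C' * (powr_modulus \<alpha> r r' + powr_modulus \<alpha> r' r) * norm x * norm y"
        if r: "r \<in> {0<..a}" "r' \<in> {0<..a}" "r \<le> r'" for r r'
      proof -
        have "\<bar>S r' x \<bullet> y - S r x \<bullet> y\<bar> \<le> C * norm x * norm y / (\<alpha> * Gamma \<alpha>) * powr_modulus \<alpha> r r'"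
          using pb(2)[of r r' x y] r a by simp
        also have "\<dots> \<le> (C' * norm x * norm y) * (powr_modulus \<alpha> r r' + powr_modulus \<alpha> r' r)"
          using Cle pm[of r r'] pm[of r' r] r C' by (intro mult_mono) auto
        finally show ?thesis by (simp add: mult_ac)
      qed
      show "\<bar>(S t' x - S t x) \<bullet> y\<bar> \<le> C' * (powr_modulus \<alpha> t t' + powr_modulus \<alpha> t' t) * norm x * norm y"
        using *[of t t'] *[of t' t] t by (cases "t \<le> t'") (auto simp: inner_diff_left abs_minus_commute add.commute)
    qed (use C' pm[of t t'] pm[of t' t] t in simp)
    show "continuous_on {0<..a} (\<lambda>t. Blinfun (S t))"
      unfolding continuous_on_def
    proof
      fix t assume t: "t \<in> {0<..a}"
      have "((\<lambda>t'. Blinfun (S t') - Blinfun (S t)) \<longlongrightarrow> 0) (at t within {0<..a})"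
      proof (rule Lim_null_comparison)
        show "\<forall>\<^sub>F t' in at t within {0<..a}. norm (Blinfun (S t') - Blinfun (S t)) \<le>
            C' * (powr_modulus \<alpha> t t' + powr_modulus \<alpha> t' t)"
          unfolding eventually_at_filter
        proof (rule always_eventually, intro allI impI)
          fix t' assume t': "t' \<in> {0<..a}"
          show "norm (Blinfun (S t') - Blinfun (S t)) \<le> C' * (powr_modulus \<alpha> t t' + powr_modulus \<alpha> t' t)"
            using diff[OF t t'] t t' pm[of t t'] pm[of t' t] C'
            by (intro norm_blinfun_bound)
              (auto simp: blinfun.diff_left bounded_linear_Blinfun_apply[OF bl])
        qed
        have "((\<lambda>t'. C' * (powr_modulus \<alpha> t t' + powr_modulus \<alpha> t' t)) \<longlongrightarrow> C' * (0 + 0)) (at t)"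
          using t by (intro tendsto_intros powr_modulus_tendsto) auto
        then show "((\<lambda>t'. C' * (powr_modulus \<alpha> t t' + powr_modulus \<alpha> t' t)) \<longlongrightarrow> 0) (at t within {0<..a})"
          unfolding add_0_right mult_zero_right by (rule tendsto_within_subset) simp
      qed
      then show "((\<lambda>t'. Blinfun (S t')) \<longlongrightarrow> Blinfun (S t)) (at t within {0<..a})"
        by (rule LIM_zero_cancel)
    qed
    show "\<exists>d>0. d \<le> a \<and> (\<forall>t y. 0 < t \<longrightarrow> t \<le> d \<longrightarrow>
       \<bar>(\<integral>s. indicator {0<..<t} s * (S s x \<bullet> y) \<partial>lborel) - t powr \<alpha> * (x \<bullet> y) / (\<alpha> * Gamma \<alpha>)\<bar>
         \<le> t powr \<alpha> * e * norm y)" if e: "e > 0" for x e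
    proof -
      have T0: "T 0 x = x" and cT: "continuous_on {0..} (\<lambda>t. T t x)"
        using T unfolding solution_operator_def by auto
      \<comment> \<open>Averaging multiplies the tolerance by the mass c of the kernel; dividing by
        c in advance restores e.\<close>
      have "e / c > 0" using e c by simp
      then obtain d where d: "d > 0" "\<And>s. 0 \<le> s \<Longrightarrow> s < d \<Longrightarrow> norm (T s x - x) < e / c"
        using cT[unfolded continuous_on_iff, rule_format, of 0 "e / c"] T0 by (auto simp: dist_norm)
      show ?thesis
      proof (intro exI[of _ "min d a"] conjI allI impI)
        show "min d a > 0" "min d a \<le> a" using d a by auto
        fix t y assume t: "0 < t" "t \<le> min d a"
        have "\<bar>kernel_mean \<alpha> (\<lambda>s. T s x \<bullet> y) t - (T 0 x \<bullet> y) / (\<alpha> * Gamma \<alpha>)\<bar> \<le> (e / c * norm y) / (\<alpha> * Gamma \<alpha>)"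
        proof (rule kernel_mean_at_0[OF \<alpha>(1) a continuous_on_solution_operator[OF TS] b0 b1 b2])
          fix s assume s: "0 < s" "s < t"
          have "\<bar>T s x \<bullet> y - T 0 x \<bullet> y\<bar> \<le> norm (T s x - x) * norm y"
            using Cauchy_Schwarz_ineq2[of "T s x - x" y] by (simp add: T0 inner_diff_left)
          also have "\<dots> \<le> e / c * norm y"
            using d(2)[of s] s t by (intro mult_right_mono) auto
          finally show "\<bar>T s x \<bullet> y - T 0 x \<bullet> y\<bar> \<le> e / c * norm y" .
        qed (use t a in auto)
        also have "(e / c * norm y) / (\<alpha> * Gamma \<alpha>) = e * norm y"
          using \<alpha> Gamma_real_pos[OF \<alpha>(1), THEN less_imp_neq] by (simp add: c_def)
        finally have "t powr \<alpha> * \<bar>kernel_mean \<alpha> (\<lambda>s. T s x \<bullet> y) t - (x \<bullet> y) / (\<alpha> * Gamma \<alpha>)\<bar> \<le> t powr \<alpha> * (e * norm y)"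
          unfolding T0 by (rule mult_left_mono) simp
        then have "\<bar>t powr \<alpha> * (kernel_mean \<alpha> (\<lambda>s. T s x \<bullet> y) t - (x \<bullet> y) / (\<alpha> * Gamma \<alpha>))\<bar> \<le> t powr \<alpha> * e * norm y"
          unfolding abs_mult by (simp only: abs_of_nonneg[OF powr_ge_zero] mult.assoc)
        then have "\<bar>t powr \<alpha> * kernel_mean \<alpha> (\<lambda>s. T s x \<bullet> y) t - t powr \<alpha> * (x \<bullet> y) / (\<alpha> * Gamma \<alpha>)\<bar> \<le> t powr \<alpha> * e * norm y"
          unfolding right_diff_distrib times_divide_eq_right .
        moreover have "(\<integral>s. indicator {0<..<t} s * (S s x \<bullet> y) \<partial>lborel) = t powr \<alpha> * kernel_mean \<alpha> (\<lambda>s. T s x \<bullet> y) t"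
          using prim(2)[where t=t and x=x and y=y] t(1) frac_int_eq_kernel_mean[OF t(1)] by simp
        ultimately show "\<bar>(\<integral>s. indicator {0<..<t} s * (S s x \<bullet> y) \<partial>lborel) - t powr \<alpha> * (x \<bullet> y) / (\<alpha> * Gamma \<alpha>)\<bar>
         \<le> t powr \<alpha> * e * norm y"
          by simp
      qed
    qed
  qed
qed

section \<open>Finite-dimensional approximation\<close>

text \<open>Banach's fixed point theorem for x \<mapsto> y + P x gives surjectivity, and (1 -
  \<kappa>) norm x \<le> norm (x - P x) gives both injectivity and the bound for the
  inverse.\<close>

lemma neumann_inverse:
  fixes P :: "'a::banach \<Rightarrow> 'a"
  assumes P: "bounded_linear P" and le: "\<And>x. norm (P x) \<le> \<kappa> * norm x" and \<kappa>: "0 \<le> \<kappa>" "\<kappa> < 1"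
  shows "bij (\<lambda>x. x - P x)" "bounded_linear (inv (\<lambda>x. x - P x))"
proof -
  interpret P: bounded_linear P by fact
  let ?f = "\<lambda>x. x - P x"
  have lower: "(1 - \<kappa>) * norm x \<le> norm (?f x)" for x
    using norm_triangle_ineq2[of x "P x"] le[of x] by (simp add: algebra_simps)
  have lin: "?f (x + y) = ?f x + ?f y" "?f (r *\<^sub>R x) = r *\<^sub>R ?f x" "?f (x - y) = ?f x - ?f y" for x y r
    by (simp_all add: P.add P.scaleR P.diff scaleR_diff_right)
  have inj: "inj ?f"
  proof (rule injI)
    fix x y assume "?f x = ?f y"
    then have "(1 - \<kappa>) * norm (x - y) \<le> 0"
      using lower[of "x - y"] lin(3)[of x y] by simp
    then show "x = y"
      using \<kappa> by (simp add: mult_le_0_iff)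
  qed
  have "\<exists>x. y = ?f x" for y
  proof -
    have "\<exists>!x. y + P x = x"
    proof (rule banach_fix_type[OF \<kappa>], intro allI)
      fix u v
      show "dist (y + P u) (y + P v) \<le> \<kappa> * dist u v"
        using le[of "u - v"] by (simp add: dist_norm P.diff)
    qed
    then show ?thesis by (metis add_diff_cancel_right')
  qed
  then have surj: "surj ?f"
    unfolding surj_def by blast
  then show "bij ?f" using inj by (simp add: bij_def)
  let ?g = "inv ?f"
  have fg: "?f (?g y) = y" for y
    using surj by (rule surj_f_inv_f)
  have gf: "?g (?f x) = x" for x
    using inj by (rule inv_f_f)
  show "bounded_linear ?g"
  proof (rule bounded_linear_intro)
    show "?g (x + y) = ?g x + ?g y" for x y
      using gf[of "?g x + ?g y"] unfolding lin(1) fg .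
    show "?g (r *\<^sub>R x) = r *\<^sub>R ?g x" for r x
      using gf[of "r *\<^sub>R ?g x"] unfolding lin(2) fg .
    show "norm (?g x) \<le> norm x * (1 / (1 - \<kappa>))" for x
      using lower[of "?g x"] \<kappa> fg[of x] by (simp add: pos_le_divide_eq mult.commute)
  qed
qed

text \<open>In the extended reals 1 / \<infinity> = 0, so the strict inequality already forces the
  supremum to be finite. If the supremum is 0, its reciprocal is infinite and s * 0 < 1 holds
  directly.\<close>

lemma sup_norm_solop_bound:
  assumes "ennreal s < 1 / sup_norm_solop T" "s \<ge> 0"
  obtains B where "B \<ge> 0" "\<And>t. t \<ge> 0 \<Longrightarrow> onorm (T t) \<le> B" "s * B < 1"
proof -
  have fin: "sup_norm_solop T \<noteq> \<infinity>"
    using assms(1) by auto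
  define B where "B = enn2real (sup_norm_solop T)"
  have eq: "sup_norm_solop T = ennreal B" and B: "B \<ge> 0"
    using fin by (auto simp: B_def ennreal_enn2real_if)
  show ?thesis
  proof
    show "B \<ge> 0" by fact
    show "onorm (T t) \<le> B" if "t \<ge> 0" for t
    proof -
      have "ennreal (onorm (T t)) \<le> sup_norm_solop T"
        unfolding sup_norm_solop_def using that by (intro SUP_upper) simp
      then show ?thesis using B by (simp add: eq ennreal_le_iff)
    qed
    show "s * B < 1"
    proof (cases "B = 0")
      case False
      then have "B > 0" using B by simp
      then have "1 / sup_norm_solop T = ennreal (1 / B)"
        using divide_ennreal[of 1 B] by (simp add: eq)
      then have "s < 1 / B"
        using assms by (simp add: ennreal_less_iff)
      then show ?thesis using \<open>B > 0\<close> by (simp add: field_simps)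
    qed simp
  qed
qed

section \<open>Orthogonal projections and finite nets\<close>

text \<open>Fourier coefficients with respect to an orthogonal basis W of span Z. The formula is
  part of the conclusion because it places the projection of a bounded set inside a compact set from
  \<open>compact_bounded_combinations\<close>. A zero vector in W would only contribute the term
  0.\<close>

lemma orthogonal_projection_span:
  fixes Z :: "'a::real_inner set"
  assumes "finite Z"
  obtains W p where "finite W" "bounded_linear p" "\<And>x. norm (p x) \<le> norm x"
    "\<And>x z. z \<in> Z \<Longrightarrow> norm (x - p x) \<le> norm (x - z)"
    "\<And>x. p x = (\<Sum>w\<in>W. ((x \<bullet> w) / (w \<bullet> w)) *\<^sub>R w)"
proof -
  obtain W where W: "finite W" "span W = span Z" "pairwise orthogonal W"
    using basis_orthogonal[OF assms] by blast
  define p where "p x = (\<Sum>w\<in>W. ((x \<bullet> w) / (w \<bullet> w)) *\<^sub>R w)" for x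
  have ps: "p x \<in> span W" for x
    unfolding p_def by (intro span_sum span_scale span_base)
  have orth: "orthogonal (x - p x) z" if "z \<in> span W" for x z
  proof (rule orthogonal_to_span[OF that])
    fix v assume v: "v \<in> W"
    have "p x \<bullet> v = (\<Sum>w\<in>W. ((x \<bullet> w) / (w \<bullet> w)) * (w \<bullet> v))"
      by (simp add: p_def inner_sum_left)
    also have "\<dots> = (\<Sum>w\<in>W. if w = v then x \<bullet> v else 0)"
      using W(3) v by (intro sum.cong) (auto simp: pairwise_def orthogonal_def)
    also have "\<dots> = x \<bullet> v" using W(1) v by simp
    finally show "orthogonal (x - p x) v"
      by (simp add: orthogonal_def inner_diff_left)
  qed
  have pyth: "(norm (x - z))\<^sup>2 = (norm (x - p x))\<^sup>2 + (norm (p x - z))\<^sup>2" if "z \<in> span W" for x z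
  proof -
    have "orthogonal (x - p x) (p x - z)"
      by (rule orth[OF span_diff[OF ps that]])
    from norm_add_Pythagorean[OF this] show ?thesis by simp
  qed
  have le: "norm (x - p x) \<le> norm (x - z)" if "z \<in> span W" for x z
  proof (rule power2_le_imp_le)
    show "(norm (x - p x))\<^sup>2 \<le> (norm (x - z))\<^sup>2"
      unfolding pyth[OF that, of x] by simp
  qed simp
  have np: "norm (p x) \<le> norm x" for x
  proof (rule power2_le_imp_le)
    have "(norm (p x - 0))\<^sup>2 \<le> (norm (x - 0))\<^sup>2"
      unfolding pyth[OF span_zero, of x] by simp
    then show "(norm (p x))\<^sup>2 \<le> (norm x)\<^sup>2" by simp
  qed simp
  have "bounded_linear p"
    by (rule bounded_linear_intro[where K=1])
      (use np in \<open>auto simp: p_def inner_add_left add_divide_distrib scaleR_left_distrib sum.distrib scaleR_sum_right\<close>)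
  then show ?thesis
    using W(1,2) np le p_def by (intro that[of W p]) (auto simp: span_base)
qed

lemma compact_bounded_combinations:
  fixes W :: "'a::real_normed_vector set"
  assumes "finite W"
  shows "compact {\<Sum>w\<in>W. c w *\<^sub>R w |c. \<forall>w\<in>W. \<bar>c w\<bar> \<le> R w}"
  using assms
proof (induction W rule: finite_induct)
  case (insert v W)
  let ?S = "\<lambda>W. {\<Sum>w\<in>W. c w *\<^sub>R w |c. \<forall>w\<in>W. \<bar>c w\<bar> \<le> R w}"
  let ?A = "(\<lambda>r. r *\<^sub>R v) ` {- R v..R v}"
  have "compact ?A"
    by (intro compact_continuous_image continuous_intros) auto
  then have "compact {x + y |x y. x \<in> ?A \<and> y \<in> ?S W}"
    using insert.IH by (rule compact_sums)
  also have "{x + y |x y. x \<in> ?A \<and> y \<in> ?S W} = ?S (insert v W)"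
  proof (intro equalityI subsetI)
    fix u assume "u \<in> {x + y |x y. x \<in> ?A \<and> y \<in> ?S W}"
    then obtain r c where rc: "u = r *\<^sub>R v + (\<Sum>w\<in>W. c w *\<^sub>R w)" "\<bar>r\<bar> \<le> R v" "\<forall>w\<in>W. \<bar>c w\<bar> \<le> R w"
      by (auto simp: abs_le_iff)
    define c' where "c' = c(v := r)"
    have "(\<Sum>w\<in>W. c' w *\<^sub>R w) = (\<Sum>w\<in>W. c w *\<^sub>R w)"
      using insert.hyps by (intro sum.cong) (auto simp: c'_def)
    then have "u = (\<Sum>w\<in>insert v W. c' w *\<^sub>R w)"
      using insert.hyps rc by (simp add: c'_def)
    moreover have "\<forall>w\<in>insert v W. \<bar>c' w\<bar> \<le> R w"
      using rc by (auto simp: c'_def)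
    ultimately show "u \<in> ?S (insert v W)" by blast
  next
    fix u assume "u \<in> ?S (insert v W)"
    then obtain c where c: "u = (\<Sum>w\<in>insert v W. c w *\<^sub>R w)" "\<forall>w\<in>insert v W. \<bar>c w\<bar> \<le> R w"
      by blast
    then have "u = c v *\<^sub>R v + (\<Sum>w\<in>W. c w *\<^sub>R w)" "c v *\<^sub>R v \<in> ?A"
      using insert.hyps by (auto simp: abs_le_iff)
    then show "u \<in> {x + y |x y. x \<in> ?A \<and> y \<in> ?S W}"
      using c(2) by blast
  qed
  finally show ?case .
qed simp

text \<open>Centres of a finite cover of C by e-balls need not lie in K, so each centre close to K
  is replaced by a point of K within 2e of it; two such distances add up to 4e.\<close>

lemma finite_net_near_compact:
  fixes K C :: "'a::metric_space set"
  assumes C: "compact C" and e: "e > 0" and near: "\<And>x. x \<in> K \<Longrightarrow> \<exists>y\<in>C. dist x y \<le> e"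
  obtains F where "finite F" "F \<subseteq> K" "\<And>x. x \<in> K \<Longrightarrow> \<exists>y\<in>F. dist x y < 4 * e"
proof -
  obtain k where k: "finite k" "C \<subseteq> (\<Union>x\<in>k. ball x e)"
    by (rule compactE_image[OF C, of C "\<lambda>x. ball x e"]) (use e in auto)
  have "\<exists>g. \<forall>c\<in>k. (\<exists>x\<in>K. dist x c < 2 * e) \<longrightarrow> g c \<in> K \<and> dist (g c) c < 2 * e"
    by (rule bchoice) blast
  then obtain g where g: "\<And>c. c \<in> k \<Longrightarrow> \<exists>x\<in>K. dist x c < 2 * e \<Longrightarrow> g c \<in> K \<and> dist (g c) c < 2 * e"
    by blast
  let ?F = "g ` {c \<in> k. \<exists>x\<in>K. dist x c < 2 * e}"
  show ?thesis
  proof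
    show "finite ?F" using k by simp
    show "?F \<subseteq> K" using g by blast
    fix x assume x: "x \<in> K"
    obtain y where y: "y \<in> C" "dist x y \<le> e" using near[OF x] by blast
    obtain c where c: "c \<in> k" "dist c y < e" using k(2) y(1) by auto
    have xc: "dist x c < 2 * e"
      using dist_triangle[of x c y] y(2) c(2) by (simp add: dist_commute)
    then have "dist (g c) c < 2 * e" using g[OF c(1)] x by blast
    then have "dist x (g c) < 4 * e"
      using dist_triangle[of x "g c" c] xc by (simp add: dist_commute)
    then show "\<exists>y\<in>?F. dist x y < 4 * e" using c(1) x xc by blast
  qed
qed

section \<open>Square integrals of the kernel singularity\<close>

text \<open>The singular factor (b - s)^(\<alpha> - 1) in the bound for S(b - s), restricted to the
  last stretch of length \<delta> before b. There S is controlled by its growth bound, elsewhere by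
  compactness or norm continuity on [\<delta>, a].\<close>

definition edge :: "real \<Rightarrow> real \<Rightarrow> real \<Rightarrow> real \<Rightarrow> real" where
  "edge \<alpha> \<delta> b s = indicator {b - \<delta><..<b} s * (b - s) powr (\<alpha> - 1)"

lemma edge_nonneg: "edge \<alpha> \<delta> b s \<ge> 0"
  by (simp add: edge_def)

text \<open>The L2 norm of an edge over the whole line for \<alpha> > 1/2, from the integral of r^(2
  \<alpha> - 2) over (0, \<delta>).\<close>

definition edge_norm :: "real \<Rightarrow> real \<Rightarrow> real" where
  "edge_norm \<alpha> \<delta> = sqrt (\<delta> powr (2 * \<alpha> - 1) / (2 * \<alpha> - 1))"

lemma edge_norm_tendsto:
  assumes "\<alpha> > 1 / 2"
  shows "((\<lambda>\<delta>. edge_norm \<alpha> \<delta>) \<longlongrightarrow> 0) (at_right 0)"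
proof -
  have "((\<lambda>\<delta>. \<delta> powr (2 * \<alpha> - 1)) \<longlongrightarrow> 0) (at_right 0)"
  proof (rule tendsto_zero_powrI)
    show "\<forall>\<^sub>F \<delta> in at_right 0. 0 \<le> (\<delta> :: real)"
      by (simp add: eventually_at_filter)
  qed (use assms in \<open>auto intro!: tendsto_eq_intros\<close>)
  then have "((\<lambda>\<delta>. sqrt (\<delta> powr (2 * \<alpha> - 1) / (2 * \<alpha> - 1))) \<longlongrightarrow> sqrt (0 / (2 * \<alpha> - 1))) (at_right 0)"
    by (intro tendsto_real_sqrt tendsto_divide tendsto_const) (use assms in auto)
  then show ?thesis
    by (simp add: edge_norm_def)
qed

lemma edge_square_integral:
  assumes \<alpha>: "\<alpha> > 1 / 2" and \<delta>: "\<delta> > 0"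
  shows "edge \<alpha> \<delta> b \<in> borel_measurable (lebesgue_on {0..a})"
    "integrable (lebesgue_on {0..a}) (\<lambda>s. (edge \<alpha> \<delta> b s)\<^sup>2)"
    "(\<integral>s. (edge \<alpha> \<delta> b s)\<^sup>2 \<partial>lebesgue_on {0..a}) \<le> (edge_norm \<alpha> \<delta>)\<^sup>2"
proof -
  have m: "edge \<alpha> \<delta> b \<in> borel_measurable borel"
    unfolding edge_def[abs_def] by measurable
  then have "edge \<alpha> \<delta> b \<in> borel_measurable lebesgue"
    by (simp add: measurable_completion)
  then show "edge \<alpha> \<delta> b \<in> borel_measurable (lebesgue_on {0..a})"
    by (rule measurable_restrict_space1)
  define c where "c = \<delta> powr (2 * \<alpha> - 1) / (2 * \<alpha> - 1)"
  have c0: "c \<ge> 0" using \<alpha> by (simp add: c_def)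
  have "((\<lambda>r. r powr (2 * \<alpha> - 2)) has_integral (\<delta> powr (2 * \<alpha> - 2 + 1) / (2 * \<alpha> - 2 + 1))) {0..\<delta>}"
    by (rule has_integral_powr_from_0) (use \<alpha> \<delta> in auto)
  then have nn: "(\<integral>\<^sup>+r. ennreal (indicator {0..\<delta>} r * r powr (2 * \<alpha> - 2)) \<partial>lborel) = ennreal c"
    by (subst nn_integral_has_integral_lebesgue) (auto simp: c_def)
  have "(\<integral>\<^sup>+s. ennreal ((edge \<alpha> \<delta> b s)\<^sup>2) \<partial>lborel) = (\<integral>\<^sup>+r. ennreal ((edge \<alpha> \<delta> b (b - r))\<^sup>2) \<partial>lborel)"
    using nn_integral_real_affine[of "\<lambda>s. ennreal ((edge \<alpha> \<delta> b s)\<^sup>2)" "- 1" b] m by simp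
  also have "\<dots> \<le> (\<integral>\<^sup>+r. ennreal (indicator {0..\<delta>} r * r powr (2 * \<alpha> - 2)) \<partial>lborel)"
  proof (intro nn_integral_mono ennreal_leI)
    fix r
    show "(edge \<alpha> \<delta> b (b - r))\<^sup>2 \<le> indicator {0..\<delta>} r * r powr (2 * \<alpha> - 2)"
      by (auto simp: edge_def indicator_def power2_eq_square powr_add[symmetric])
  qed
  finally have le: "(\<integral>\<^sup>+s. ennreal ((edge \<alpha> \<delta> b s)\<^sup>2) \<partial>lborel) \<le> ennreal c"
    using nn by simp
  have i: "integrable lborel (\<lambda>s. (edge \<alpha> \<delta> b s)\<^sup>2)"
    using m le by (intro integrableI_bounded) (auto simp: top_unique intro: order.strict_trans1)
  then have "ennreal (\<integral>s. (edge \<alpha> \<delta> b s)\<^sup>2 \<partial>lborel) \<le> ennreal c"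
    using le by (subst nn_integral_eq_integral[symmetric]) auto
  then have ile: "(\<integral>s. (edge \<alpha> \<delta> b s)\<^sup>2 \<partial>lborel) \<le> c"
    using c0 by (simp add: ennreal_le_iff)
  have il: "integrable lebesgue (\<lambda>s. (edge \<alpha> \<delta> b s)\<^sup>2)" "(\<integral>s. (edge \<alpha> \<delta> b s)\<^sup>2 \<partial>lebesgue) \<le> c"
    using i ile m by (simp_all add: integrable_completion integral_completion)
  have ii: "integrable lebesgue (\<lambda>s. indicator {0..a} s *\<^sub>R (edge \<alpha> \<delta> b s)\<^sup>2)"
    using il(1) by (intro integrable_mult_indicator) auto
  then show "integrable (lebesgue_on {0..a}) (\<lambda>s. (edge \<alpha> \<delta> b s)\<^sup>2)"
    by (simp add: integrable_restrict_space)
  have "(\<integral>s. (edge \<alpha> \<delta> b s)\<^sup>2 \<partial>lebesgue_on {0..a}) = (\<integral>s. indicator {0..a} s *\<^sub>R (edge \<alpha> \<delta> b s)\<^sup>2 \<partial>lebesgue)"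
    by (simp add: integral_restrict_space)
  also have "\<dots> \<le> (\<integral>s. (edge \<alpha> \<delta> b s)\<^sup>2 \<partial>lebesgue)"
    by (rule integral_mono[OF ii il(1)]) (auto simp: indicator_def)
  also have "\<dots> \<le> c" by fact
  finally show "(\<integral>s. (edge \<alpha> \<delta> b s)\<^sup>2 \<partial>lebesgue_on {0..a}) \<le> (edge_norm \<alpha> \<delta>)\<^sup>2"
    using c0 unfolding edge_norm_def c_def by simp
qed

text \<open>Estimates of the Green's function take this shape: a constant A away from the
  singularities plus edges at the points b j. Cauchy-Schwarz against 1 and against each edge makes
  the first part small through A and the second through \<delta>.\<close>

lemma L2_edge_integral:
  fixes h :: "real \<Rightarrow> 'e::complex_hilbert"
  assumes h: "h \<in> L2 a" and a: "a \<ge> 0" and \<alpha>: "\<alpha> > 1 / 2" and \<delta>: "\<delta> > 0" and J: "finite J" and AB: "A \<ge> 0" "B \<ge> 0"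
  shows "integrable (lebesgue_on {0..a}) (\<lambda>s. norm (h s) * (A + B * (\<Sum>j\<in>J. edge \<alpha> \<delta> (b j) s)))"
    and "(\<integral>s. norm (h s) * (A + B * (\<Sum>j\<in>J. edge \<alpha> \<delta> (b j) s)) \<partial>lebesgue_on {0..a})
      \<le> L2_norm a h * (A * sqrt a + B * (real (card J) * edge_norm \<alpha> \<delta>))"
proof -
  let ?M = "lebesgue_on {0..a}"
  note hm = L2_borel_measurable_norm[OF h] and hi = L2_integrable[OF h]
  have fin: "integrable ?M (\<lambda>s. 1 :: real)" "(\<integral>s. 1 \<partial>?M) = a"
    using a finite_measure.integrable_const[OF finite_measure_lebesgue_on[of "{0..a}"], of "1 :: real"]
    by (auto simp: measure_restrict_space)
  have h1: "integrable ?M (\<lambda>s. norm (h s))" "(\<integral>s. norm (h s) \<partial>?M) \<le> L2_norm a h * sqrt a"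
    using Cauchy_Schwarz_integral[OF hm _ hi, of "\<lambda>s. 1"] fin by (simp_all add: L2_norm_def)
  have "edge_norm \<alpha> \<delta> \<ge> 0" using \<alpha> by (simp add: edge_norm_def)
  have he: "integrable ?M (\<lambda>s. norm (h s) * edge \<alpha> \<delta> b s)"
    "(\<integral>s. norm (h s) * edge \<alpha> \<delta> b s \<partial>?M) \<le> L2_norm a h * edge_norm \<alpha> \<delta>" for b
  proof -
    note e = edge_square_integral[OF \<alpha> \<delta>, where b=b and a=a]
    note cs = Cauchy_Schwarz_integral[OF hm e(1) hi e(2)]
    show "integrable ?M (\<lambda>s. norm (h s) * edge \<alpha> \<delta> b s)" by (rule cs)
    have "(\<integral>s. norm (h s) * edge \<alpha> \<delta> b s \<partial>?M) \<le> L2_norm a h * sqrt (\<integral>s. (edge \<alpha> \<delta> b s)\<^sup>2 \<partial>?M)"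
      using cs(2) by (simp add: L2_norm_def abs_mult edge_nonneg)
    also have "\<dots> \<le> L2_norm a h * edge_norm \<alpha> \<delta>"
      using real_sqrt_le_mono[OF e(3)] \<open>edge_norm \<alpha> \<delta> \<ge> 0\<close> by (intro mult_left_mono L2_norm_nonneg) simp
    finally show "(\<integral>s. norm (h s) * edge \<alpha> \<delta> b s \<partial>?M) \<le> L2_norm a h * edge_norm \<alpha> \<delta>" .
  qed
  have eq: "norm (h s) * (A + B * (\<Sum>j\<in>J. edge \<alpha> \<delta> (b j) s)) =
      A * norm (h s) + B * (\<Sum>j\<in>J. norm (h s) * edge \<alpha> \<delta> (b j) s)" for s
    by (simp add: distrib_left sum_distrib_left mult_ac)
  show "integrable ?M (\<lambda>s. norm (h s) * (A + B * (\<Sum>j\<in>J. edge \<alpha> \<delta> (b j) s)))"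
    unfolding eq using h1 he by simp
  have "(\<integral>s. norm (h s) * (A + B * (\<Sum>j\<in>J. edge \<alpha> \<delta> (b j) s)) \<partial>?M) =
     A * (\<integral>s. norm (h s) \<partial>?M) + B * (\<Sum>j\<in>J. \<integral>s. norm (h s) * edge \<alpha> \<delta> (b j) s \<partial>?M)"
    unfolding eq using h1 he by simp
  also have "\<dots> \<le> A * (L2_norm a h * sqrt a) + B * (\<Sum>j\<in>J. L2_norm a h * edge_norm \<alpha> \<delta>)"
    using h1 he AB by (intro add_mono mult_left_mono sum_mono) auto
  also have "\<dots> = L2_norm a h * (A * sqrt a + B * (real (card J) * edge_norm \<alpha> \<delta>))"
    by (simp add: algebra_simps)
  finally show "(\<integral>s. norm (h s) * (A + B * (\<Sum>j\<in>J. edge \<alpha> \<delta> (b j) s)) \<partial>?M)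
      \<le> L2_norm a h * (A * sqrt a + B * (real (card J) * edge_norm \<alpha> \<delta>))" .
qed

section \<open>Brouwer's theorem on a cube of arbitrary dimension\<close>

lemma cube_convergent_subsequence:
  fixes X :: "nat \<Rightarrow> nat \<Rightarrow> real"
  assumes "\<And>k i. i < n \<Longrightarrow> X k i \<in> {0..1}"
  shows "\<exists>x r. strict_mono r \<and> (\<forall>i<n. x i \<in> {0..1} \<and> (\<lambda>k. X (r k) i) \<longlonglongrightarrow> x i)"
  using assms
proof (induction n)
  case 0
  show ?case by (intro exI[of _ "\<lambda>i. 0"] exI[of _ id]) (auto simp: strict_mono_def)
next
  case (Suc n)
  then obtain x r where r: "strict_mono r" and x: "\<forall>i<n. x i \<in> {0..1} \<and> (\<lambda>k. X (r k) i) \<longlonglongrightarrow> x i"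
    by (metis less_SucI)
  have "seq_compact {0..1::real}"
    by (simp add: compact_imp_seq_compact)
  then obtain l r' where l: "l \<in> {0..1}" "strict_mono r'" "((\<lambda>k. X (r k) n) \<circ> r') \<longlonglongrightarrow> l"
    using Suc.prems by (auto elim!: seq_compactE[of _ "\<lambda>k. X (r k) n"])
  have "(\<lambda>k. X ((r \<circ> r') k) i) \<longlonglongrightarrow> (x(n := l)) i \<and> (x(n := l)) i \<in> {0..1}" if "i < Suc n" for i
  proof (cases "i = n")
    case True
    then show ?thesis using l by (simp add: comp_def)
  next
    case False
    then have "i < n" using that by simp
    then have "((\<lambda>k. X (r k) i) \<circ> r') \<longlonglongrightarrow> x i" "x i \<in> {0..1}"
      using x l(2) by (auto intro: LIMSEQ_subseq_LIMSEQ)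
    then show ?thesis using False by (simp add: comp_def)
  qed
  then show ?case
    using strict_mono_o[OF r l(2)] by blast
qed

text \<open>The library's version of Brouwer's theorem fixes the dimension in the type; here it is the size
  of a net that is only obtained inside a proof.\<close>

lemma brouwer_nat_cube:
  fixes f :: "(nat \<Rightarrow> real) \<Rightarrow> nat \<Rightarrow> real"
  assumes range: "\<And>x i. (\<And>j. j < n \<Longrightarrow> x j \<in> {0..1}) \<Longrightarrow> i < n \<Longrightarrow> f x i \<in> {0..1}"
    and cont: "\<And>X x i. (\<And>k j. j < n \<Longrightarrow> X k j \<in> {0..1}) \<Longrightarrow> (\<And>j. j < n \<Longrightarrow> x j \<in> {0..1}) \<Longrightarrow>
      (\<And>j. j < n \<Longrightarrow> (\<lambda>k. X k j) \<longlonglongrightarrow> x j) \<Longrightarrow> i < n \<Longrightarrow> (\<lambda>k. f (X k) i) \<longlonglongrightarrow> f x i"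
  shows "\<exists>x. \<forall>i<n. x i \<in> {0..1} \<and> f x i = x i"
proof -
  \<comment> \<open>Grid points of mesh 1 / (p + 1). The labels defined next record the direction in
    which f moves coordinate i; the prescribed labels on the faces agree with it because f maps the
    cube into itself.\<close>
  define g where "g p q = (\<lambda>i. real (q i) / real (Suc p))" for p :: nat and q :: "nat \<Rightarrow> nat"
  define lab where "lab p q i = (if q i = 0 then 0 else if q i = Suc p then 1 else
     if g p q i \<le> f (g p q) i then 0 else 1 :: nat)" for p q i
  have g01: "g p q j \<in> {0..1}" if "q j \<le> Suc p" for p q j
    using that by (simp add: g_def)
  have f01: "f (g p q) i \<in> {0..1}" if "\<And>j. j < n \<Longrightarrow> q j \<le> Suc p" "i < n" for p q i
    by (rule range) (use g01 that in auto)
  have g0: "g p q i = 0" if "q i = 0" for p q i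
    using that by (simp add: g_def)
  have g1: "g p q i = 1" if "q i = Suc p" for p q i
    using that by (simp add: g_def)
  have lab0: "g p q i \<le> f (g p q) i" if "\<And>j. j < n \<Longrightarrow> q j \<le> Suc p" "i < n" "lab p q i = 0" for p q i
    using f01[OF that(1,2)] that(3) g0[of q i p] g1[of q i p] by (auto simp: lab_def split: if_splits)
  have lab1: "f (g p q) i \<le> g p q i" if "\<And>j. j < n \<Longrightarrow> q j \<le> Suc p" "i < n" "lab p q i \<noteq> 0" for p q i
    using f01[OF that(1,2)] that(3) g0[of q i p] g1[of q i p] by (auto simp: lab_def split: if_splits)
  have "\<forall>p. \<exists>q. (\<forall>i<n. q i < Suc p) \<and> (\<forall>i<n. \<exists>r s. (\<forall>j<n. q j \<le> r j \<and> r j \<le> q j + 1) \<and>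
      (\<forall>j<n. q j \<le> s j \<and> s j \<le> q j + 1) \<and> lab p r i \<noteq> lab p s i)"
  proof
    fix p
    have 1: "\<forall>x. (\<forall>i<n. x i \<le> Suc p) \<longrightarrow> (\<forall>i<n. lab p x i = 0 \<or> lab p x i = 1)"
      and 2: "\<forall>x. (\<forall>i<n. x i \<le> Suc p) \<longrightarrow> (\<forall>i<n. x i = 0 \<longrightarrow> lab p x i = 0)"
      and 3: "\<forall>x. (\<forall>i<n. x i \<le> Suc p) \<longrightarrow> (\<forall>i<n. x i = Suc p \<longrightarrow> lab p x i = 1)"
      by (auto simp: lab_def)
    show "\<exists>q. (\<forall>i<n. q i < Suc p) \<and> (\<forall>i<n. \<exists>r s. (\<forall>j<n. q j \<le> r j \<and> r j \<le> q j + 1) \<and>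
        (\<forall>j<n. q j \<le> s j \<and> s j \<le> q j + 1) \<and> lab p r i \<noteq> lab p s i)"
      by (rule kuhn_lemma[OF _ 1 2 3]) (simp, blast)
  qed
  from choice[OF this] obtain q where q1: "\<And>p i. i < n \<Longrightarrow> q p i < Suc p"
    and q2: "\<And>p i. i < n \<Longrightarrow> \<exists>r s. (\<forall>j<n. q p j \<le> r j \<and> r j \<le> q p j + 1) \<and>
      (\<forall>j<n. q p j \<le> s j \<and> s j \<le> q p j + 1) \<and> lab p r i \<noteq> lab p s i"
    by blast
  \<comment> \<open>For each coordinate the cell found by Kuhn's lemma has a vertex u where f does
    not lower it and a vertex w where f does not raise it.\<close>
  have uw: "\<exists>u w. (\<forall>j<n. q p j \<le> u j \<and> u j \<le> q p j + 1) \<and> (\<forall>j<n. q p j \<le> w j \<and> w j \<le> q p j + 1) \<and>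
      lab p u i = 0 \<and> lab p w i \<noteq> 0" if i: "i < n" for p i
  proof -
    obtain r s where rs: "\<forall>j<n. q p j \<le> r j \<and> r j \<le> q p j + 1" "\<forall>j<n. q p j \<le> s j \<and> s j \<le> q p j + 1"
      "lab p r i \<noteq> lab p s i"
      using q2[OF i] by blast
    have "lab p r i \<le> 1" "lab p s i \<le> 1"
      by (auto simp: lab_def)
    then consider "lab p r i = 0" "lab p s i \<noteq> 0" | "lab p s i = 0" "lab p r i \<noteq> 0"
      using rs(3) by linarith
    then show ?thesis
      using rs(1,2) by cases blast+
  qed
  obtain x r where r: "strict_mono r" and x: "\<And>i. i < n \<Longrightarrow> x i \<in> {0..1}"
    and lim: "\<And>i. i < n \<Longrightarrow> (\<lambda>k. g (r k) (q (r k)) i) \<longlonglongrightarrow> x i"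
  proof -
    have "g p (q p) i \<in> {0..1}" if "i < n" for p i
      by (rule g01, rule less_imp_le, rule q1, rule that)
    then show thesis
      using cube_convergent_subsequence[of n "\<lambda>p. g p (q p)"] that by blast
  qed
  \<comment> \<open>The cells shrink, so any choice of vertices converges to the same x as the
    corners.\<close>
  have near: "(\<lambda>k. g (r k) (u k) j) \<longlonglongrightarrow> x j"
    if u: "\<And>k j. j < n \<Longrightarrow> q (r k) j \<le> u k j \<and> u k j \<le> q (r k) j + 1" and j: "j < n" for u j
  proof -
    have inv: "(\<lambda>k. 1 / real (Suc (r k))) \<longlonglongrightarrow> 0"
      using LIMSEQ_subseq_LIMSEQ[OF LIMSEQ_inverse_real_of_nat r] by (simp add: comp_def inverse_eq_divide)
    have "(\<lambda>k. g (r k) (u k) j - g (r k) (q (r k)) j) \<longlonglongrightarrow> 0"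
    proof (rule Lim_null_comparison[OF always_eventually inv], intro allI)
      fix k
      have "\<bar>real (u k j) - real (q (r k) j)\<bar> \<le> 1"
        using u[OF j, of k] by linarith
      then show "norm (g (r k) (u k) j - g (r k) (q (r k)) j) \<le> 1 / real (Suc (r k))"
        by (simp add: g_def diff_divide_distrib[symmetric] divide_right_mono)
    qed
    from tendsto_add[OF this lim[OF j]] show ?thesis by simp
  qed
  have "f x i = x i" if i: "i < n" for i
  proof -
    have "\<forall>p. \<exists>u w. (\<forall>j<n. q p j \<le> u j \<and> u j \<le> q p j + 1) \<and> (\<forall>j<n. q p j \<le> w j \<and> w j \<le> q p j + 1) \<and>
        lab p u i = 0 \<and> lab p w i \<noteq> 0"
      using uw[OF i] by simp
    from choice[OF this] obtain u where "\<forall>p. \<exists>w. (\<forall>j<n. q p j \<le> u p j \<and> u p j \<le> q p j + 1) \<and>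
        (\<forall>j<n. q p j \<le> w j \<and> w j \<le> q p j + 1) \<and> lab p (u p) i = 0 \<and> lab p w i \<noteq> 0" ..
    from choice[OF this] obtain w where "\<forall>p. (\<forall>j<n. q p j \<le> u p j \<and> u p j \<le> q p j + 1) \<and>
        (\<forall>j<n. q p j \<le> w p j \<and> w p j \<le> q p j + 1) \<and> lab p (u p) i = 0 \<and> lab p (w p) i \<noteq> 0" ..
    then have u: "\<And>p j. j < n \<Longrightarrow> q p j \<le> u p j \<and> u p j \<le> q p j + 1" "\<And>p. lab p (u p) i = 0"
      and w: "\<And>p j. j < n \<Longrightarrow> q p j \<le> w p j \<and> w p j \<le> q p j + 1" "\<And>p. lab p (w p) i \<noteq> 0"
      by blast+
    have le: "u p j \<le> Suc p" "w p j \<le> Suc p" if "j < n" for p j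
      using u(1)[OF that, of p] w(1)[OF that, of p] q1[OF that, of p] by auto
    have nu: "(\<lambda>k. g (r k) (u (r k)) j) \<longlonglongrightarrow> x j" and nw: "(\<lambda>k. g (r k) (w (r k)) j) \<longlonglongrightarrow> x j" if "j < n" for j
      using near[of "\<lambda>k. u (r k)"] near[of "\<lambda>k. w (r k)"] u(1) w(1) that by blast+
    have fu: "(\<lambda>k. f (g (r k) (u (r k))) i) \<longlonglongrightarrow> f x i"
      by (rule cont) (use le g01 x nu i in auto)
    have fw: "(\<lambda>k. f (g (r k) (w (r k))) i) \<longlonglongrightarrow> f x i"
      by (rule cont) (use le g01 x nw i in auto)
    have "x i \<le> f x i"
      by (rule LIMSEQ_le[OF nu[OF i] fu]) (use lab0[OF _ i u(2)] le in blast)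
    moreover have "f x i \<le> x i"
      by (rule LIMSEQ_le[OF fw nw[OF i]]) (use lab1[OF _ i w(2)] le in blast)
    ultimately show ?thesis by simp
  qed
  then show ?thesis using x by blast
qed

section \<open>The nonlocal problem\<close>

text \<open>Generator and analyticity do not appear here: \<open>S_bound\<close>,
  \<open>S_cont\<close> and \<open>S_asymp\<close> are what remains of them. \<open>BT\<close> is a
  finite bound in the role of the supremum of the norms of T.\<close>

locale nonlocal_problem =
  fixes \<alpha> a C BT :: real and T S :: "real \<Rightarrow> 'e::complex_hilbert \<Rightarrow> 'e"
    and m :: nat and c \<tau> :: "nat \<Rightarrow> real" and L :: "(real \<Rightarrow> 'e) \<Rightarrow> 'e"
  assumes \<alpha>: "0 < \<alpha>" and \<alpha>1: "\<alpha> < 1" and a: "0 < a"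
    and S_linear: "\<And>t. t > 0 \<Longrightarrow> bounded_linear (S t)"
    and S_strong: "\<And>x. continuous_on {0<..} (\<lambda>t. S t x)"
    and C: "C \<ge> 0" and S_bound: "\<And>t x. 0 < t \<Longrightarrow> t \<le> a \<Longrightarrow> norm (S t x) \<le> C * t powr (\<alpha> - 1) * norm x"
    and S_cont: "continuous_on {0<..a} (\<lambda>t. Blinfun (S t))"
    and S_asymp: "\<And>x e. e > 0 \<Longrightarrow> \<exists>d>0. d \<le> a \<and> (\<forall>t y. 0 < t \<longrightarrow> t \<le> d \<longrightarrow>
       \<bar>(\<integral>s. indicator {0<..<t} s * (S s x \<bullet> y) \<partial>lborel) - t powr \<alpha> * (x \<bullet> y) / (\<alpha> * Gamma \<alpha>)\<bar>
         \<le> t powr \<alpha> * e * norm y)"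
    and S_compact: "\<And>t V. t > 0 \<Longrightarrow> bounded V \<Longrightarrow> compact (closure (S t ` V))"
    and T_linear: "\<And>t. t \<ge> 0 \<Longrightarrow> bounded_linear (T t)"
    and T_strong: "\<And>x. continuous_on {0..} (\<lambda>t. T t x)"
    and BT: "BT \<ge> 0" and T_bound: "\<And>t x. t \<ge> 0 \<Longrightarrow> norm (T t x) \<le> BT * norm x"
    and small: "(\<Sum>k=1..m. \<bar>c k\<bar>) * BT < 1"
    and \<tau>: "\<And>k. k \<in> {1..m} \<Longrightarrow> \<tau> k \<in> {0..a}"
    and L: "is_terminal_operator a (green T S m c \<tau>) L"
begin

abbreviation "G \<equiv> green T S m c \<tau>"
abbreviation "Op \<equiv> nonlocal_inverse T m c \<tau>"

section \<open>The Green's function near the right end\<close>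

text \<open>General index sets K are allowed because the nodes at the right end will be separated
  from the others.\<close>

lemma partial_sum_linear:
  assumes "K \<subseteq> {1..m}"
  shows "bounded_linear (\<lambda>x. \<Sum>k\<in>K. c k *\<^sub>R T (\<tau> k) x)"
    and "norm (\<Sum>k\<in>K. c k *\<^sub>R T (\<tau> k) x) \<le> (\<Sum>k=1..m. \<bar>c k\<bar>) * BT * norm x"
proof -
  have t0: "\<tau> k \<ge> 0" if "k \<in> K" for k
    using \<tau>[of k] that assms by auto
  show "bounded_linear (\<lambda>x. \<Sum>k\<in>K. c k *\<^sub>R T (\<tau> k) x)"
    by (intro bounded_linear_sum bounded_linear_const_scaleR T_linear t0)
  have "norm (\<Sum>k\<in>K. c k *\<^sub>R T (\<tau> k) x) \<le> (\<Sum>k\<in>K. \<bar>c k\<bar> * (BT * norm x))"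
    by (rule order_trans[OF norm_sum sum_mono]) (auto intro!: mult_left_mono T_bound t0)
  also have "\<dots> = (\<Sum>k\<in>K. \<bar>c k\<bar>) * (BT * norm x)"
    by (simp add: sum_distrib_right)
  also have "\<dots> \<le> (\<Sum>k=1..m. \<bar>c k\<bar>) * (BT * norm x)"
    using assms BT by (intro mult_right_mono sum_mono2) auto
  finally show "norm (\<Sum>k\<in>K. c k *\<^sub>R T (\<tau> k) x) \<le> (\<Sum>k=1..m. \<bar>c k\<bar>) * BT * norm x"
    by (simp add: mult.assoc)
qed

lemma neumann_partial:
  assumes "K \<subseteq> {1..m}"
  shows "bij (\<lambda>x. x - (\<Sum>k\<in>K. c k *\<^sub>R T (\<tau> k) x))"
    "bounded_linear (inv (\<lambda>x. x - (\<Sum>k\<in>K. c k *\<^sub>R T (\<tau> k) x)))"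
proof -
  have "(\<Sum>k=1..m. \<bar>c k\<bar>) * BT \<ge> 0"
    using BT by (simp add: sum_nonneg)
  note n = neumann_inverse[OF partial_sum_linear[OF assms] this small]
  show "bij (\<lambda>x. x - (\<Sum>k\<in>K. c k *\<^sub>R T (\<tau> k) x))"
    "bounded_linear (inv (\<lambda>x. x - (\<Sum>k\<in>K. c k *\<^sub>R T (\<tau> k) x)))"
    by (rule n)+
qed

lemma Op_linear: "bounded_linear Op"
  unfolding nonlocal_inverse_def by (rule neumann_partial) simp

lemma Op_eq: "Op x - (\<Sum>k=1..m. c k *\<^sub>R T (\<tau> k) (Op x)) = x"
  using surj_f_inv_f[OF bij_is_surj[OF neumann_partial(1)[OF subset_refl]], of x]
  by (simp add: nonlocal_inverse_def)

lemma G_zero: "G t s 0 = 0" if "t \<ge> 0"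
proof -
  have "S r 0 = 0" if "r > 0" for r
    using S_linear[OF that] by (simp add: linear_simps)
  moreover have "T t 0 = 0" "Op 0 = 0"
    using T_linear[OF \<open>t \<ge> 0\<close>] Op_linear by (simp_all add: linear_simps)
  ultimately show ?thesis
    by (auto simp: green_def intro!: sum.neutral)
qed

text \<open>Near \<open>s = a\<close> only the nodes \<open>t\<^sub>k = a\<close> contribute to \<open>G(a,s)\<close>, through a factor
  \<open>N = I + \<Sum>\<^bsub>t\<^sub>k = a\<^esub> c\<^sub>k T(a) \<O> = (I - \<Sum>\<^bsub>t\<^sub>k < a\<^esub> c\<^sub>k T(t\<^sub>k)) \<O>\<close>, which is invertible
  although a node may sit at the right end of the interval.\<close>

lemma green_right_end:
  obtains d N N' where "0 < d" "d \<le> a" "bounded_linear N" "bounded_linear N'"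
    "\<And>x. N (N' x) = x" "\<And>x. N' (N x) = x" "\<And>s x. a - d < s \<Longrightarrow> s < a \<Longrightarrow> G a s x = N (S (a - s) x)"
proof -
  define K where "K = {k \<in> {1..m}. \<tau> k \<noteq> a}"
  define P where "P x = (\<Sum>k\<in>K. c k *\<^sub>R T (\<tau> k) x)" for x
  define P1 where "P1 x = (\<Sum>k=1..m. c k *\<^sub>R T (\<tau> k) x)" for x
  have K: "K \<subseteq> {1..m}" "finite K" by (auto simp: K_def)
  have bP: "bounded_linear P" and bP1: "bounded_linear P1"
    unfolding P_def[abs_def] P1_def[abs_def] by (rule partial_sum_linear, use K in simp)+
  have bij: "bij (\<lambda>x. x - P x)" and bi: "bounded_linear (inv (\<lambda>x. x - P x))"
    using neumann_partial[OF K(1)] by (simp_all add: P_def[abs_def])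
  have Op: "Op x - P1 (Op x) = x" for x
    using Op_eq[of x] by (simp add: P1_def)
  have Op': "Op (x - P1 x) = x" for x
    using inv_f_f[OF bij_is_inj[OF neumann_partial(1)[OF subset_refl]], of x]
    by (simp add: nonlocal_inverse_def P1_def)
  define F where "F = inv (\<lambda>x. x - P x)"
  have F: "F x - P (F x) = x" "F (x - P x) = x" for x
    using surj_f_inv_f[OF bij_is_surj[OF bij], of x] inv_f_f[OF bij_is_inj[OF bij], of x] by (simp_all add: F_def)
  \<comment> \<open>The gap between a and the nearest node below it, capped at a. On (a - d, a)
    every node with index in K lies to the left of s and drops out of the Green's function.\<close>
  define d where "d = Min (insert a ((\<lambda>k. a - \<tau> k) ` K))"
  \<comment> \<open>N is (I - P) Op and Op is inverse to I - P1, so (I - P1) F inverts N. From Op -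
    P1 Op = I one gets N = I + (P1 - P) Op, the form in which it appears in the Green's
    function.\<close>
  define N where "N x = Op x - P (Op x)" for x
  define N' where "N' x = F x - P1 (F x)" for x
  show ?thesis
  proof
    show "0 < d"
      unfolding d_def using a K(2) \<tau> by (subst Min_gr_iff) (force simp: K_def)+
    show "d \<le> a"
      unfolding d_def using K(2) by (intro Min_le) auto
    have dk: "d \<le> a - \<tau> k" if "k \<in> K" for k
      unfolding d_def using K(2) that by (intro Min_le) auto
    show "bounded_linear N"
      unfolding N_def[abs_def] by (intro bounded_linear_sub Op_linear bounded_linear_compose[OF bP])
    show "bounded_linear N'"
      unfolding N'_def[abs_def] F_def
      by (intro bounded_linear_sub bi bounded_linear_compose[OF bP1])
    show "N (N' x) = x" for x
      using F(1)[of x] by (simp add: N_def N'_def Op')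
    show "N' (N x) = x" for x
      using Op[of x] by (simp add: N_def N'_def F(2))
    fix s x assume s: "a - d < s" "s < a"
    have s0: "0 \<le> s" using s \<open>d \<le> a\<close> by simp
    let ?w = "S (a - s) x"
    have "(\<Sum>k=1..m. if s \<in> {0..<\<tau> k} then c k *\<^sub>R T a (Op (S (\<tau> k - s) x)) else 0)
        = (\<Sum>k=1..m. if k \<in> K then 0 else c k *\<^sub>R T (\<tau> k) (Op ?w))"
    proof (rule sum.cong[OF refl])
      fix k assume k: "k \<in> {1..m}"
      show "(if s \<in> {0..<\<tau> k} then c k *\<^sub>R T a (Op (S (\<tau> k - s) x)) else 0) =
         (if k \<in> K then 0 else c k *\<^sub>R T (\<tau> k) (Op ?w))"
        using dk[of k] k s s0 by (auto simp: K_def)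
    qed
    also have "\<dots> = (\<Sum>k=1..m. c k *\<^sub>R T (\<tau> k) (Op ?w)) - (\<Sum>k=1..m. if k \<in> K then c k *\<^sub>R T (\<tau> k) (Op ?w) else 0)"
      by (simp add: sum_subtractf[symmetric] if_distrib[of "\<lambda>v. _ - v"] cong: if_cong)
    also have "(\<Sum>k=1..m. if k \<in> K then c k *\<^sub>R T (\<tau> k) (Op ?w) else 0) = P (Op ?w)"
      unfolding P_def using K by (subst sum.inter_restrict[symmetric]) (auto simp: Int_absorb1)
    finally have "G a s x = P1 (Op ?w) - P (Op ?w) + ?w"
      using s s0 by (simp add: green_def P1_def)
    also have "\<dots> = N ?w"
      using Op[of ?w] by (simp add: N_def algebra_simps)
    finally show "G a s x = N ?w" .
  qed
qed

text \<open>A profile g in a fixed direction x next to the right end makes L p computable: after N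
  is removed and \<sigma> = a - s substituted, pairing with y leaves a real integral of g(\<sigma>)
  (S(\<sigma>) x \<bullet> y). A constant g serves density, a truncation of S(\<sigma>) x \<bullet>
  x the bound on \<alpha>.\<close>

lemma terminal_right_end:
  fixes x y :: 'e and N' :: "'e \<Rightarrow> 'e" and g :: "real \<Rightarrow> real"
  assumes d: "0 < d" "d \<le> a" and N': "bounded_linear N'" and N: "\<And>x. N' (N x) = x"
    and G: "\<And>s x. a - d < s \<Longrightarrow> s < a \<Longrightarrow> G a s x = N (S (a - s) x)"
    and g: "g \<in> borel_measurable borel" and gi: "integrable lborel (\<lambda>\<sigma>. indicator {0<..<d} \<sigma> * (g \<sigma>)\<^sup>2)"
  defines "p \<equiv> \<lambda>s. (indicator {a - d<..<a} s * g (a - s)) *\<^sub>R x"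
  shows "p \<in> L2 a" "L2_norm a p = sqrt (\<integral>\<sigma>. indicator {0<..<d} \<sigma> * (g \<sigma>)\<^sup>2 \<partial>lborel) * norm x"
    "N' (L p) \<bullet> y = (\<integral>\<sigma>. indicator {0<..<d} \<sigma> * (g \<sigma> * (S \<sigma> x \<bullet> y)) \<partial>lborel)"
proof -
  note [measurable] = g
  let ?M = "lebesgue_on {0..a}"
  have refl: "integrable lborel (\<lambda>s. u (a - s)) \<longleftrightarrow> integrable lborel u"
    "(\<integral>s. u (a - s) \<partial>lborel) = (\<integral>\<sigma>. u \<sigma> \<partial>lborel)" for u :: "real \<Rightarrow> real"
    using lborel_integrable_real_affine_iff[of "-1" u a] lborel_integral_real_affine[of "-1" u a] by simp_all
  have to_M: "integrable ?M (\<lambda>s. indicator {a - d<..<a} s * u s) \<longleftrightarrow> integrable lborel (\<lambda>s. indicator {a - d<..<a} s * u s)"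
    "(\<integral>s. indicator {a - d<..<a} s * u s \<partial>?M) = (\<integral>s. indicator {a - d<..<a} s * u s \<partial>lborel)"
    if [measurable]: "(\<lambda>s. indicator {a - d<..<a} s * u s) \<in> borel_measurable borel" for u :: "real \<Rightarrow> real"
  proof -
    have eq: "indicator {0..a} s * (indicator {a - d<..<a} s * u s) = indicator {a - d<..<a} s * u s" for s
      using d by (auto simp: indicator_def)
    show "integrable ?M (\<lambda>s. indicator {a - d<..<a} s * u s) \<longleftrightarrow> integrable lborel (\<lambda>s. indicator {a - d<..<a} s * u s)"
      by (subst integrable_restrict_space) (simp_all add: eq integrable_completion)
    show "(\<integral>s. indicator {a - d<..<a} s * u s \<partial>?M) = (\<integral>s. indicator {a - d<..<a} s * u s \<partial>lborel)"
      by (subst integral_restrict_space) (simp_all add: eq integral_completion)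
  qed
  have ind: "indicator {a - d<..<a} s = (indicator {0<..<d} (a - s) :: real)" for s
    by (auto simp: indicator_def)
  have sq: "(indicator {a - d<..<a} s * g (a - s))\<^sup>2 = indicator {a - d<..<a} s * (g (a - s))\<^sup>2" for s
    by (auto simp: indicator_def)
  have m1: "(\<lambda>s. indicator {a - d<..<a} s * g (a - s)) \<in> borel_measurable ?M"
    by (rule measurable_restrict_space1) (simp add: measurable_completion)
  have i1: "integrable ?M (\<lambda>s. (indicator {a - d<..<a} s * g (a - s))\<^sup>2)"
    unfolding sq by (subst to_M) (use gi refl(1)[of "\<lambda>\<sigma>. indicator {0<..<d} \<sigma> * (g \<sigma>)\<^sup>2"] in \<open>simp_all add: ind\<close>)
  show p: "p \<in> L2 a"
    unfolding p_def by (rule L2_scaleR[OF m1 i1])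
  have "(\<integral>s. (indicator {a - d<..<a} s * g (a - s))\<^sup>2 \<partial>?M) = (\<integral>\<sigma>. indicator {0<..<d} \<sigma> * (g \<sigma>)\<^sup>2 \<partial>lborel)"
    unfolding sq by (subst to_M) (use refl(2)[of "\<lambda>\<sigma>. indicator {0<..<d} \<sigma> * (g \<sigma>)\<^sup>2"] in \<open>simp_all add: ind\<close>)
  then show "L2_norm a p = sqrt (\<integral>\<sigma>. indicator {0<..<d} \<sigma> * (g \<sigma>)\<^sup>2 \<partial>lborel) * norm x"
    unfolding p_def L2_scaleR(2)[OF m1 i1] by simp
  have "bounded_linear (\<lambda>v. N' v \<bullet> y)"
    using bounded_linear_compose[OF bounded_linear_inner_left N'] by simp
  from has_bochner_bounded_linear[OF this, of ?M "\<lambda>s. G a s (p s)" "L p"]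
  have "has_bochner_integral ?M (\<lambda>s. N' (G a s (p s)) \<bullet> y) (N' (L p) \<bullet> y)"
    using L p by (simp add: is_terminal_operator_def has_bochner_iff_has_bochner_integral)
  moreover have "N' (G a s (p s)) \<bullet> y = indicator {a - d<..<a} s * (g (a - s) * (S (a - s) x \<bullet> y))" for s
  proof (cases "s \<in> {a - d<..<a}")
    case True
    then have "bounded_linear (S (a - s))" by (intro S_linear) simp
    then have "S (a - s) (g (a - s) *\<^sub>R x) = g (a - s) *\<^sub>R S (a - s) x"
      by (simp add: linear_simps)
    then show ?thesis
      using True by (simp add: p_def G N)
  next
    case False
    then show ?thesis
      using N' a by (simp add: p_def G_zero linear_simps)
  qed
  ultimately have hb: "has_bochner_integral ?M (\<lambda>s. indicator {a - d<..<a} s * (g (a - s) * (S (a - s) x \<bullet> y))) (N' (L p) \<bullet> y)"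
    by simp
  let ?u = "\<lambda>\<sigma>. indicator {0<..<d} \<sigma> * (g \<sigma> * (S \<sigma> x \<bullet> y))"
  have "(\<lambda>\<sigma>. indicator {0<..<d} \<sigma> * (S \<sigma> x \<bullet> y)) \<in> borel_measurable borel"
    by (rule borel_measurable_indicator_cont[of "{0<..}"]) (auto intro!: continuous_intros S_strong)
  then have "(\<lambda>\<sigma>. g \<sigma> * (indicator {0<..<d} \<sigma> * (S \<sigma> x \<bullet> y))) \<in> borel_measurable borel"
    by measurable
  then have um[measurable]: "?u \<in> borel_measurable borel"
    by (simp add: mult.left_commute)
  have "(\<lambda>s. ?u (a - s)) \<in> borel_measurable borel"
    by (rule measurable_compose[OF _ um]) measurable
  then have m2: "(\<lambda>s. indicator {a - d<..<a} s * (g (a - s) * (S (a - s) x \<bullet> y))) \<in> borel_measurable borel"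
    by (simp add: ind)
  show "N' (L p) \<bullet> y = (\<integral>\<sigma>. ?u \<sigma> \<partial>lborel)"
    using hb to_M(2)[OF m2] refl(2)[of ?u] by (simp add: has_bochner_integral_iff ind)
qed

text \<open>The target is pulled back to x = N' z, and p is the constant r x on the last stretch of
  length t. The factor r = \<alpha> \<Gamma>(\<alpha>) t^(-\<alpha>) normalises the primitive of
  S(\<sigma>) x, which by \<open>S_asymp\<close> then tends to x.\<close>

lemma terminal_operator_dense:
  assumes e: "e > 0"
  obtains p where "p \<in> L2 a" "norm (L p - z) < e"
proof -
  obtain d N N' where d: "0 < d" "d \<le> a" and N: "bounded_linear N" and N': "bounded_linear N'"
    and NN: "\<And>x. N (N' x) = x" and N'N: "\<And>x. N' (N x) = x"
    and G: "\<And>s x. a - d < s \<Longrightarrow> s < a \<Longrightarrow> G a s x = N (S (a - s) x)"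
    using green_right_end by blast
  obtain B where B: "B > 0" "\<And>v. norm (N v) \<le> norm v * B"
    using bounded_linear.pos_bounded[OF N] by blast
  define x where "x = N' z"
  define k where "k = \<alpha> * Gamma \<alpha>"
  have k: "k > 0" using \<alpha> Gamma_real_pos[OF \<alpha>] by (simp add: k_def)
  \<comment> \<open>N' (L p) will be within k e' of x, and N enlarges this by at most B; the factor
    2 makes the final inequality strict.\<close>
  define e' where "e' = e / (2 * B * k)"
  have e': "e' > 0" using e B k by (simp add: e'_def)
  obtain d' where d': "d' > 0" "\<And>t y. 0 < t \<Longrightarrow> t \<le> d' \<Longrightarrow>
       \<bar>(\<integral>s. indicator {0<..<t} s * (S s x \<bullet> y) \<partial>lborel) - t powr \<alpha> * (x \<bullet> y) / k\<bar> \<le> t powr \<alpha> * e' * norm y"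
    using S_asymp[OF e', of x] unfolding k_def by blast
  define t where "t = min d d'"
  have t: "0 < t" "t \<le> d" "t \<le> d'" "t \<le> a" using d d' by (auto simp: t_def)
  define r where "r = k * t powr (- \<alpha>)"
  define p where "p = (\<lambda>s. (indicator {a - t<..<a} s * 1) *\<^sub>R (r *\<^sub>R x))"
  have "G a s x = N (S (a - s) x)" if "a - t < s" "s < a" for s x
    using G that t by simp
  note tr = terminal_right_end[OF t(1,4) N' N'N this, of "\<lambda>_. 1" "r *\<^sub>R x", folded p_def]
  have ii: "integrable lborel (\<lambda>\<sigma>. indicator {0<..<t} \<sigma> * 1\<^sup>2 :: real)"
    using t by (simp add: integrable_real_indicator)
  have "norm (N' (L p) - x) \<le> k * e'"
  proof (rule norm_le_inner_bound)
    fix y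
    have sc: "indicator {0<..<t} \<sigma> * (1 * (S \<sigma> (r *\<^sub>R x) \<bullet> y)) = r * (indicator {0<..<t} \<sigma> * (S \<sigma> x \<bullet> y))" for \<sigma>
    proof (cases "\<sigma> > 0")
      case True
      from S_linear[OF this] show ?thesis by (simp add: linear_simps)
    qed simp
    have "N' (L p) \<bullet> y = (\<integral>\<sigma>. indicator {0<..<t} \<sigma> * (1 * (S \<sigma> (r *\<^sub>R x) \<bullet> y)) \<partial>lborel)"
      by (rule tr(3)) (use ii in auto)
    also have "\<dots> = r * (\<integral>\<sigma>. indicator {0<..<t} \<sigma> * (S \<sigma> x \<bullet> y) \<partial>lborel)"
      unfolding sc by simp
    finally have "(N' (L p) - x) \<bullet> y = r * ((\<integral>\<sigma>. indicator {0<..<t} \<sigma> * (S \<sigma> x \<bullet> y) \<partial>lborel) - t powr \<alpha> * (x \<bullet> y) / k)"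
      using k t by (simp add: inner_diff_left r_def right_diff_distrib powr_minus field_simps)
    then have "\<bar>(N' (L p) - x) \<bullet> y\<bar> \<le> r * (t powr \<alpha> * e' * norm y)"
      using mult_left_mono[OF d'(2)[OF t(1,3), of y], of r] k by (simp add: abs_mult r_def)
    also have "\<dots> = k * e' * norm y"
      using t by (simp add: r_def powr_minus)
    finally show "\<bar>(N' (L p) - x) \<bullet> y\<bar> \<le> k * e' * norm y" .
  qed (use k e' in simp)
  then have "norm (N' (L p) - x) * B \<le> (k * e') * B"
    using B by (intro mult_right_mono) auto
  moreover have "N (N' (L p) - x) = L p - z"
    using N by (simp add: linear_simps NN x_def)
  ultimately have "norm (L p - z) \<le> (k * e') * B"
    using B(2)[of "N' (L p) - x"] by simp
  also have "\<dots> < e"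
    using e B k by (simp add: e'_def)
  finally show ?thesis
    using that tr(1) ii by auto
qed

text \<open>Boundedness of \<open>L\<close> on \<open>L\<^sup>2\<close> forces \<open>\<phi>(\<sigma>) = S(\<sigma>)x \<bullet> x\<close> to be square integrable near \<open>0\<close>, so that
  \<open>\<integral>\<^sub>0\<^sup>t \<phi> = o(t\<^sup>1\<^sup>/\<^sup>2)\<close>, whereas it is of the order of \<open>t\<^sup>\<alpha>\<close>.\<close>

lemma alpha_gt_half:
  fixes x :: 'e
  assumes x: "x \<noteq> 0"
  shows "\<alpha> > 1 / 2"
proof (rule ccontr)
  assume "\<not> \<alpha> > 1 / 2"
  then have \<alpha>2: "\<alpha> \<le> 1 / 2" by simp
  obtain d N N' where d: "0 < d" "d \<le> a" and N': "bounded_linear N'" and N'N: "\<And>x. N' (N x) = x"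
    and G: "\<And>s x. a - d < s \<Longrightarrow> s < a \<Longrightarrow> G a s x = N (S (a - s) x)"
    using green_right_end by metis
  obtain B where B: "B > 0" "\<And>v. norm (N' v) \<le> norm v * B"
    using bounded_linear.pos_bounded[OF N'] by blast
  obtain CL where CL: "\<And>p. p \<in> L2 a \<Longrightarrow> norm (L p) \<le> CL * L2_norm a p"
    using L unfolding is_terminal_operator_def by blast
  define \<phi> where "\<phi> \<sigma> = S \<sigma> x \<bullet> x" for \<sigma>
  have c\<phi>: "continuous_on {0<..} \<phi>"
    unfolding \<phi>_def by (intro continuous_intros S_strong)
  have m\<phi>: "(\<lambda>\<sigma>. indicator A \<sigma> * \<phi> \<sigma>) \<in> borel_measurable borel" if "A \<subseteq> {0<..}" "A \<in> sets borel" for A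
    by (rule borel_measurable_indicator_cont[OF c\<phi> that])
  \<comment> \<open>\<phi> is cut off below 1 / (n + 1): away from 0 it is square integrable by
    continuity, near 0 this is what has to be shown.\<close>
  define g where "g n \<sigma> = indicator {1 / Suc n..} \<sigma> * \<phi> \<sigma>" for n and \<sigma> :: real
  define Q where "Q = (B * \<bar>CL\<bar> * norm x * norm x)"
  have gm[measurable]: "g n \<in> borel_measurable borel" for n
    unfolding g_def[abs_def] by (rule m\<phi>) (auto intro: less_le_trans[of 0 "1 / Suc n" for n])
  have gi: "integrable lborel (\<lambda>\<sigma>. indicator {0<..<d} \<sigma> * (g n \<sigma>)\<^sup>2)" for n
  proof -
    have "continuous_on {1 / Suc n..d} (\<lambda>\<sigma>. (\<phi> \<sigma>)\<^sup>2)"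
      by (intro continuous_intros continuous_on_subset[OF c\<phi>]) (auto intro: less_le_trans[of 0 "1 / Suc n"])
    from borel_integrable_compact[OF compact_Icc this]
    have "integrable lborel (\<lambda>\<sigma>. indicator {1 / Suc n..d} \<sigma> *\<^sub>R (\<phi> \<sigma>)\<^sup>2)" .
    then show ?thesis
    proof (rule Bochner_Integration.integrable_bound)
      show "AE \<sigma> in lborel. norm (indicator {0<..<d} \<sigma> * (g n \<sigma>)\<^sup>2) \<le> norm (indicator {1 / Suc n..d} \<sigma> *\<^sub>R (\<phi> \<sigma>)\<^sup>2)"
        by (auto simp: g_def indicator_def)
    qed measurable
  qed
  \<comment> \<open>Duality: for p built from g n, pairing N' (L p) with x returns the integral J
    itself, while boundedness of L gives at most Q * sqrt J. The constant Q does not depend on the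
    cutoff.\<close>
  have J: "(\<integral>\<sigma>. indicator {0<..<d} \<sigma> * (g n \<sigma>)\<^sup>2 \<partial>lborel) \<le> Q\<^sup>2" for n
  proof -
    define p where "p = (\<lambda>s. (indicator {a - d<..<a} s * g n (a - s)) *\<^sub>R x)"
    define J where "J = (\<integral>\<sigma>. indicator {0<..<d} \<sigma> * (g n \<sigma>)\<^sup>2 \<partial>lborel)"
    have J0: "J \<ge> 0" unfolding J_def by (intro Bochner_Integration.integral_nonneg) simp
    note tr = terminal_right_end[OF d N' N'N _ gm gi]
    have tr1: "p \<in> L2 a" and tr2: "L2_norm a p = sqrt J * norm x"
      unfolding p_def J_def by (rule tr, erule (1) G)+
    have "N' (L p) \<bullet> x = (\<integral>\<sigma>. indicator {0<..<d} \<sigma> * (g n \<sigma> * (S \<sigma> x \<bullet> x)) \<partial>lborel)"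
      unfolding p_def by (rule tr, erule (1) G)
    also have "\<dots> = J"
      unfolding J_def
      by (intro Bochner_Integration.integral_cong refl) (auto simp: g_def \<phi>_def indicator_def power2_eq_square)
    finally have "J = N' (L p) \<bullet> x" by simp
    also have "\<dots> \<le> norm (N' (L p)) * norm x"
      by (rule norm_cauchy_schwarz)
    also have "\<dots> \<le> (\<bar>CL\<bar> * L2_norm a p * B) * norm x"
    proof (intro mult_right_mono)
      have "norm (N' (L p)) \<le> norm (L p) * B" by (rule B)
      also have "\<dots> \<le> (\<bar>CL\<bar> * L2_norm a p) * B"
        using CL[OF tr1] B mult_right_mono[OF abs_ge_self[of CL] L2_norm_nonneg[of a p]]
        by (intro mult_right_mono) auto
      finally show "norm (N' (L p)) \<le> \<bar>CL\<bar> * L2_norm a p * B" .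
    qed simp
    also have "\<dots> = Q * sqrt J"
      by (simp add: tr2 Q_def mult_ac)
    finally have le: "sqrt J * sqrt J \<le> Q * sqrt J"
      using J0 by simp
    have "sqrt J \<le> Q"
    proof (cases "J = 0")
      case False
      then have "sqrt J > 0" using J0 by simp
      then show ?thesis using le by (rule mult_right_le_imp_le[rotated])
    qed (use B in \<open>simp add: Q_def\<close>)
    then have "(sqrt J)\<^sup>2 \<le> Q\<^sup>2"
      using J0 by (intro power_mono) auto
    then show ?thesis
      using J0 by (simp add: J_def)
  qed
  have i2: "integrable lborel (\<lambda>\<sigma>. indicator {0<..<d} \<sigma> * (\<phi> \<sigma>)\<^sup>2)"
  proof (rule integrableI_bounded)
    have "(\<lambda>\<sigma>. (indicator {0<..<d} \<sigma> * \<phi> \<sigma>)\<^sup>2) \<in> borel_measurable borel"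
      by (intro borel_measurable_power m\<phi>) (auto simp: subset_eq)
    moreover have "(indicator {0<..<d} \<sigma> * \<phi> \<sigma>)\<^sup>2 = indicator {0<..<d} \<sigma> * (\<phi> \<sigma>)\<^sup>2" for \<sigma>
      by (auto simp: indicator_def)
    ultimately show "(\<lambda>\<sigma>. indicator {0<..<d} \<sigma> * (\<phi> \<sigma>)\<^sup>2) \<in> borel_measurable lborel"
      by simp
    let ?f = "\<lambda>n \<sigma>. ennreal (indicator {0<..<d} \<sigma> * (g n \<sigma>)\<^sup>2)"
    have inc: "incseq ?f"
    proof (intro incseq_SucI le_funI ennreal_leI)
      fix n \<sigma>
      have "1 / real (Suc (Suc n)) \<le> 1 / real (Suc n)" by (simp add: field_simps)
      then show "indicator {0<..<d} \<sigma> * (g n \<sigma>)\<^sup>2 \<le> indicator {0<..<d} \<sigma> * (g (Suc n) \<sigma>)\<^sup>2"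
        by (auto simp: g_def indicator_def)
    qed
    have "(\<integral>\<^sup>+\<sigma>. ennreal (norm (indicator {0<..<d} \<sigma> * (\<phi> \<sigma>)\<^sup>2)) \<partial>lborel) \<le> (\<integral>\<^sup>+\<sigma>. (SUP n. ?f n \<sigma>) \<partial>lborel)"
    proof (rule nn_integral_mono)
      fix \<sigma> :: real
      show "ennreal (norm (indicator {0<..<d} \<sigma> * (\<phi> \<sigma>)\<^sup>2)) \<le> (SUP n. ?f n \<sigma>)"
      proof (cases "\<sigma> \<in> {0<..<d}")
        case True
        then obtain n where "inverse (real (Suc n)) < \<sigma>"
          using reals_Archimedean[of \<sigma>] by auto
        then have "ennreal (norm (indicator {0<..<d} \<sigma> * (\<phi> \<sigma>)\<^sup>2)) = ?f n \<sigma>"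
          using True by (simp add: g_def inverse_eq_divide indicator_def)
        also have "\<dots> \<le> (SUP n. ?f n \<sigma>)"
          by (rule SUP_upper) simp
        finally show ?thesis .
      qed simp
    qed
    also have "\<dots> = (SUP n. \<integral>\<^sup>+\<sigma>. ?f n \<sigma> \<partial>lborel)"
      by (rule nn_integral_monotone_convergence_SUP[OF inc]) measurable
    also have "\<dots> \<le> ennreal (Q\<^sup>2)"
    proof (rule SUP_least)
      fix n
      show "(\<integral>\<^sup>+\<sigma>. ?f n \<sigma> \<partial>lborel) \<le> ennreal (Q\<^sup>2)"
        using J[of n] by (subst nn_integral_eq_integral[OF gi]) (auto intro: ennreal_leI)
    qed
    also have "\<dots> < \<infinity>" by simp
    finally show "(\<integral>\<^sup>+\<sigma>. ennreal (norm (indicator {0<..<d} \<sigma> * (\<phi> \<sigma>)\<^sup>2)) \<partial>lborel) < \<infinity>" .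
  qed
  \<comment> \<open>The integral of \<phi>^2 over (0,t) when t \<le> d; as the primitive of an
    integrable function it tends to 0 with t.\<close>
  define F where "F t = (\<integral>\<sigma>. indicator {0<..<t} \<sigma> * (indicator {0<..<d} \<sigma> * (\<phi> \<sigma>)\<^sup>2) \<partial>lborel)" for t
  have i3: "integrable lborel (\<lambda>\<sigma>. indicator {0<..<t} \<sigma> * (indicator {0<..<d} \<sigma> * (\<phi> \<sigma>)\<^sup>2))" for t
    using integrable_mult_indicator[OF _ i2, of "{0<..<t}"] by simp
  have cF: "continuous_on {0..} F"
    unfolding F_def by (rule continuous_on_primitive[OF i3])
  define k where "k = \<alpha> * Gamma \<alpha>"
  have k: "k > 0" using \<alpha> Gamma_real_pos[OF \<alpha>] by (simp add: k_def)
  \<comment> \<open>Half of the leading coefficient: the primitive of \<phi> behaves like 2 q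
    t^\<alpha>, hence is at least q t^\<alpha> near 0.\<close>
  define q where "q = (norm x)\<^sup>2 / (2 * k)"
  have q: "q > 0" using x k by (simp add: q_def)
  have "norm x / (2 * k) > 0" using x k by simp
  then obtain d1 where d1: "d1 > 0" "d1 \<le> a" "\<And>t y. 0 < t \<Longrightarrow> t \<le> d1 \<Longrightarrow>
       \<bar>(\<integral>s. indicator {0<..<t} s * (S s x \<bullet> y) \<partial>lborel) - t powr \<alpha> * (x \<bullet> y) / k\<bar> \<le> t powr \<alpha> * (norm x / (2 * k)) * norm y"
    using S_asymp[of "norm x / (2 * k)" x] unfolding k_def by blast
  have "F 0 = 0" by (simp add: F_def)
  then obtain d2 where d2: "d2 > 0" "\<And>t. 0 \<le> t \<Longrightarrow> t < d2 \<Longrightarrow> \<bar>F t\<bar> < q\<^sup>2"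
    using cF[unfolded continuous_on_iff, rule_format, of 0 "q\<^sup>2"] q by (auto simp: dist_real_def)
  define t where "t = Min {d, d1, d2 / 2, 1}"
  have t: "0 < t" "t \<le> d" "t \<le> d1" "t < d2" "t \<le> 1"
    using d d1(1) d2(1) by (auto simp: t_def)
  define I where "I = (\<integral>s. indicator {0<..<t} s * \<phi> s \<partial>lborel)"
  have "\<bar>I - t powr \<alpha> * (norm x)\<^sup>2 / k\<bar> \<le> t powr \<alpha> * q"
    using d1(3)[OF t(1,3), of x] by (simp add: I_def \<phi>_def q_def dot_square_norm power2_eq_square mult.assoc)
  moreover have e: "t powr \<alpha> * (norm x)\<^sup>2 / k = 2 * (t powr \<alpha> * q)"
    using k by (simp add: q_def)
  ultimately have "t powr \<alpha> * q \<le> I"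
    unfolding abs_le_iff using e by linarith
  also have "I \<le> sqrt t * sqrt (F t)"
  proof -
    let ?f = "indicator {0<..<t} :: real \<Rightarrow> real"
    let ?g = "\<lambda>s. indicator {0<..<t} s * \<phi> s"
    have g2: "(?g s)\<^sup>2 = indicator {0<..<t} s * (indicator {0<..<d} s * (\<phi> s)\<^sup>2)" for s
      using t by (auto simp: indicator_def)
    have f2: "(?f s)\<^sup>2 = ?f s" for s by (simp add: indicator_def)
    have fi: "integrable lborel ?f" using t by (simp add: integrable_real_indicator)
    have gm: "?g \<in> borel_measurable lborel"
      using m\<phi>[of "{0<..<t}"] by (simp add: subset_eq)
    have "(\<integral>s. \<bar>?f s * ?g s\<bar> \<partial>lborel) \<le> sqrt (\<integral>s. (?f s)\<^sup>2 \<partial>lborel) * sqrt (\<integral>s. (?g s)\<^sup>2 \<partial>lborel)"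
      by (rule Cauchy_Schwarz_integral(2)[OF _ gm]) (unfold f2 g2, use fi i3 in auto)
    also have "\<dots> = sqrt t * sqrt (F t)"
      unfolding f2 g2 F_def using t by simp
    finally have "(\<integral>s. \<bar>?f s * ?g s\<bar> \<partial>lborel) \<le> sqrt t * sqrt (F t)" .
    moreover have "I \<le> (\<integral>s. \<bar>?g s\<bar> \<partial>lborel)"
      unfolding I_def by (rule order_trans[OF abs_ge_self integral_abs_bound])
    moreover have "?f s * ?g s = ?g s" for s by (simp add: indicator_def)
    ultimately show ?thesis by simp
  qed
  also have "sqrt (F t) < q"
    using d2(2)[of t] t q by (intro real_less_lsqrt) auto
  then have "sqrt t * sqrt (F t) < sqrt t * q"
    using t by simp
  \<comment> \<open>Here t \<le> 1 and \<alpha> \<le> 1/2 enter; the chain ends with t^\<alpha> q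
    being smaller than itself.\<close>
  also have "sqrt t \<le> t powr \<alpha>"
    using powr_mono'[of \<alpha> "1 / 2" t] \<alpha>2 t by (simp add: powr_half_sqrt)
  then have "sqrt t * q \<le> t powr \<alpha> * q"
    using q by (intro mult_right_mono) auto
  finally show False by simp
qed

end

section \<open>Compactness of the terminal operator and equicontinuity of trajectories\<close>

context nonlocal_problem
begin

text \<open>Each S(\<sigma>) maps the unit ball to a relatively compact set, and norm continuity
  lets a net for one \<sigma> serve a neighbourhood of it; compactness of [\<delta>, a] leaves
  finitely many nets to unite.\<close>

lemma S_net:
  assumes \<delta>: "0 < \<delta>" and \<eta>: "0 < \<eta>"
  obtains Z where "finite Z" "\<And>\<sigma> e. \<sigma> \<in> {\<delta>..a} \<Longrightarrow> norm e \<le> 1 \<Longrightarrow> \<exists>z\<in>Z. norm (S \<sigma> e - z) \<le> \<eta>"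
proof -
  have "\<exists>d Z. 0 < d \<and> finite Z \<and> (\<forall>\<sigma>\<in>{\<delta>..a}. \<bar>\<sigma> - \<sigma>0\<bar> < d \<longrightarrow>
      (\<forall>e. norm e \<le> 1 \<longrightarrow> (\<exists>z\<in>Z. norm (S \<sigma> e - z) \<le> \<eta>)))" if s0: "\<sigma>0 \<in> {\<delta>..a}" for \<sigma>0
  proof -
    have s0': "\<sigma>0 \<in> {0<..a}" using s0 \<delta> by auto
    obtain d where d: "d > 0" "\<And>\<sigma>. \<sigma> \<in> {0<..a} \<Longrightarrow> dist \<sigma> \<sigma>0 < d \<Longrightarrow> dist (Blinfun (S \<sigma>)) (Blinfun (S \<sigma>0)) < \<eta> / 2"
      using S_cont[unfolded continuous_on_iff] s0' \<eta> by (metis half_gt_zero)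
    have "compact (closure (S \<sigma>0 ` cball 0 1))"
      using s0' by (intro S_compact) auto
    then obtain Z where Z: "finite Z" "closure (S \<sigma>0 ` cball 0 1) \<subseteq> (\<Union>z\<in>Z. ball z (\<eta> / 2))"
      by (rule compactE_image[of _ "closure (S \<sigma>0 ` cball 0 1)" "\<lambda>z. ball z (\<eta> / 2)"]) (use \<eta> in auto)
    have "\<exists>z\<in>Z. norm (S \<sigma> e - z) \<le> \<eta>" if s: "\<sigma> \<in> {\<delta>..a}" "\<bar>\<sigma> - \<sigma>0\<bar> < d" and e: "norm e \<le> 1" for \<sigma> e
    proof -
      have "S \<sigma>0 e \<in> closure (S \<sigma>0 ` cball 0 1)"
        using e closure_subset by fastforce
      then obtain z where z: "z \<in> Z" "norm (S \<sigma>0 e - z) < \<eta> / 2"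
        using Z(2) by (auto simp: dist_norm norm_minus_commute)
      have s': "\<sigma> \<in> {0<..a}" using s \<delta> by auto
      have "norm (S \<sigma> e - S \<sigma>0 e) = norm (blinfun_apply (Blinfun (S \<sigma>) - Blinfun (S \<sigma>0)) e)"
        using s' s0' by (simp add: blinfun.diff_left bounded_linear_Blinfun_apply[OF S_linear])
      also have "\<dots> \<le> norm (Blinfun (S \<sigma>) - Blinfun (S \<sigma>0)) * norm e"
        by (rule norm_blinfun)
      also have "\<dots> \<le> (\<eta> / 2) * 1"
        using d(2)[OF s'] s(2) e \<eta> by (intro mult_mono) (auto simp: dist_norm)
      finally have "norm (S \<sigma> e - z) \<le> \<eta>"
        using z(2) norm_triangle_ineq[of "S \<sigma> e - S \<sigma>0 e" "S \<sigma>0 e - z"] by simp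
      then show ?thesis using z(1) by blast
    qed
    then show ?thesis using d(1) Z(1) by blast
  qed
  then obtain d Z where dZ: "\<And>\<sigma>0. \<sigma>0 \<in> {\<delta>..a} \<Longrightarrow> 0 < d \<sigma>0 \<and> finite (Z \<sigma>0) \<and> (\<forall>\<sigma>\<in>{\<delta>..a}. \<bar>\<sigma> - \<sigma>0\<bar> < d \<sigma>0 \<longrightarrow>
      (\<forall>e. norm e \<le> 1 \<longrightarrow> (\<exists>z\<in>Z \<sigma>0. norm (S \<sigma> e - z) \<le> \<eta>)))"
    by metis
  obtain D where D: "D \<subseteq> {\<delta>..a}" "finite D" "{\<delta>..a} \<subseteq> (\<Union>\<sigma>\<in>D. ball \<sigma> (d \<sigma>))"
    by (rule compactE_image[OF compact_Icc, of "{\<delta>..a}" "\<lambda>\<sigma>. ball \<sigma> (d \<sigma>)"]) (use dZ in auto)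
  show ?thesis
  proof
    show "finite (\<Union>\<sigma>\<in>D. Z \<sigma>)" using D dZ by auto
    fix \<sigma> e assume s: "\<sigma> \<in> {\<delta>..a}" and e: "norm (e::'e) \<le> 1"
    then obtain \<sigma>0 where s0: "\<sigma>0 \<in> D" "\<bar>\<sigma> - \<sigma>0\<bar> < d \<sigma>0"
      using D(3) by (auto simp: dist_real_def abs_minus_commute)
    then have "\<sigma>0 \<in> {\<delta>..a}" using D(1) by blast
    from dZ[OF this] s s0(2) e have "\<exists>z\<in>Z \<sigma>0. norm (S \<sigma> e - z) \<le> \<eta>" by blast
    then show "\<exists>z\<in>\<Union>\<sigma>\<in>D. Z \<sigma>. norm (S \<sigma> e - z) \<le> \<eta>" using s0(1) by blast
  qed
qed

text \<open>V is at most \<eta>' on the net, hence at most \<eta>' + B \<eta> on the images of the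
  unit ball for \<sigma> \<ge> \<delta>; for \<sigma> < \<delta> the growth bound of S is used. V
  will be the defect of a projection, also composed with T(a) Op, or the difference (T(t) - T(a))
  Op.\<close>

lemma net_bound:
  assumes V: "bounded_linear V" and B: "\<And>w. norm (V w) \<le> B * norm w" "B \<ge> 0"
    and net: "\<And>\<sigma> e. \<sigma> \<in> {\<delta>..a} \<Longrightarrow> norm e \<le> 1 \<Longrightarrow> \<exists>z\<in>Z. norm (S \<sigma> e - z) \<le> \<eta>"
    and z: "\<And>z. z \<in> Z \<Longrightarrow> norm (V z) \<le> \<eta>'" and \<delta>: "0 < \<delta>" and \<eta>: "0 \<le> \<eta>" "0 \<le> \<eta>'" and \<sigma>: "0 < \<sigma>" "\<sigma> \<le> a"
  shows "norm (V (S \<sigma> e)) \<le> ((\<eta>' + B * \<eta>) + B * C * (indicator {0<..<\<delta>} \<sigma> * \<sigma> powr (\<alpha> - 1))) * norm e"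
proof (cases "\<sigma> < \<delta>")
  case True
  have "norm (V (S \<sigma> e)) \<le> B * (C * \<sigma> powr (\<alpha> - 1) * norm e)"
    by (rule order_trans[OF B(1)]) (intro mult_left_mono S_bound \<sigma> B)
  also have "\<dots> = (0 + B * C * (indicator {0<..<\<delta>} \<sigma> * \<sigma> powr (\<alpha> - 1))) * norm e"
    using True \<sigma> by (simp add: mult_ac)
  also have "\<dots> \<le> ((\<eta>' + B * \<eta>) + B * C * (indicator {0<..<\<delta>} \<sigma> * \<sigma> powr (\<alpha> - 1))) * norm e"
    using \<eta> B by (intro mult_right_mono add_right_mono) auto
  finally show ?thesis .
next
  case False
  interpret V: bounded_linear V by fact
  interpret S: bounded_linear "S \<sigma>" by (rule S_linear) fact
  have unit: "norm (V (S \<sigma> u)) \<le> \<eta>' + B * \<eta>" if u: "norm u \<le> 1" for u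
  proof -
    obtain w where w: "w \<in> Z" "norm (S \<sigma> u - w) \<le> \<eta>"
      using net[of \<sigma> u] u \<sigma> False by auto
    have "V (S \<sigma> u) = V w + V (S \<sigma> u - w)" by (simp add: V.diff)
    then have "norm (V (S \<sigma> u)) \<le> norm (V w) + norm (V (S \<sigma> u - w))"
      by (metis norm_triangle_ineq)
    also have "norm (V (S \<sigma> u - w)) \<le> B * \<eta>"
      using B(2) w(2) by (intro order_trans[OF B(1)] mult_left_mono)
    finally show ?thesis using z[OF w(1)] by simp
  qed
  have "norm (V (S \<sigma> e)) \<le> (\<eta>' + B * \<eta>) * norm e"
  proof (cases "e = 0")
    case False
    have "norm (V (S \<sigma> (e /\<^sub>R norm e))) \<le> \<eta>' + B * \<eta>"
      using False by (intro unit) simp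
    then show ?thesis
      using False by (simp add: S.scaleR V.scaleR divide_simps mult.commute)
  qed (simp add: S.zero V.zero)
  then show ?thesis using False by simp
qed

text \<open>In front of the edges each |c k| is enlarged to the full sum, so that all edges share
  one coefficient, as \<open>L2_edge_integral\<close> expects.\<close>

lemma node_sum_bound:
  assumes V: "\<And>\<sigma>. 0 < \<sigma> \<Longrightarrow> \<sigma> \<le> a \<Longrightarrow> norm (V (S \<sigma> e)) \<le> (A + B * (indicator {0<..<\<delta>} \<sigma> * \<sigma> powr (\<alpha> - 1))) * norm e"
    and A: "A \<ge> 0" and B: "B \<ge> 0" and s: "s \<ge> 0"
  shows "norm (\<Sum>k=1..m. if s \<in> {0..<\<tau> k} then c k *\<^sub>R V (S (\<tau> k - s) e) else 0)
    \<le> norm e * ((\<Sum>k=1..m. \<bar>c k\<bar>) * A + (\<Sum>k=1..m. \<bar>c k\<bar>) * B * (\<Sum>k=1..m. edge \<alpha> \<delta> (\<tau> k) s))"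
proof -
  let ?c = "\<Sum>k=1..m. \<bar>c k\<bar>"
  have "norm (\<Sum>k=1..m. if s \<in> {0..<\<tau> k} then c k *\<^sub>R V (S (\<tau> k - s) e) else 0)
     \<le> (\<Sum>k=1..m. \<bar>c k\<bar> * A * norm e + ?c * B * norm e * edge \<alpha> \<delta> (\<tau> k) s)"
  proof (rule order_trans[OF norm_sum sum_mono])
    fix k assume k: "k \<in> {1..m}"
    have ck: "\<bar>c k\<bar> \<le> ?c"
      using k by (intro member_le_sum) auto
    have nn: "0 \<le> \<bar>c k\<bar> * A * norm e" "0 \<le> ?c * B * norm e * edge \<alpha> \<delta> (\<tau> k) s"
      using A B by (auto simp: edge_nonneg sum_nonneg)
    show "norm (if s \<in> {0..<\<tau> k} then c k *\<^sub>R V (S (\<tau> k - s) e) else 0) \<le>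
        \<bar>c k\<bar> * A * norm e + ?c * B * norm e * edge \<alpha> \<delta> (\<tau> k) s"
    proof (cases "s \<in> {0..<\<tau> k}")
      case True
      have "indicator {0<..<\<delta>} (\<tau> k - s) * (\<tau> k - s) powr (\<alpha> - 1) = edge \<alpha> \<delta> (\<tau> k) s"
        using True by (auto simp: edge_def indicator_def)
      then have "norm (V (S (\<tau> k - s) e)) \<le> (A + B * edge \<alpha> \<delta> (\<tau> k) s) * norm e"
        using V[of "\<tau> k - s"] True \<tau>[OF k] by simp
      then have "\<bar>c k\<bar> * norm (V (S (\<tau> k - s) e)) \<le> \<bar>c k\<bar> * ((A + B * edge \<alpha> \<delta> (\<tau> k) s) * norm e)"
        by (rule mult_left_mono) simp
      also have "\<dots> = \<bar>c k\<bar> * A * norm e + \<bar>c k\<bar> * (B * norm e * edge \<alpha> \<delta> (\<tau> k) s)"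
        by (simp add: algebra_simps)
      also have "\<dots> \<le> \<bar>c k\<bar> * A * norm e + ?c * (B * norm e * edge \<alpha> \<delta> (\<tau> k) s)"
        using ck B by (intro add_left_mono mult_right_mono) (auto simp: edge_nonneg)
      finally show ?thesis using True by (simp add: mult.assoc)
    next
      case False
      then show ?thesis
        unfolding if_not_P[OF False] norm_zero using nn by (intro add_nonneg_nonneg)
    qed
  qed
  also have "\<dots> = norm e * (?c * A + ?c * B * (\<Sum>k=1..m. edge \<alpha> \<delta> (\<tau> k) s))"
    by (simp add: sum.distrib sum_distrib_left[symmetric] sum_distrib_right[symmetric] algebra_simps)
  finally show ?thesis .
qed

lemma edge_norm_small:
  assumes \<alpha>2: "\<alpha> > 1 / 2" and e: "e > 0"
  obtains \<delta> where "\<delta> > 0" "edge_norm \<alpha> \<delta> * q < e"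
proof -
  have "((\<lambda>\<delta>. edge_norm \<alpha> \<delta> * q) \<longlongrightarrow> 0 * q) (at_right 0)"
    by (intro tendsto_intros edge_norm_tendsto \<alpha>2)
  then have "\<forall>\<^sub>F \<delta> in at_right 0. edge_norm \<alpha> \<delta> * q < e"
    using e by (intro order_tendstoD(2)) auto
  then obtain b where "b > 0" "\<And>y. 0 < y \<Longrightarrow> y < b \<Longrightarrow> edge_norm \<alpha> y * q < e"
    unfolding eventually_at_right_field by blast
  then show ?thesis
    using that[of "b / 2"] by simp
qed

text \<open>Let p project onto the span of a net for S and of its images under T(a) Op. The defect V
  = I - p makes V G(a,s) small except at the edges, so V L h is small uniformly on the ball, while p
  L h stays in a compact set.\<close>

lemma terminal_totally_bounded:
  assumes \<alpha>2: "\<alpha> > 1 / 2" and R: "R \<ge> 0" and \<epsilon>: "\<epsilon> > 0"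
  obtains F where "finite F" "F \<subseteq> {h \<in> L2 a. L2_norm a h \<le> R}"
    "\<And>h. h \<in> L2 a \<Longrightarrow> L2_norm a h \<le> R \<Longrightarrow> \<exists>q\<in>F. norm (L h - L q) < \<epsilon>"
proof -
  let ?M = "lebesgue_on {0..a}"
  let ?c = "\<Sum>k=1..m. \<bar>c k\<bar>"
  have c0: "?c \<ge> 0" by (simp add: sum_nonneg)
  have bTO: "bounded_linear (\<lambda>w. T a (Op w))"
    using a by (intro bounded_linear_compose[OF T_linear Op_linear]) simp
  then obtain B1 where B1: "B1 > 0" "\<And>w. norm (T a (Op w)) \<le> norm w * B1"
    using bounded_linear.pos_bounded by blast
  \<comment> \<open>The summand 1 accounts for the term S(a - s), the other one for the
    nodes.\<close>
  define KA where "KA = ?c * B1 + 1"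
  have KA: "KA > 0" using c0 B1 by (simp add: KA_def add_nonneg_pos)
  obtain \<delta> where \<delta>: "\<delta> > 0" "edge_norm \<alpha> \<delta> * (R * (C * KA) * (m + 1)) < \<epsilon> / 8"
    using edge_norm_small[OF \<alpha>2, of "\<epsilon> / 8"] \<epsilon> by auto
  \<comment> \<open>Chosen so that the part away from the edges contributes at most \<epsilon> / 8,
    next to \<epsilon> / 8 from the edges; the added 1 keeps the denominator positive when R =
    0.\<close>
  define \<eta> where "\<eta> = \<epsilon> / (8 * (R * KA * sqrt a + 1))"
  have den: "R * KA * sqrt a \<ge> 0" using R KA a by simp
  then have \<eta>: "\<eta> > 0" using \<epsilon> by (simp add: \<eta>_def add_nonneg_pos)
  have \<eta>2: "R * (KA * \<eta>) * sqrt a \<le> \<epsilon> / 8"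
  proof -
    have "R * (KA * \<eta>) * sqrt a = (\<epsilon> / 8) * ((R * KA * sqrt a) / (R * KA * sqrt a + 1))"
      by (simp add: \<eta>_def)
    also have "\<dots> \<le> (\<epsilon> / 8) * 1"
      using den \<epsilon> by (intro mult_left_mono) (auto simp: divide_le_eq_1)
    finally show ?thesis by simp
  qed
  obtain Z where Z: "finite Z" "\<And>\<sigma> e. \<sigma> \<in> {\<delta>..a} \<Longrightarrow> norm e \<le> 1 \<Longrightarrow> \<exists>z\<in>Z. norm (S \<sigma> e - z) \<le> \<eta>"
    using S_net[OF \<delta>(1) \<eta>] by blast
  obtain W p where W: "finite W" and bp: "bounded_linear p" and np: "\<And>x. norm (p x) \<le> norm x"
    and best: "\<And>x z. z \<in> insert 0 (Z \<union> (\<lambda>w. T a (Op w)) ` Z) \<Longrightarrow> norm (x - p x) \<le> norm (x - z)"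
    and peq: "\<And>x. p x = (\<Sum>w\<in>W. ((x \<bullet> w) / (w \<bullet> w)) *\<^sub>R w)"
  proof -
    have "finite (insert 0 (Z \<union> (\<lambda>w. T a (Op w)) ` Z))" using Z(1) by simp
    then show thesis by (rule orthogonal_projection_span) (rule that)
  qed
  define V where "V x = x - p x" for x
  have bV: "bounded_linear V"
    unfolding V_def[abs_def] by (intro bounded_linear_sub bp bounded_linear_ident)
  have nV: "norm (V x) \<le> 1 * norm x" for x
    using best[of 0 x] by (simp add: V_def)
  have V0: "V z = 0" if "z \<in> Z \<union> (\<lambda>w. T a (Op w)) ` Z" for z
    using best[of z z] that by (simp add: V_def)
  obtain CL where CL: "\<And>h. h \<in> L2 a \<Longrightarrow> norm (L h) \<le> CL * L2_norm a h"
    using L unfolding is_terminal_operator_def by blast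
  define K where "K = L ` {h \<in> L2 a. L2_norm a h \<le> R}"
  define D where "D = {\<Sum>w\<in>W. d w *\<^sub>R w |d. \<forall>w\<in>W. \<bar>d w\<bar> \<le> \<bar>CL\<bar> * R / norm w}"
  have cD: "compact D"
    unfolding D_def by (rule compact_bounded_combinations[OF W])
  have near: "\<exists>y\<in>D. dist x y \<le> \<epsilon> / 4" if "x \<in> K" for x
  proof -
    obtain h where h: "h \<in> L2 a" "L2_norm a h \<le> R" "x = L h"
      using \<open>x \<in> K\<close> by (auto simp: K_def)
    have hb: "has_bochner ?M (\<lambda>s. V (G a s (h s))) (V (L h))"
      using L h(1) by (intro has_bochner_bounded_linear[OF bV]) (auto simp: is_terminal_operator_def)
    \<comment> \<open>Nodes are numbered from 1, so the index 0 is free for the singularity at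
      a.\<close>
    let ?b = "\<lambda>j. if j = 0 then a else \<tau> j"
    let ?J = "insert 0 {1..m}"
    have sumJ: "(\<Sum>j\<in>?J. edge \<alpha> \<delta> (?b j) s) = edge \<alpha> \<delta> a s + (\<Sum>k=1..m. edge \<alpha> \<delta> (\<tau> k) s)" for s
      by (subst sum.insert) (auto intro!: sum.cong)
    have pw: "norm (V (G a s e)) \<le> norm e * (KA * \<eta> + (C * KA) * (\<Sum>j\<in>?J. edge \<alpha> \<delta> (?b j) s))" if s: "s \<in> {0..a}" for s e
    proof -
      interpret V: bounded_linear V by fact
      have 1: "norm (V (T a (Op (S \<sigma> e)))) \<le> (B1 * \<eta> + B1 * C * (indicator {0<..<\<delta>} \<sigma> * \<sigma> powr (\<alpha> - 1))) * norm e"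
        if "0 < \<sigma>" "\<sigma> \<le> a" for \<sigma>
      proof -
        have "norm (V (T a (Op w))) \<le> B1 * norm w" for w
          using nV[of "T a (Op w)"] B1(2)[of w] by (simp add: mult.commute)
        from net_bound[OF bounded_linear_compose[OF bV bTO] this _ Z(2) _ \<delta>(1), of 0]
        show ?thesis using V0 B1(1) \<eta> that by auto
      qed
      have 2: "norm (V (S \<sigma> e)) \<le> (\<eta> + C * (indicator {0<..<\<delta>} \<sigma> * \<sigma> powr (\<alpha> - 1))) * norm e"
        if "0 < \<sigma>" "\<sigma> \<le> a" for \<sigma>
        using net_bound[OF bV nV _ Z(2) _ \<delta>(1), of 0] V0 \<eta> that by auto
      have last: "norm (V (if s \<in> {0..<a} then S (a - s) e else 0)) \<le> norm e * (\<eta> + C * edge \<alpha> \<delta> a s)"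
      proof (cases "s < a")
        case True
        then have "indicator {0<..<\<delta>} (a - s) * (a - s) powr (\<alpha> - 1) = edge \<alpha> \<delta> a s"
          by (auto simp: edge_def indicator_def)
        then show ?thesis using 2[of "a - s"] True s by (simp add: mult.commute)
      next
        case False
        then show ?thesis using \<eta> C by (simp add: V.zero edge_nonneg)
      qed
      have "V (G a s e) = (\<Sum>k=1..m. if s \<in> {0..<\<tau> k} then c k *\<^sub>R V (T a (Op (S (\<tau> k - s) e))) else 0) +
          V (if s \<in> {0..<a} then S (a - s) e else 0)"
        unfolding green_def V.add V.sum by (intro arg_cong2[where f="(+)"] sum.cong refl) (simp add: V.scaleR V.zero)
      also have "norm \<dots> \<le> norm e * (?c * (B1 * \<eta>) + ?c * (B1 * C) * (\<Sum>k=1..m. edge \<alpha> \<delta> (\<tau> k) s)) +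
          norm e * (\<eta> + C * edge \<alpha> \<delta> a s)"
        by (intro order_trans[OF norm_triangle_ineq] add_mono last
            node_sum_bound[where V="\<lambda>w. V (T a (Op w))"] 1) (use B1 \<eta> C s in auto)
      also have "\<dots> \<le> norm e * (KA * \<eta> + (C * KA) * (\<Sum>j\<in>?J. edge \<alpha> \<delta> (?b j) s))"
      proof -
        let ?E = "\<Sum>k=1..m. edge \<alpha> \<delta> (\<tau> k) s" and ?e = "edge \<alpha> \<delta> a s"
        have "?E \<ge> 0" "?e \<ge> 0" by (auto simp: edge_nonneg sum_nonneg)
        then have "0 \<le> C * ?E + ?c * B1 * C * ?e"
          using C c0 B1 by (intro add_nonneg_nonneg mult_nonneg_nonneg) auto
        then have "(?c * (B1 * \<eta>) + ?c * (B1 * C) * ?E) + (\<eta> + C * ?e) \<le> KA * \<eta> + (C * KA) * (?e + ?E)"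
          by (simp add: KA_def algebra_simps)
        then show ?thesis
          unfolding sumJ distrib_left[symmetric] by (rule mult_left_mono) simp
      qed
      finally show ?thesis .
    qed
    have CKA: "C * KA \<ge> 0" "KA * \<eta> \<ge> 0" using C KA \<eta> by auto
    note int = L2_edge_integral[OF h(1) less_imp_le[OF a] \<alpha>2 \<delta>(1), of ?J "KA * \<eta>" "C * KA" ?b]
    have en: "edge_norm \<alpha> \<delta> \<ge> 0" using \<alpha>2 by (simp add: edge_norm_def)
    have "norm (V (L h)) \<le> (\<integral>s. norm (h s) * (KA * \<eta> + (C * KA) * (\<Sum>j\<in>?J. edge \<alpha> \<delta> (?b j) s)) \<partial>?M)"
      by (rule norm_has_bochner_le[OF hb int(1)]) (use CKA pw in \<open>auto intro!: AE_I2\<close>)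
    also have "\<dots> \<le> L2_norm a h * (KA * \<eta> * sqrt a + C * KA * (real (card ?J) * edge_norm \<alpha> \<delta>))"
      by (rule int(2)) (use CKA in auto)
    also have "\<dots> \<le> R * (KA * \<eta> * sqrt a + C * KA * (real (card ?J) * edge_norm \<alpha> \<delta>))"
      using h(2) CKA en a by (intro mult_right_mono) auto
    also have "\<dots> = R * (KA * \<eta>) * sqrt a + edge_norm \<alpha> \<delta> * (R * (C * KA) * (m + 1))"
      by (simp add: algebra_simps)
    also have "\<dots> \<le> \<epsilon> / 4"
      using \<eta>2 \<delta>(2) by simp
    finally have "dist x (p x) \<le> \<epsilon> / 4"
      by (simp add: dist_norm V_def h(3))
    moreover have "p x \<in> D"
    proof -
      have "\<bar>(x \<bullet> w) / (w \<bullet> w)\<bar> \<le> \<bar>CL\<bar> * R / norm w" for w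
      proof (cases "w = 0")
        case False
        have "\<bar>x \<bullet> w\<bar> \<le> norm x * norm w" by (rule Cauchy_Schwarz_ineq2)
        also have "\<dots> \<le> (\<bar>CL\<bar> * R) * norm w"
        proof (intro mult_right_mono)
          have "norm x \<le> CL * L2_norm a h" using CL[OF h(1)] h(3) by simp
          also have "\<dots> \<le> \<bar>CL\<bar> * R"
            using h(2) by (intro mult_mono) (auto simp: L2_norm_nonneg)
          finally show "norm x \<le> \<bar>CL\<bar> * R" .
        qed simp
        finally show ?thesis
          using False by (simp add: dot_square_norm power2_eq_square divide_simps abs_mult)
      qed simp
      then show ?thesis
        unfolding D_def peq by (intro CollectI exI[of _ "\<lambda>w. (x \<bullet> w) / (w \<bullet> w)"]) simp
    qed
    ultimately show ?thesis by blast
  qed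
  obtain F where F: "finite F" "F \<subseteq> K" "\<And>x. x \<in> K \<Longrightarrow> \<exists>y\<in>F. dist x y < 4 * (\<epsilon> / 4)"
  proof -
    have "\<epsilon> / 4 > 0" using \<epsilon> by simp
    from finite_net_near_compact[OF cD this, of K] near that show thesis by blast
  qed
  obtain F' where F': "finite F'" "F' \<subseteq> {h \<in> L2 a. L2_norm a h \<le> R}" "F = L ` F'"
    using finite_subset_image[OF F(1) F(2)[unfolded K_def]] by blast
  show ?thesis
  proof
    show "finite F'" "F' \<subseteq> {h \<in> L2 a. L2_norm a h \<le> R}" by fact+
    fix h :: "real \<Rightarrow> 'e" assume "h \<in> L2 a" "L2_norm a h \<le> R"
    then have "L h \<in> K" by (auto simp: K_def)
    from F(3)[OF this] show "\<exists>q\<in>F'. norm (L h - L q) < \<epsilon>"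
      by (auto simp: F'(3) dist_norm)
  qed
qed

text \<open>Node terms differ through (T(t) - T(a)) Op, which tends to 0 strongly and therefore
  uniformly on a finite net for S. The last term is handled by uniform norm continuity of S on
  [\<delta>, a]. What remains are edges at the nodes, at t and at a, whose L2 size is bounded
  independently of t.\<close>

lemma terminal_equicontinuous:
  assumes \<alpha>2: "\<alpha> > 1 / 2" and R: "R \<ge> 0" and \<epsilon>: "\<epsilon> > 0"
  obtains d where "0 < d" "d \<le> a"
    "\<And>t h yt ya. t \<in> {a - d..a} \<Longrightarrow> h \<in> L2 a \<Longrightarrow> L2_norm a h \<le> R \<Longrightarrow>
      has_bochner (lebesgue_on {0..a}) (\<lambda>s. G t s (h s)) yt \<Longrightarrow>
      has_bochner (lebesgue_on {0..a}) (\<lambda>s. G a s (h s)) ya \<Longrightarrow> norm (yt - ya) \<le> \<epsilon>"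
proof -
  let ?M = "lebesgue_on {0..a}"
  let ?c = "\<Sum>k=1..m. \<bar>c k\<bar>"
  have c0: "?c \<ge> 0" by (simp add: sum_nonneg)
  obtain BO where BO: "BO > 0" "\<And>w. norm (Op w) \<le> norm w * BO"
    using bounded_linear.pos_bounded[OF Op_linear] by blast
  define B2 where "B2 = 2 * BT * BO"
  have B2: "B2 \<ge> 0" using BT BO by (simp add: B2_def)
  define KA where "KA = ?c * (1 + B2) + 1"
  define KB where "KB = ?c * (B2 * C) + 2 * C"
  have KA: "KA > 0" and KB: "KB \<ge> 0"
    using c0 B2 C by (simp_all add: KA_def KB_def add_nonneg_pos)
  obtain \<delta> where \<delta>: "\<delta> > 0" "edge_norm \<alpha> \<delta> * (R * KB * (m + 2)) < \<epsilon> / 2"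
    using edge_norm_small[OF \<alpha>2, of "\<epsilon> / 2"] \<epsilon> by auto
  define \<eta> where "\<eta> = \<epsilon> / (2 * (R * KA * sqrt a + 1))"
  have den: "R * KA * sqrt a \<ge> 0" using R KA a by simp
  then have \<eta>: "\<eta> > 0" using \<epsilon> by (simp add: \<eta>_def add_nonneg_pos)
  have \<eta>2: "R * (KA * \<eta>) * sqrt a \<le> \<epsilon> / 2"
  proof -
    have "R * (KA * \<eta>) * sqrt a = (\<epsilon> / 2) * ((R * KA * sqrt a) / (R * KA * sqrt a + 1))"
      by (simp add: \<eta>_def)
    also have "\<dots> \<le> (\<epsilon> / 2) * 1"
      using den \<epsilon> by (intro mult_left_mono) (auto simp: divide_le_eq_1)
    finally show ?thesis by simp
  qed
  obtain Z where Z: "finite Z" "\<And>\<sigma> e. \<sigma> \<in> {\<delta>..a} \<Longrightarrow> norm e \<le> 1 \<Longrightarrow> \<exists>z\<in>Z. norm (S \<sigma> e - z) \<le> \<eta>"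
    using S_net[OF \<delta>(1) \<eta>] by blast
  have "\<forall>\<^sub>F t in at a within {0..}. \<forall>z\<in>Z. dist (T t (Op z)) (T a (Op z)) < \<eta>"
  proof (rule eventually_ball_finite[OF Z(1)], rule ballI)
    fix z
    have "((\<lambda>t. T t (Op z)) \<longlongrightarrow> T a (Op z)) (at a within {0..})"
      using T_strong[of "Op z"] a by (simp add: continuous_on_def)
    then show "\<forall>\<^sub>F t in at a within {0..}. dist (T t (Op z)) (T a (Op z)) < \<eta>"
      using \<eta> by (rule tendstoD)
  qed
  then obtain d1 where d1: "d1 > 0"
    "\<And>t z. t \<ge> 0 \<Longrightarrow> t \<noteq> a \<Longrightarrow> dist t a < d1 \<Longrightarrow> z \<in> Z \<Longrightarrow> dist (T t (Op z)) (T a (Op z)) < \<eta>"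
    unfolding eventually_at by auto
  have "uniformly_continuous_on {\<delta>..a} (\<lambda>t. Blinfun (S t))"
    by (intro compact_uniformly_continuous continuous_on_subset[OF S_cont]) (use \<delta> in auto)
  then obtain d2 where d2: "d2 > 0" "\<And>\<sigma> \<sigma>'. \<sigma> \<in> {\<delta>..a} \<Longrightarrow> \<sigma>' \<in> {\<delta>..a} \<Longrightarrow> dist \<sigma>' \<sigma> < d2 \<Longrightarrow>
      dist (Blinfun (S \<sigma>')) (Blinfun (S \<sigma>)) < \<eta>"
    unfolding uniformly_continuous_on_def using \<eta> by metis
  have Sdiff: "norm (S \<sigma> e - S \<sigma>' e) \<le> norm e * \<eta>" if s: "\<sigma> \<in> {\<delta>..a}" "\<sigma>' \<in> {\<delta>..a}" "dist \<sigma> \<sigma>' < d2" for \<sigma> \<sigma>' e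
  proof -
    have pos: "\<sigma> > 0" "\<sigma>' > 0" using s \<delta> by auto
    have "norm (S \<sigma> e - S \<sigma>' e) = norm (blinfun_apply (Blinfun (S \<sigma>) - Blinfun (S \<sigma>')) e)"
      using pos by (simp add: blinfun.diff_left bounded_linear_Blinfun_apply[OF S_linear])
    also have "\<dots> \<le> norm (Blinfun (S \<sigma>) - Blinfun (S \<sigma>')) * norm e"
      by (rule norm_blinfun)
    also have "\<dots> \<le> \<eta> * norm e"
      using d2(2)[OF s(2,1,3)] by (intro mult_right_mono) (auto simp: dist_norm)
    finally show ?thesis by (simp add: mult.commute)
  qed
  \<comment> \<open>The halves give strict inequalities. d < \<delta> places every s in [t, a)
    inside the edge at a, and d < d2 keeps t - s and a - s within the range of uniform
    continuity.\<close>
  define d where "d = Min {a, d1 / 2, d2 / 2, \<delta> / 2}"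
  have d: "0 < d" "d \<le> a" "d < d1" "d < d2" "d < \<delta>"
    using a d1(1) d2(1) \<delta>(1) by (auto simp: d_def min_def)
  show ?thesis
  proof (rule that[OF d(1,2)])
    fix t h yt ya
    assume t: "t \<in> {a - d..a}" and h: "h \<in> L2 a" "L2_norm a h \<le> R"
      and yt: "has_bochner ?M (\<lambda>s. G t s (h s)) yt" and ya: "has_bochner ?M (\<lambda>s. G a s (h s)) ya"
    have t0: "0 \<le> t" using t d by auto
    define V where "V w = T t (Op w) - T a (Op w)" for w
    have bV: "bounded_linear V"
      unfolding V_def[abs_def] using t0 a
      by (intro bounded_linear_sub bounded_linear_compose[OF T_linear Op_linear]) auto
    have nV: "norm (V w) \<le> B2 * norm w" for w
    proof -
      have "norm (V w) \<le> norm (T t (Op w)) + norm (T a (Op w))"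
        unfolding V_def by (rule norm_triangle_ineq4)
      also have "\<dots> \<le> BT * norm (Op w) + BT * norm (Op w)"
        using t0 a by (intro add_mono T_bound) auto
      also have "\<dots> = 2 * BT * norm (Op w)" by simp
      also have "\<dots> \<le> 2 * BT * (norm w * BO)"
        using BO(2) BT by (intro mult_left_mono) auto
      finally show ?thesis by (simp add: B2_def mult_ac)
    qed
    have VZ: "norm (V z) \<le> \<eta>" if "z \<in> Z" for z
    proof (cases "t = a")
      case False
      have "dist t a < d1" using t d by (auto simp: dist_real_def)
      from d1(2)[OF t0 False this that] show ?thesis by (simp add: V_def dist_norm)
    qed (use \<eta> in \<open>simp add: V_def\<close>)
    \<comment> \<open>Index 0 stands for a and \<open>Suc m\<close> for t, both outside the node
      indices.\<close>
    let ?b = "\<lambda>j. if j = 0 then a else if j = Suc m then t else \<tau> j"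
    let ?J = "insert 0 (insert (Suc m) {1..m})"
    have sumJ: "(\<Sum>j\<in>?J. edge \<alpha> \<delta> (?b j) s) = edge \<alpha> \<delta> a s + (edge \<alpha> \<delta> t s + (\<Sum>k=1..m. edge \<alpha> \<delta> (\<tau> k) s))" for s
    proof -
      have "(\<Sum>j=1..m. edge \<alpha> \<delta> (?b j) s) = (\<Sum>k=1..m. edge \<alpha> \<delta> (\<tau> k) s)"
        by (intro sum.cong) auto
      then show ?thesis by simp
    qed
    have pw: "norm (G t s e - G a s e) \<le> norm e * (KA * \<eta> + KB * (\<Sum>j\<in>?J. edge \<alpha> \<delta> (?b j) s))" if s: "s \<in> {0..a}" for s e
    proof -
      have 1: "norm (V (S \<sigma> e)) \<le> ((\<eta> + B2 * \<eta>) + B2 * C * (indicator {0<..<\<delta>} \<sigma> * \<sigma> powr (\<alpha> - 1))) * norm e"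
        if "0 < \<sigma>" "\<sigma> \<le> a" for \<sigma>
        using net_bound[OF bV nV B2 Z(2) VZ \<delta>(1)] \<eta> that by auto
      let ?l = "(if s \<in> {0..<t} then S (t - s) e else 0) - (if s \<in> {0..<a} then S (a - s) e else 0)"
      have last: "norm ?l \<le> norm e * (\<eta> + 2 * C * (edge \<alpha> \<delta> a s + edge \<alpha> \<delta> t s))"
      proof -
        have en: "edge \<alpha> \<delta> a s \<ge> 0" "edge \<alpha> \<delta> t s \<ge> 0" by (auto simp: edge_nonneg)
        \<comment> \<open>Past t only S(a - s) remains, inside the edge at a. When t - s < \<delta>,
          the negative exponent gives (a - s)^(\<alpha> - 1) \<le> (t - s)^(\<alpha> - 1), so the
          edge at t covers both terms.\<close>
        consider "s = a" | "t \<le> s" "s < a" | "s < t" "t - s \<ge> \<delta>" | "s < t" "t - s < \<delta>"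
          using s t by fastforce
        then show ?thesis
        proof cases
          case 1
          then show ?thesis using t \<eta> C en by simp
        next
          case 2
          then have e: "edge \<alpha> \<delta> a s = (a - s) powr (\<alpha> - 1)"
            using t d by (simp add: edge_def)
          have "norm ?l \<le> C * (a - s) powr (\<alpha> - 1) * norm e"
            using 2 s S_bound[of "a - s" e] by simp
          also have "\<dots> = norm e * (0 + C * edge \<alpha> \<delta> a s)"
            by (simp add: e mult_ac)
          also have "\<dots> \<le> norm e * (\<eta> + 2 * C * (edge \<alpha> \<delta> a s + edge \<alpha> \<delta> t s))"
            using \<eta> mult_nonneg_nonneg[OF C en(1)] mult_nonneg_nonneg[OF C en(2)]
            by (intro mult_left_mono) (auto simp: algebra_simps)
          finally show ?thesis .
        next
          case 3
          have "norm ?l \<le> norm e * (\<eta> + 0)"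
            using 3 s t d Sdiff[of "t - s" "a - s" e] by (simp add: dist_real_def)
          also have "\<dots> \<le> norm e * (\<eta> + 2 * C * (edge \<alpha> \<delta> a s + edge \<alpha> \<delta> t s))"
            using C en by (intro mult_left_mono add_left_mono) auto
          finally show ?thesis .
        next
          case 4
          then have e: "edge \<alpha> \<delta> t s = (t - s) powr (\<alpha> - 1)"
            by (simp add: edge_def)
          have le: "(a - s) powr (\<alpha> - 1) \<le> (t - s) powr (\<alpha> - 1)"
            using 4 t \<alpha>1 by (intro powr_mono2') auto
          have "norm ?l \<le> norm (S (t - s) e) + norm (S (a - s) e)"
            using 4 s t by (simp add: norm_triangle_ineq4)
          also have "\<dots> \<le> C * (t - s) powr (\<alpha> - 1) * norm e + C * (a - s) powr (\<alpha> - 1) * norm e"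
            using 4 s t by (intro add_mono S_bound) auto
          also have "\<dots> \<le> C * (t - s) powr (\<alpha> - 1) * norm e + C * (t - s) powr (\<alpha> - 1) * norm e"
            using le C by (intro add_left_mono mult_right_mono mult_left_mono) auto
          also have "\<dots> = norm e * (0 + 2 * C * (0 + edge \<alpha> \<delta> t s))"
            by (simp add: e mult_ac)
          also have "\<dots> \<le> norm e * (\<eta> + 2 * C * (edge \<alpha> \<delta> a s + edge \<alpha> \<delta> t s))"
            using \<eta> C en by (intro mult_left_mono add_mono) auto
          finally show ?thesis .
        qed
      qed
      have "G t s e - G a s e = (\<Sum>k=1..m. if s \<in> {0..<\<tau> k} then c k *\<^sub>R V (S (\<tau> k - s) e) else 0) + ?l"
        unfolding green_def add_diff_add sum_subtractf[symmetric]
        by (intro arg_cong2[where f="(+)"] sum.cong refl) (simp add: V_def scaleR_diff_right)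
      also have "norm \<dots> \<le> norm e * (?c * (\<eta> + B2 * \<eta>) + ?c * (B2 * C) * (\<Sum>k=1..m. edge \<alpha> \<delta> (\<tau> k) s)) +
          norm e * (\<eta> + 2 * C * (edge \<alpha> \<delta> a s + edge \<alpha> \<delta> t s))"
        by (intro order_trans[OF norm_triangle_ineq] add_mono last node_sum_bound 1) (use B2 \<eta> C s in auto)
      also have "\<dots> \<le> norm e * (KA * \<eta> + KB * (\<Sum>j\<in>?J. edge \<alpha> \<delta> (?b j) s))"
      proof -
        let ?E = "\<Sum>k=1..m. edge \<alpha> \<delta> (\<tau> k) s" and ?e = "edge \<alpha> \<delta> a s" and ?f = "edge \<alpha> \<delta> t s"
        have "?E \<ge> 0" "?e \<ge> 0" "?f \<ge> 0" by (auto simp: edge_nonneg sum_nonneg)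
        then have "0 \<le> 2 * C * ?E + ?c * (B2 * C) * ?e + ?c * (B2 * C) * ?f"
          using C c0 B2 by (intro add_nonneg_nonneg mult_nonneg_nonneg) auto
        then have "(?c * (\<eta> + B2 * \<eta>) + ?c * (B2 * C) * ?E) + (\<eta> + 2 * C * (?e + ?f)) \<le> KA * \<eta> + KB * (?e + (?f + ?E))"
          by (simp add: KA_def KB_def algebra_simps)
        then show ?thesis
          unfolding sumJ distrib_left[symmetric] by (rule mult_left_mono) simp
      qed
      finally show ?thesis .
    qed
    have KA\<eta>: "KA * \<eta> \<ge> 0" using KA \<eta> by simp
    note int = L2_edge_integral[OF h(1) less_imp_le[OF a] \<alpha>2 \<delta>(1), of ?J "KA * \<eta>" KB ?b]
    have en: "edge_norm \<alpha> \<delta> \<ge> 0" using \<alpha>2 by (simp add: edge_norm_def)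
    have "norm (yt - ya) \<le> (\<integral>s. norm (h s) * (KA * \<eta> + KB * (\<Sum>j\<in>?J. edge \<alpha> \<delta> (?b j) s)) \<partial>?M)"
      by (rule norm_has_bochner_diff_le[OF yt ya int(1)]) (use KA\<eta> KB pw in \<open>auto intro!: AE_I2\<close>)
    also have "\<dots> \<le> L2_norm a h * (KA * \<eta> * sqrt a + KB * (real (card ?J) * edge_norm \<alpha> \<delta>))"
      by (rule int(2)) (use KA\<eta> KB in auto)
    also have "\<dots> \<le> R * (KA * \<eta> * sqrt a + KB * (real (card ?J) * edge_norm \<alpha> \<delta>))"
      using h(2) KA\<eta> KB en a by (intro mult_right_mono) auto
    also have "\<dots> = R * (KA * \<eta>) * sqrt a + edge_norm \<alpha> \<delta> * (R * KB * (m + 2))"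
      by (simp add: algebra_simps)
    also have "\<dots> \<le> \<epsilon>"
      using \<eta>2 \<delta>(2) by simp
    finally show "norm (yt - ya) \<le> \<epsilon>" .
  qed
qed

end

section \<open>Continuity in L2 and Schauder weights\<close>

lemma has_bochner_unique:
  fixes f g :: "'a \<Rightarrow> 'b::real_inner"
  assumes "has_bochner M f x" "has_bochner M g y" "AE t in M. f t = g t"
  shows "x = y"
  using norm_has_bochner_diff_le[OF assms(1,2), of "\<lambda>t. 0"] assms(3) by (simp add: eventually_mono)

lemma L2_zero: "(\<lambda>t. 0) \<in> L2 a"
  by (simp add: L2_def strongly_measurable_const)

lemma L2_diff:
  fixes p q :: "real \<Rightarrow> 'e::complex_hilbert"
  assumes p: "p \<in> L2 a" and q: "q \<in> L2 a"
  shows "(\<lambda>t. p t - q t) \<in> L2 a"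
  using L2_norm_add(1)[OF p L2_norm_scaleR(1)[OF q, of "- 1"]] by simp

lemma L2_norm_triangle:
  fixes p q r :: "real \<Rightarrow> 'e::complex_hilbert"
  assumes "p \<in> L2 a" "q \<in> L2 a" "r \<in> L2 a"
  shows "L2_norm a (\<lambda>t. p t - r t) \<le> L2_norm a (\<lambda>t. p t - q t) + L2_norm a (\<lambda>t. q t - r t)"
  using L2_norm_add(2)[OF L2_diff[OF assms(1,2)] L2_diff[OF assms(2,3)]] by simp

text \<open>By the triangle inequality a seminorm ball is open in \<open>L2_topology\<close>, so
  continuity can be used in \<epsilon>-\<delta> form on representatives.\<close>

lemma continuous_map_L2_ball:
  fixes W :: "(real \<Rightarrow> 'e::complex_hilbert) \<Rightarrow> (real \<Rightarrow> 'f::complex_hilbert)"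
  assumes W: "continuous_map (subtopology (L2_topology a) Y) (L2_topology a) W"
    and Y: "Y \<subseteq> L2 a" and \<mu>: "\<mu> \<in> Y" and e: "e > 0"
  obtains r where "r > 0" "\<And>\<nu>. \<nu> \<in> Y \<Longrightarrow> L2_norm a (\<lambda>t. \<nu> t - \<mu> t) < r \<Longrightarrow> L2_norm a (\<lambda>t. W \<nu> t - W \<mu> t) < e"
proof -
  have top: "topspace (subtopology (L2_topology a) Y) = Y"
    using Y by (auto simp: topspace_subtopology)
  have WL: "W \<nu> \<in> L2 a" if "\<nu> \<in> Y" for \<nu>
    using continuous_map_image_subset_topspace[OF W] that top by auto
  define U where "U = {q \<in> L2 a. L2_norm a (\<lambda>t. q t - W \<mu> t) < e}"
  have "openin (L2_topology a) U"
    unfolding openin_L2_topology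
  proof (intro conjI ballI)
    show "U \<subseteq> L2 a" by (auto simp: U_def)
    fix p assume p: "p \<in> U"
    show "\<exists>r>0. {q \<in> L2 a. L2_norm a (\<lambda>t. q t - p t) < r} \<subseteq> U"
    proof (intro exI[of _ "e - L2_norm a (\<lambda>t. p t - W \<mu> t)"] conjI subsetI)
      show "0 < e - L2_norm a (\<lambda>t. p t - W \<mu> t)" using p by (simp add: U_def)
      fix q assume q: "q \<in> {q \<in> L2 a. L2_norm a (\<lambda>t. q t - p t) < e - L2_norm a (\<lambda>t. p t - W \<mu> t)}"
      then show "q \<in> U"
        using L2_norm_triangle[of q a p "W \<mu>"] p WL[OF \<mu>] by (auto simp: U_def)
    qed
  qed
  then have "openin (subtopology (L2_topology a) Y) {x \<in> Y. W x \<in> U}"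
    using openin_continuous_map_preimage[OF W, of U] unfolding top by simp
  then obtain V where V: "openin (L2_topology a) V" "{x \<in> Y. W x \<in> U} = V \<inter> Y"
    by (auto simp: openin_subtopology)
  have "W \<mu> \<in> U"
    using WL[OF \<mu>] e by (simp add: U_def L2_norm_def)
  then have "\<mu> \<in> V" using V(2) \<mu> by blast
  then obtain r where r: "r > 0" "{q \<in> L2 a. L2_norm a (\<lambda>t. q t - \<mu> t) < r} \<subseteq> V"
    using V(1) unfolding openin_L2_topology by blast
  show ?thesis
  proof
    show "r > 0" by fact
    fix \<nu> assume "\<nu> \<in> Y" "L2_norm a (\<lambda>t. \<nu> t - \<mu> t) < r"
    then have "\<nu> \<in> {x \<in> Y. W x \<in> U}" using r(2) V(2) Y by blast
    then show "L2_norm a (\<lambda>t. W \<nu> t - W \<mu> t) < e" by (simp add: U_def)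
  qed
qed

text \<open>B respects sums and multiples only up to null sets, so the identity is accumulated one
  summand at a time, with finitely many exceptional sets.\<close>

lemma bounded_clinear_L2_combination:
  fixes B :: "(real \<Rightarrow> 'u::complex_hilbert) \<Rightarrow> (real \<Rightarrow> 'e::complex_hilbert)"
    and n :: nat
  assumes B: "bounded_clinear_L2 a B" and v0: "v0 \<in> L2 a" and v: "\<And>i. i < n \<Longrightarrow> v i \<in> L2 a"
  shows "(\<lambda>s. v0 s + (\<Sum>i<n. r i *\<^sub>R v i s)) \<in> L2 a"
    "AE t in lebesgue_on {0..a}. B (\<lambda>s. v0 s + (\<Sum>i<n. r i *\<^sub>R v i s)) t = B v0 t + (\<Sum>i<n. r i *\<^sub>R B (v i) t)"
proof -
  have add: "AE t in lebesgue_on {0..a}. B (\<lambda>s. u s + w s) t = B u t + B w t" if "u \<in> L2 a" "w \<in> L2 a" for u w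
    using B that unfolding bounded_clinear_L2_def by blast
  have scale: "AE t in lebesgue_on {0..a}. B (\<lambda>s. x *\<^sub>R w s) t = x *\<^sub>R B w t" if "w \<in> L2 a" for w and x :: real
    using B that unfolding bounded_clinear_L2_def scaleR_scaleC by blast
  have "(\<lambda>s. v0 s + (\<Sum>i<k. r i *\<^sub>R v i s)) \<in> L2 a \<and>
    (AE t in lebesgue_on {0..a}. B (\<lambda>s. v0 s + (\<Sum>i<k. r i *\<^sub>R v i s)) t = B v0 t + (\<Sum>i<k. r i *\<^sub>R B (v i) t))"
    if "k \<le> n" for k
    using that
  proof (induction k)
    case 0
    then show ?case using v0 by simp
  next
    case (Suc k)
    let ?w = "\<lambda>s. v0 s + (\<Sum>i<k. r i *\<^sub>R v i s)"
    have w: "?w \<in> L2 a" and vk: "v k \<in> L2 a"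
      and IH: "AE t in lebesgue_on {0..a}. B ?w t = B v0 t + (\<Sum>i<k. r i *\<^sub>R B (v i) t)"
      using Suc v by auto
    have rv: "(\<lambda>s. r k *\<^sub>R v k s) \<in> L2 a" by (rule L2_norm_scaleR(1)[OF vk])
    have eq: "(\<lambda>s. v0 s + (\<Sum>i<Suc k. r i *\<^sub>R v i s)) = (\<lambda>s. ?w s + r k *\<^sub>R v k s)"
      by (simp add: add.assoc)
    have "AE t in lebesgue_on {0..a}. B (\<lambda>s. ?w s + r k *\<^sub>R v k s) t = B v0 t + (\<Sum>i<Suc k. r i *\<^sub>R B (v i) t)"
      using add[OF w rv] scale[OF vk, of "r k"] IH by eventually_elim (simp add: add.assoc)
    then show ?case
      unfolding eq using L2_norm_add(1)[OF w rv] by blast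
  qed
  from this[of n] show "(\<lambda>s. v0 s + (\<Sum>i<n. r i *\<^sub>R v i s)) \<in> L2 a"
    "AE t in lebesgue_on {0..a}. B (\<lambda>s. v0 s + (\<Sum>i<n. r i *\<^sub>R v i s)) t = B v0 t + (\<Sum>i<n. r i *\<^sub>R B (v i) t)"
    by auto
qed

text \<open>A Chebyshev-type bound on [a - d, a]. Read backwards, it extracts from smallness in L2 a
  point near a where the values are small.\<close>

lemma L2_norm_lower_bound:
  assumes p: "p \<in> L2 a" and d: "0 \<le> d" "d \<le> a" and e: "0 \<le> e" and le: "\<And>t. t \<in> {a - d..a} \<Longrightarrow> e \<le> norm (p t)"
  shows "sqrt d * e \<le> L2_norm a p"
proof -
  let ?M = "lebesgue_on {0..a}"
  have m: "{a - d..a} \<inter> space ?M = {a - d..a}" using d by auto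
  have meas: "measure ?M {a - d..a} = d"
    using d by (subst measure_restrict_space) auto
  have i: "integrable ?M (\<lambda>t. indicator {a - d..a} t * e\<^sup>2)"
    using d by (intro integrable_mult_left integrable_real_indicator)
      (auto simp: sets_restrict_space_iff emeasure_restrict_space)
  have "d * e\<^sup>2 = (\<integral>t. indicator {a - d..a} t * e\<^sup>2 \<partial>?M)"
    unfolding integral_mult_left_zero Bochner_Integration.integral_indicator m meas ..
  also have "\<dots> \<le> (\<integral>t. (norm (p t))\<^sup>2 \<partial>?M)"
    using le e by (intro integral_mono[OF i L2_integrable[OF p]]) (auto simp: indicator_def intro: power_mono)
  finally have "sqrt (d * e\<^sup>2) \<le> L2_norm a p"
    unfolding L2_norm_def by (rule real_sqrt_le_mono)
  then show ?thesis using e by (simp add: real_sqrt_mult)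
qed

text \<open>The weights of the Schauder projection onto the net \<open>y\<^sub>0, \<dots>, y\<^sub>n\<^sub>-\<^sub>1\<close>.\<close>

definition hat :: "real \<Rightarrow> (nat \<Rightarrow> 'a::real_normed_vector) \<Rightarrow> 'a \<Rightarrow> nat \<Rightarrow> real" where
  "hat e y x i = max 0 (e - norm (x - y i))"

definition hat_weight :: "real \<Rightarrow> nat \<Rightarrow> (nat \<Rightarrow> 'a::real_normed_vector) \<Rightarrow> 'a \<Rightarrow> nat \<Rightarrow> real" where
  "hat_weight e n y x i = hat e y x i / (\<Sum>j<n. hat e y x j)"

lemma hat_sum_pos:
  assumes "j < n" "norm (x - y j) < e"
  shows "(\<Sum>j<n. hat e y x j) > 0"
  by (rule sum_pos2[of _ j]) (use assms in \<open>auto simp: hat_def\<close>)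

text \<open>Only net points closer to x than e carry weight, so x minus the combination is a convex
  combination of vectors of norm at most e. The index j keeps the denominator positive.\<close>

lemma hat_weight:
  assumes j: "j < n" "norm (x - y j) < e"
  shows "i < n \<Longrightarrow> hat_weight e n y x i \<in> {0..1}"
    "norm (x - (\<Sum>i<n. hat_weight e n y x i *\<^sub>R y i)) \<le> e"
proof -
  note pos = hat_sum_pos[where y=y and j=j, OF j]
  have nn: "hat e y x i \<ge> 0" for i by (simp add: hat_def)
  show "hat_weight e n y x i \<in> {0..1}" if "i < n"
    using pos nn member_le_sum[of i "{..<n}" "hat e y x"] that by (simp add: hat_weight_def)
  have one: "(\<Sum>i<n. hat_weight e n y x i) = 1"
    using pos by (simp add: hat_weight_def sum_divide_distrib[symmetric])
  have "x - (\<Sum>i<n. hat_weight e n y x i *\<^sub>R y i) = (\<Sum>i<n. hat_weight e n y x i *\<^sub>R (x - y i))"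
    using one by (simp add: scaleR_diff_right sum_subtractf scaleR_left.sum[symmetric])
  also have "norm \<dots> \<le> (\<Sum>i<n. hat_weight e n y x i * e)"
  proof (rule order_trans[OF norm_sum sum_mono])
    fix i
    have "hat_weight e n y x i \<ge> 0" using pos nn by (simp add: hat_weight_def)
    moreover have "hat_weight e n y x i = 0 \<or> norm (x - y i) \<le> e"
      by (auto simp: hat_weight_def hat_def)
    ultimately show "norm (hat_weight e n y x i *\<^sub>R (x - y i)) \<le> hat_weight e n y x i * e"
      by (auto intro: mult_left_mono)
  qed
  also have "\<dots> = e" by (simp add: sum_distrib_right[symmetric] one)
  finally show "norm (x - (\<Sum>i<n. hat_weight e n y x i *\<^sub>R y i)) \<le> e" .
qed

lemma hat_weight_tendsto:
  assumes lim: "X \<longlonglongrightarrow> x" and j: "j < n" "norm (x - y j) < e"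
  shows "(\<lambda>k. hat_weight e n y (X k) i) \<longlonglongrightarrow> hat_weight e n y x i"
proof -
  have h: "(\<lambda>k. hat e y (X k) i) \<longlonglongrightarrow> hat e y x i" for i
    unfolding hat_def by (intro tendsto_intros lim)
  show ?thesis
    unfolding hat_weight_def by (intro tendsto_divide h tendsto_sum) (use hat_sum_pos[where y=y and j=j, OF j] in simp)
qed

section \<open>The fixed point argument for the controls\<close>

context nonlocal_problem
begin

lemma G_linear: "t \<ge> 0 \<Longrightarrow> bounded_linear (G t s)"
proof -
  assume t: "t \<ge> 0"
  have 1: "bounded_linear (\<lambda>x. if s \<in> {0..<\<tau> k} then c k *\<^sub>R T t (Op (S (\<tau> k - s) x)) else 0)" for k
  proof (cases "s \<in> {0..<\<tau> k}")
    case True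
    then have "bounded_linear (S (\<tau> k - s))" by (intro S_linear) simp
    then have "bounded_linear (\<lambda>x. c k *\<^sub>R T t (Op (S (\<tau> k - s) x)))"
      by (intro bounded_linear_const_scaleR bounded_linear_compose[OF T_linear[OF t]] bounded_linear_compose[OF Op_linear])
    then show ?thesis using True by simp
  next
    case False
    then show ?thesis by (simp only: False if_False bounded_linear_zero)
  qed
  have 2: "bounded_linear (\<lambda>x. if s \<in> {0..<t} then S (t - s) x else 0)"
    using S_linear[of "t - s"] by (cases "s \<in> {0..<t}") (simp_all only: if_True if_False bounded_linear_zero, simp)
  show ?thesis
    unfolding green_def[abs_def] by (intro bounded_linear_add bounded_linear_sum 1 2)
qed

lemma L_bochner: "p \<in> L2 a \<Longrightarrow> has_bochner (lebesgue_on {0..a}) (\<lambda>s. G a s (p s)) (L p)"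
  using L unfolding is_terminal_operator_def by blast

text \<open>Linearity of G(a,s) and, after pairing with y, of real integrals. The relation between
  the arguments is asked for almost everywhere, which is how
  \<open>bounded_clinear_L2_combination\<close> describes B.\<close>

lemma L_combination:
  fixes n :: nat
  assumes p: "p \<in> L2 a" and q: "q \<in> L2 a" and w: "\<And>i. i < n \<Longrightarrow> w i \<in> L2 a"
    and ae: "AE s in lebesgue_on {0..a}. p s = q s + (\<Sum>i<n. r i *\<^sub>R w i s)"
  shows "L p = L q + (\<Sum>i<n. r i *\<^sub>R L (w i))"
proof -
  let ?M = "lebesgue_on {0..a}"
  have "L p \<bullet> y = (L q + (\<Sum>i<n. r i *\<^sub>R L (w i))) \<bullet> y" for y
  proof -
    note hp = has_bochner_inner[OF L_bochner[OF p], of y]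
    have hq: "has_bochner_integral ?M (\<lambda>s. G a s (q s) \<bullet> y + (\<Sum>i<n. r i * (G a s (w i s) \<bullet> y)))
        (L q \<bullet> y + (\<Sum>i<n. r i * (L (w i) \<bullet> y)))"
      by (intro has_bochner_integral_add has_bochner_integral_sum has_bochner_integral_mult_right
          has_bochner_inner L_bochner q) (use w in auto)
    have "AE s in ?M. G a s (p s) \<bullet> y = G a s (q s) \<bullet> y + (\<Sum>i<n. r i * (G a s (w i s) \<bullet> y))"
      using ae
    proof eventually_elim
      case (elim s)
      interpret bounded_linear "G a s" using a by (intro G_linear) simp
      show ?case
        unfolding elim add sum scaleR by (simp add: inner_add_left inner_sum_left)
    qed
    then have "(\<integral>s. G a s (p s) \<bullet> y \<partial>?M) = (\<integral>s. G a s (q s) \<bullet> y + (\<Sum>i<n. r i * (G a s (w i s) \<bullet> y)) \<partial>?M)"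
      using hp hq by (intro integral_cong_AE) (auto simp: has_bochner_integral_iff dest: borel_measurable_integrable)
    then show ?thesis
      using hp hq by (simp add: has_bochner_integral_iff inner_add_left inner_sum_left)
  qed
  then show ?thesis
    by (metis inner_commute vector_eq_rdot)
qed

text \<open>The tolerance is halved: e / 2 for approximating z by L p0 and e / 2 for the net. At a
  fixed point l the deviation of the terminal value from L p0 is exactly the error of the Schauder
  projection of x l.\<close>

lemma approximate_controllability:
  fixes B :: "(real \<Rightarrow> 'u::complex_hilbert) \<Rightarrow> (real \<Rightarrow> 'e)" and f :: "real \<Rightarrow> 'e \<Rightarrow> 'e"
  defines "Y \<equiv> L2_topology a closure_of (B ` L2 a)"
  assumes \<alpha>2: "\<alpha> > 1 / 2" and B: "bounded_clinear_L2 a B"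
    and F: "\<And>z. z \<in> L2 a \<Longrightarrow> nemytskii f z \<in> L2 a"
    and A': "\<And>p. p \<in> L2 a \<Longrightarrow> \<exists>q\<in>B ` L2 a. L p = L q"
    and W: "is_solution_map a G f Y W" "W ` Y \<subseteq> L2 a"
      "continuous_map (subtopology (L2_topology a) Y) (L2_topology a) W"
    and M: "M \<ge> 0" "\<And>z. z \<in> L2 a \<Longrightarrow> L2_norm a (nemytskii f z) \<le> M"
    and e: "e > 0"
  shows "\<exists>v\<in>L2 a. mild_solution a G f (B v) (W (B v)) \<and> norm (W (B v) a - z) < e"
proof -
  have BL: "B v \<in> L2 a" if "v \<in> L2 a" for v
    using B that unfolding bounded_clinear_L2_def by blast
  have YL: "Y \<subseteq> L2 a"
    using closure_of_subset_topspace[of "L2_topology a"] by (simp add: Y_def)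
  have BY: "B v \<in> Y" if "v \<in> L2 a" for v
    using closure_of_subset[of "B ` L2 a" "L2_topology a"] BL that by (auto simp: Y_def)
  have mild: "mild_solution a G f (B v) (W (B v))" if "v \<in> L2 a" for v
    using W(1) BY[OF that] unfolding is_solution_map_def by blast
  have WL: "W (B v) \<in> L2 a" if "v \<in> L2 a" for v
    using W(2) BY[OF that] by blast
  define h where "h v = (\<lambda>s. B v s + nemytskii f (W (B v)) s)" for v
  have hL: "h v \<in> L2 a" if "v \<in> L2 a" for v
    unfolding h_def using BL F WL that by (intro L2_norm_add(1)) auto
  have bochner: "has_bochner (lebesgue_on {0..a}) (\<lambda>s. G t s (h v s)) (W (B v) t)" if "v \<in> L2 a" "t \<in> {0..a}" for v t
    using mild[OF that(1)] that(2) unfolding mild_solution_def h_def nemytskii_def by blast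
  have Wa: "W (B v) a = L (B v) + L (nemytskii f (W (B v)))" if v: "v \<in> L2 a" for v
  proof -
    have "W (B v) a = L (h v)"
      using a by (intro has_bochner_unique[OF bochner[OF v] L_bochner[OF hL[OF v]]]) auto
    also have "\<dots> = L (B v) + (\<Sum>i<(1::nat). 1 *\<^sub>R L (nemytskii f (W (B v))))"
      by (rule L_combination[OF hL[OF v] BL[OF v] F[OF WL[OF v]]]) (simp add: h_def)
    finally show ?thesis by simp
  qed
  obtain p0 where p0: "p0 \<in> L2 a" "norm (L p0 - z) < e / 2"
    using terminal_operator_dense[of "e / 2" z] e by auto
  obtain v0 where v0: "v0 \<in> L2 a" "L p0 = L (B v0)"
    using A'[OF p0(1)] by blast
  obtain N where N: "finite N" "N \<subseteq> {h \<in> L2 a. L2_norm a h \<le> M}"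
    "\<And>h. h \<in> L2 a \<Longrightarrow> L2_norm a h \<le> M \<Longrightarrow> \<exists>q\<in>N. norm (L h - L q) < e / 2"
    using terminal_totally_bounded[OF \<alpha>2 M(1), of "e / 2"] e by auto
  obtain n and g :: "nat \<Rightarrow> real \<Rightarrow> 'e" where g: "N = g ` {..<n}"
    using finite_imp_nat_seg_image_inj_on[OF N(1)] by (auto simp: lessThan_def)
  have "\<forall>i\<in>{..<n}. \<exists>v. v \<in> L2 a \<and> L (g i) = L (B v)"
  proof
    fix i assume "i \<in> {..<n}"
    then have "g i \<in> L2 a" using N(2) g by blast
    from A'[OF this] show "\<exists>v. v \<in> L2 a \<and> L (g i) = L (B v)" by blast
  qed
  from bchoice[OF this] obtain v where v: "\<And>i. i < n \<Longrightarrow> v i \<in> L2 a" "\<And>i. i < n \<Longrightarrow> L (g i) = L (B (v i))"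
    by auto
  define u where "u l = (\<lambda>s. v0 s + (\<Sum>i<n. (- l i) *\<^sub>R v i s))" for l
  have uL: "u l \<in> L2 a" and Bu: "AE t in lebesgue_on {0..a}. B (u l) t = B v0 t + (\<Sum>i<n. (- l i) *\<^sub>R B (v i) t)" for l
  proof -
    show "u l \<in> L2 a"
      unfolding u_def by (rule bounded_clinear_L2_combination(1)[OF B v0(1)]) (rule v(1))
    show "AE t in lebesgue_on {0..a}. B (u l) t = B v0 t + (\<Sum>i<n. (- l i) *\<^sub>R B (v i) t)"
      unfolding u_def by (rule bounded_clinear_L2_combination(2)[OF B v0(1)]) (rule v(1))
  qed
  have LBu: "L (B (u l)) = L p0 - (\<Sum>i<n. l i *\<^sub>R L (g i))" for l
  proof -
    have "L (B (u l)) = L (B v0) + (\<Sum>i<n. (- l i) *\<^sub>R L (B (v i)))"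
      by (rule L_combination[OF BL[OF uL] BL[OF v0(1)] _ Bu]) (intro BL v(1))
    also have "\<dots> = L p0 - (\<Sum>i<n. l i *\<^sub>R L (g i))"
      by (simp add: v0(2) v(2) sum_negf)
    finally show ?thesis .
  qed
  define x where "x l = L (nemytskii f (W (B (u l))))" for l
  \<comment> \<open>Solved for x l, the splitting of the terminal value shows that x depends on l
    through W (B (u l)) a and an affine term; continuity of x is read off from this form.\<close>
  have x: "x l = W (B (u l)) a - L p0 + (\<Sum>i<n. l i *\<^sub>R L (g i))" for l
    using Wa[OF uL, of l] LBu[of l] by (simp add: x_def)
  have net: "\<exists>j<n. norm (x l - L (g j)) < e / 2" for l
    using N(3)[OF F[OF WL[OF uL]] M(2)[OF WL[OF uL]]] by (auto simp: x_def g)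
  define cube where "cube l \<longleftrightarrow> (\<forall>j<n. l j \<in> {0..1})" for l :: "nat \<Rightarrow> real"
  \<comment> \<open>Bounds the forcing term h (u l) for every l in the cube, where the coefficients
    have modulus at most 1; equicontinuity needs one radius for the whole cube.\<close>
  define R where "R = L2_norm a (B v0) + (\<Sum>i<n. L2_norm a (B (v i))) + M"
  have R: "R \<ge> 0" unfolding R_def using M(1) by (intro add_nonneg_nonneg sum_nonneg L2_norm_nonneg)
  have comb: "L2_norm a (\<lambda>t. \<Sum>i<n. r i *\<^sub>R B (v i) t) \<le> (\<Sum>i<n. \<bar>r i\<bar> * L2_norm a (B (v i)))"
    "(\<lambda>t. \<Sum>i<n. r i *\<^sub>R B (v i) t) \<in> L2 a" for r
  proof -
    have m: "(\<lambda>t. r i *\<^sub>R B (v i) t) \<in> L2 a" if "i \<in> {..<n}" for i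
      using that by (intro L2_norm_scaleR(1) BL v(1)) simp
    show "(\<lambda>t. \<Sum>i<n. r i *\<^sub>R B (v i) t) \<in> L2 a"
      by (rule L2_sum(1)) (use m in auto)
    have "L2_norm a (\<lambda>t. \<Sum>i<n. r i *\<^sub>R B (v i) t) \<le> (\<Sum>i<n. L2_norm a (\<lambda>t. r i *\<^sub>R B (v i) t))"
      by (rule L2_sum(2)) (use m in auto)
    also have "\<dots> = (\<Sum>i<n. \<bar>r i\<bar> * L2_norm a (B (v i)))"
      by (intro sum.cong refl L2_norm_scaleR(2) BL v(1)) simp
    finally show "L2_norm a (\<lambda>t. \<Sum>i<n. r i *\<^sub>R B (v i) t) \<le> (\<Sum>i<n. \<bar>r i\<bar> * L2_norm a (B (v i)))" .
  qed
  have hR: "L2_norm a (h (u l)) \<le> R" if l: "cube l" for l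
  proof -
    have "L2_norm a (B (u l)) = L2_norm a (\<lambda>t. B v0 t + (\<Sum>i<n. (- l i) *\<^sub>R B (v i) t))"
      by (rule L2_norm_cong_AE[OF BL[OF uL] L2_norm_add(1)[OF BL[OF v0(1)] comb(2)] Bu])
    also have "\<dots> \<le> L2_norm a (B v0) + L2_norm a (\<lambda>t. \<Sum>i<n. (- l i) *\<^sub>R B (v i) t)"
      by (rule L2_norm_add(2)[OF BL[OF v0(1)] comb(2)])
    also have "\<dots> \<le> L2_norm a (B v0) + (\<Sum>i<n. \<bar>- l i\<bar> * L2_norm a (B (v i)))"
      by (intro add_left_mono comb(1))
    also have "\<dots> \<le> L2_norm a (B v0) + (\<Sum>i<n. 1 * L2_norm a (B (v i)))"
      using l by (intro add_left_mono sum_mono mult_right_mono L2_norm_nonneg) (auto simp: cube_def)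
    finally have "L2_norm a (B (u l)) \<le> L2_norm a (B v0) + (\<Sum>i<n. L2_norm a (B (v i)))" by simp
    moreover have "L2_norm a (h (u l)) \<le> L2_norm a (B (u l)) + L2_norm a (nemytskii f (W (B (u l))))"
      unfolding h_def by (rule L2_norm_add(2)[OF BL[OF uL] F[OF WL[OF uL]]])
    ultimately show ?thesis
      using M(2)[OF WL[OF uL]] by (simp add: R_def add_mono order_trans[OF _ add_mono])
  qed
  text \<open>Although the Nemytskii operator may be discontinuous, the terminal value depends continuously on the
    coefficients: the trajectories converge in \<open>L\<^sup>2\<close> and are equicontinuous at \<open>a\<close>.\<close>
  have cont_a: "(\<lambda>k. W (B (u (X k))) a) \<longlonglongrightarrow> W (B (u l)) a"
    if X: "\<And>k. cube (X k)" and l: "cube l" and lim: "\<And>j. j < n \<Longrightarrow> (\<lambda>k. X k j) \<longlonglongrightarrow> l j" for X l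
  proof (rule LIMSEQ_I)
    fix \<epsilon> :: real assume \<epsilon>: "\<epsilon> > 0"
    obtain d where d: "0 < d" "d \<le> a"
      and equi: "\<And>t h yt ya. t \<in> {a - d..a} \<Longrightarrow> h \<in> L2 a \<Longrightarrow> L2_norm a h \<le> R \<Longrightarrow>
      has_bochner (lebesgue_on {0..a}) (\<lambda>s. G t s (h s)) yt \<Longrightarrow>
      has_bochner (lebesgue_on {0..a}) (\<lambda>s. G a s (h s)) ya \<Longrightarrow> norm (yt - ya) \<le> \<epsilon> / 4"
      using terminal_equicontinuous[OF \<alpha>2 R, of "\<epsilon> / 4"] \<epsilon> by auto
    have eq: "norm (W (B (u l)) t - W (B (u l)) a) \<le> \<epsilon> / 4" if "cube l" "t \<in> {a - d..a}" for l t
      using that d by (intro equi[OF that(2) hL[OF uL] hR bochner[OF uL] bochner[OF uL]]) auto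
    \<comment> \<open>If the values at a differed by \<epsilon>, equicontinuity would cost at most
      \<epsilon> / 4 per trajectory, leaving a gap of \<epsilon> / 2 on [a - d, a] and hence an L2
      distance of at least sqrt d * (\<epsilon> / 2).\<close>
    have "sqrt d * (\<epsilon> / 2) > 0" using d \<epsilon> by simp
    then obtain r where r: "r > 0" "\<And>\<nu>. \<nu> \<in> Y \<Longrightarrow> L2_norm a (\<lambda>t. \<nu> t - B (u l) t) < r \<Longrightarrow>
        L2_norm a (\<lambda>t. W \<nu> t - W (B (u l)) t) < sqrt d * (\<epsilon> / 2)"
      using continuous_map_L2_ball[OF W(3) YL BY[OF uL]] by metis
    have "(\<lambda>k. \<Sum>i<n. \<bar>l i - X k i\<bar> * L2_norm a (B (v i))) \<longlonglongrightarrow> (\<Sum>i<n. \<bar>l i - l i\<bar> * L2_norm a (B (v i)))"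
      by (intro tendsto_intros lim) simp
    then have "\<forall>\<^sub>F k in sequentially. (\<Sum>i<n. \<bar>l i - X k i\<bar> * L2_norm a (B (v i))) < r"
      using r(1) by (intro order_tendstoD(2)) auto
    then obtain k0 where k0: "\<And>k. k \<ge> k0 \<Longrightarrow> (\<Sum>i<n. \<bar>l i - X k i\<bar> * L2_norm a (B (v i))) < r"
      unfolding eventually_sequentially by blast
    show "\<exists>k0. \<forall>k\<ge>k0. norm (W (B (u (X k))) a - W (B (u l)) a) < \<epsilon>"
    proof (intro exI[of _ k0] allI impI, rule ccontr)
      fix k assume k: "k \<ge> k0" and not: "\<not> norm (W (B (u (X k))) a - W (B (u l)) a) < \<epsilon>"
      have "AE t in lebesgue_on {0..a}. B (u (X k)) t - B (u l) t = (\<Sum>i<n. (l i - X k i) *\<^sub>R B (v i) t)"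
        using Bu[of "X k"] Bu[of l]
        by eventually_elim (simp add: sum_subtractf[symmetric] sum_negf[symmetric] scaleR_diff_left)
      then have "L2_norm a (\<lambda>t. B (u (X k)) t - B (u l) t) = L2_norm a (\<lambda>t. \<Sum>i<n. (l i - X k i) *\<^sub>R B (v i) t)"
        by (intro L2_norm_cong_AE L2_diff BL uL comb(2))
      also have "\<dots> < r"
        using comb(1)[of "\<lambda>i. l i - X k i"] k0[OF k] by simp
      finally have small: "L2_norm a (\<lambda>t. W (B (u (X k))) t - W (B (u l)) t) < sqrt d * (\<epsilon> / 2)"
        by (intro r(2) BY uL)
      have "sqrt d * (\<epsilon> / 2) \<le> L2_norm a (\<lambda>t. W (B (u (X k))) t - W (B (u l)) t)"
      proof (rule L2_norm_lower_bound)
        show "(\<lambda>t. W (B (u (X k))) t - W (B (u l)) t) \<in> L2 a"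
          by (intro L2_diff WL uL)
        fix t assume t: "t \<in> {a - d..a}"
        have "\<epsilon> \<le> norm (W (B (u (X k))) a - W (B (u l)) a)" using not by simp
        also have "W (B (u (X k))) a - W (B (u l)) a =
            (W (B (u (X k))) t - W (B (u l)) t) - (W (B (u (X k))) t - W (B (u (X k))) a) + (W (B (u l)) t - W (B (u l)) a)"
          by simp
        also have "norm \<dots> \<le> norm (W (B (u (X k))) t - W (B (u l)) t) + \<epsilon> / 4 + \<epsilon> / 4"
          by (intro order_trans[OF norm_triangle_ineq] add_mono order_trans[OF norm_triangle_ineq4]
              order_refl eq X l t)
        finally show "\<epsilon> / 2 \<le> norm (W (B (u (X k))) t - W (B (u l)) t)" by simp
      qed (use d \<epsilon> in auto)
      then show False using small by simp
    qed
  qed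
  define \<beta> where "\<beta> l = hat_weight (e / 2) n (\<lambda>i. L (g i)) (x l)" for l
  have "\<exists>l. \<forall>i<n. l i \<in> {0..1} \<and> \<beta> l i = l i"
  proof (rule brouwer_nat_cube)
    fix l :: "nat \<Rightarrow> real" and i assume i: "i < n"
    obtain j where j: "j < n" "norm (x l - L (g j)) < e / 2"
      using net[of l] by blast
    show "\<beta> l i \<in> {0..1}"
      unfolding \<beta>_def by (rule hat_weight(1)[where y="\<lambda>i. L (g i)", OF j i])
  next
    fix X :: "nat \<Rightarrow> nat \<Rightarrow> real" and l :: "nat \<Rightarrow> real" and i
    assume X: "\<And>k j. j < n \<Longrightarrow> X k j \<in> {0..1}" and l: "\<And>j. j < n \<Longrightarrow> l j \<in> {0..1}"
      and lim: "\<And>j. j < n \<Longrightarrow> (\<lambda>k. X k j) \<longlonglongrightarrow> l j" and "i < n"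
    have "(\<lambda>k. x (X k)) \<longlonglongrightarrow> x l"
      unfolding x by (intro tendsto_intros cont_a lim) (use X l in \<open>auto simp: cube_def\<close>)
    note lim_x = this
    obtain j where j: "j < n" "norm (x l - L (g j)) < e / 2"
      using net[of l] by blast
    show "(\<lambda>k. \<beta> (X k) i) \<longlonglongrightarrow> \<beta> l i"
      unfolding \<beta>_def by (rule hat_weight_tendsto[where y="\<lambda>i. L (g i)", OF lim_x j])
  qed
  then obtain l where l: "\<And>i. i < n \<Longrightarrow> \<beta> l i = l i" by blast
  obtain j where j: "j < n" "norm (x l - L (g j)) < e / 2"
    using net[of l] by blast
  have "norm (x l - (\<Sum>i<n. \<beta> l i *\<^sub>R L (g i))) \<le> e / 2"
    unfolding \<beta>_def by (rule hat_weight(2)[where y="\<lambda>i. L (g i)", OF j])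
  then have "norm (W (B (u l)) a - L p0) \<le> e / 2"
    using l by (simp add: x)
  then have "norm (W (B (u l)) a - z) < e"
    using p0(2) norm_triangle_ineq[of "W (B (u l)) a - L p0" "L p0 - z"] by simp
  then show ?thesis
    using uL mild by blast
qed

end

text \<open>Two solution operators are in play: \<open>analytic_class\<close> supplies its own, from
  which the estimates for S are derived, while the Green's function and the Neumann condition refer
  to the given T.\<close>

theorem theorem5p4:
  fixes \<alpha> a \<omega>\<^sub>0 \<theta>\<^sub>0 :: real
    and D :: "'e::complex_hilbert set" and A :: "'e \<Rightarrow> 'e"
    and Q T S :: "real \<Rightarrow> 'e \<Rightarrow> 'e"
    and B :: "(real \<Rightarrow> 'u::complex_hilbert) \<Rightarrow> (real \<Rightarrow> 'e)"
    and f :: "real \<Rightarrow> 'e \<Rightarrow> 'e"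
    and m :: nat and c \<tau> :: "nat \<Rightarrow> real"
    and L :: "(real \<Rightarrow> 'e) \<Rightarrow> 'e"
    and W :: "(real \<Rightarrow> 'e) \<Rightarrow> (real \<Rightarrow> 'e)"
  defines "G \<equiv> green T S m c \<tau>"
    and "RB \<equiv> B ` L2 a"
    and "RB_closure \<equiv> L2_topology a closure_of (B ` L2 a)"
  assumes "0 < \<alpha>" "\<alpha> < 1" "0 < a"
    and "C0_semigroup Q" "infinitesimal_generator D A Q"
    and "0 < \<theta>\<^sub>0" "\<theta>\<^sub>0 \<le> pi / 2" "analytic_class \<alpha> \<omega>\<^sub>0 \<theta>\<^sub>0 D A"
    and "solution_operator \<alpha> D A T" "\<And>t. t > 0 \<Longrightarrow> compact_operator (T t)"
    and "resolvent_operator \<alpha> D A S" "\<And>t. t > 0 \<Longrightarrow> compact_operator (S t)"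
    and "bounded_clinear_L2 a B"
    and "\<And>k. k \<in> {1..m} \<Longrightarrow> \<tau> k \<in> {0..a}"
    and "ennreal (\<Sum>k=1..m. \<bar>c k\<bar>) < 1 / sup_norm_solop T"
    and "is_terminal_operator a G L"
    and "\<And>z. z \<in> L2 a \<Longrightarrow> nemytskii f z \<in> L2 a"
    and A': "\<And>p. p \<in> L2 a \<Longrightarrow> \<exists>q\<in>RB. L p = L q"
    and B': "is_solution_map a G f RB_closure W"
            "compact_map_L2 a RB_closure W"
            "continuous_map (subtopology (L2_topology a) RB_closure) (L2_topology a) W"
    and C': "\<exists>M\<ge>0. \<forall>z\<in>L2 a. L2_norm a (nemytskii f z) \<le> M"
  shows "approximately_controllable a G f B"
proof -
  obtain C where C: "C \<ge> 0"
    "\<And>t x. 0 < t \<Longrightarrow> t \<le> a \<Longrightarrow> norm (S t x) \<le> C * t powr (\<alpha> - 1) * norm x"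
    "continuous_on {0<..a} (\<lambda>t. Blinfun (S t))"
    "\<And>x e. e > 0 \<Longrightarrow> \<exists>d>0. d \<le> a \<and> (\<forall>t y. 0 < t \<longrightarrow> t \<le> d \<longrightarrow>
       \<bar>(\<integral>s. indicator {0<..<t} s * (S s x \<bullet> y) \<partial>lborel) - t powr \<alpha> * (x \<bullet> y) / (\<alpha> * Gamma \<alpha>)\<bar>
         \<le> t powr \<alpha> * e * norm y)"
    by (rule resolvent_operator_estimates[OF \<open>0 < \<alpha>\<close> \<open>\<alpha> < 1\<close> \<open>0 < a\<close> \<open>0 < \<theta>\<^sub>0\<close> \<open>\<theta>\<^sub>0 \<le> pi / 2\<close>
          \<open>analytic_class \<alpha> \<omega>\<^sub>0 \<theta>\<^sub>0 D A\<close> \<open>resolvent_operator \<alpha> D A S\<close>]) (rule that)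
  obtain BT where BT: "BT \<ge> 0" "\<And>t. t \<ge> 0 \<Longrightarrow> onorm (T t) \<le> BT" "(\<Sum>k=1..m. \<bar>c k\<bar>) * BT < 1"
    using sup_norm_solop_bound[OF \<open>ennreal (\<Sum>k=1..m. \<bar>c k\<bar>) < 1 / sup_norm_solop T\<close>]
    by (auto simp: sum_nonneg)
  have T_linear: "bounded_linear (T t)" if "t \<ge> 0" for t
    using \<open>solution_operator \<alpha> D A T\<close> that unfolding solution_operator_def bounded_clinear_def by blast
  interpret nonlocal_problem \<alpha> a C BT T S m c \<tau> L
  proof (rule nonlocal_problem.intro)
    show "bounded_linear (S t)" if "t > 0" for t
      using \<open>resolvent_operator \<alpha> D A S\<close> that unfolding resolvent_operator_def bounded_clinear_def by blast
    show "continuous_on {0<..} (\<lambda>t. S t x)" for x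
      using \<open>resolvent_operator \<alpha> D A S\<close> unfolding resolvent_operator_def by blast
    show "compact (closure (S t ` V))" if "t > 0" "bounded V" for t V
    proof -
      have "compact_operator (S t)" using that(1) by fact
      then show ?thesis using that(2) unfolding compact_operator_def by blast
    qed
    show "continuous_on {0..} (\<lambda>t. T t x)" for x
      using \<open>solution_operator \<alpha> D A T\<close> unfolding solution_operator_def by blast
    show "norm (T t x) \<le> BT * norm x" if "t \<ge> 0" for t x
      by (rule order_trans[OF onorm[OF T_linear[OF that]] mult_right_mono[OF BT(2)[OF that]]]) simp
    show "is_terminal_operator a (green T S m c \<tau>) L"
      using \<open>is_terminal_operator a G L\<close> by (simp add: G_def)
    show "norm (S t x) \<le> C * t powr (\<alpha> - 1) * norm x" if "0 < t" "t \<le> a" for t x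
      by (rule C(2)[OF that])
    show "\<exists>d>0. d \<le> a \<and> (\<forall>t y. 0 < t \<longrightarrow> t \<le> d \<longrightarrow>
       \<bar>(\<integral>s. indicator {0<..<t} s * (S s x \<bullet> y) \<partial>lborel) - t powr \<alpha> * (x \<bullet> y) / (\<alpha> * Gamma \<alpha>)\<bar>
         \<le> t powr \<alpha> * e * norm y)" if "e > 0" for x e
      by (rule C(4)[OF that])
    show "bounded_linear (T t)" if "t \<ge> 0" for t
      by (rule T_linear[OF that])
    show "\<tau> k \<in> {0..a}" if "k \<in> {1..m}" for k
      using that by fact
  qed (rule C(1) C(3) BT(1) BT(3) \<open>0 < \<alpha>\<close> \<open>\<alpha> < 1\<close> \<open>0 < a\<close>)+
  obtain M where M: "M \<ge> 0" "\<And>z. z \<in> L2 a \<Longrightarrow> L2_norm a (nemytskii f z) \<le> M"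
    using C' by blast
  let ?X = "{u a |u v. v \<in> L2 a \<and> mild_solution a G f (B v) u}"
  have "closure ?X = UNIV"
  \<comment> \<open>The bound \<alpha> > 1/2 comes from testing L on a nonzero vector, so the zero
    space is treated apart; there it is enough that some mild solution exists.\<close>
  proof (cases "\<exists>x::'e. x \<noteq> 0")
    case True
    then have \<alpha>2: "\<alpha> > 1 / 2" using alpha_gt_half by blast
    have "\<exists>y\<in>?X. dist y z < e" if e: "e > 0" for z e
    proof -
      have "\<exists>v\<in>L2 a. mild_solution a (green T S m c \<tau>) f (B v) (W (B v)) \<and> norm (W (B v) a - z) < e"
      proof (rule approximate_controllability[OF \<alpha>2 \<open>bounded_clinear_L2 a B\<close> _ _ _ _ _ M e])
        show "nemytskii f z \<in> L2 a" if "z \<in> L2 a" for z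
          using that by fact
        show "\<exists>q\<in>B ` L2 a. L p = L q" if "p \<in> L2 a" for p
          using A'[OF that] by (simp add: RB_def)
        show "is_solution_map a (green T S m c \<tau>) f (L2_topology a closure_of B ` L2 a) W"
          using B'(1) by (simp add: G_def RB_closure_def)
        show "W ` (L2_topology a closure_of B ` L2 a) \<subseteq> L2 a"
          using B'(2) by (simp add: compact_map_L2_def RB_closure_def)
        show "continuous_map (subtopology (L2_topology a) (L2_topology a closure_of B ` L2 a)) (L2_topology a) W"
          using B'(3) by (simp add: RB_closure_def)
      qed
      then show ?thesis by (auto simp: G_def dist_norm)
    qed
    then show ?thesis
      by (auto simp: closure_approachable)
  next
    case False
    have "(\<lambda>t. 0) \<in> L2 a" by (rule L2_zero)
    moreover have "B (\<lambda>t. 0) \<in> RB_closure"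
      using closure_of_subset[of "B ` L2 a" "L2_topology a"] \<open>bounded_clinear_L2 a B\<close> L2_zero
      by (auto simp: RB_closure_def bounded_clinear_L2_def)
    ultimately have mem: "W (B (\<lambda>t. 0)) a \<in> ?X"
      using B'(1) unfolding is_solution_map_def by blast
    have zero: "y = 0" for y :: 'e
      using False by blast
    have "y \<in> ?X" for y :: 'e
      by (rule subst[where P="\<lambda>y. y \<in> ?X", OF trans[OF zero zero[symmetric]] mem])
    then show ?thesis using closure_subset by blast
  qed
  then show ?thesis
    by (simp add: approximately_controllable_def)
qed

end
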